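(* Assume that at least one of the following two sets of conditions holds. (a) The set $\widetilde{\mathcal W}$ (defined in the context) is a basis of $\mathbb C^k$, and for some $\lambda\ge0$ the following holds for all $\mathsf v\in\mathsf V$ and all $\xi\in Y_{\mathsf v}$: $T_{\mathsf v}\xi\cdot\bar\xi+2\,\mathrm{Re}(Q_{\mathsf v}B_{\mathsf v}\xi\cdot\bar\xi)-\lambda\,Q_{\mathsf v}P^{(d)}_{\mathsf v}\xi\cdot\overline{P^{(d)}_{\mathsf v}\xi}\le0$. (b) For some $\lambda,\mu\ge0$ the following holds for all $\mathsf v\in\mathsf V$: the inequality $T_{\mathsf v}\xi\cdot\bar\xi+2\,\mathrm{Re}(Q_{\mathsf v}B_{\mathsf v}\xi\cdot\bar\xi)-\lambda\,Q_{\mathsf v}P^{(d)}_{\mathsf v}\xi\cdot\overline{P^{(d)}_{\mathsf v}\xi}\le0$ holds for all $\xi\in Y^{(d)}_{\mathsf v}$; and the quadratic form on $\mathbb C^{k_{\mathsf v}}\oplus Y^{(d)}_{\mathsf v}$ (with Euclidean inner product) associated with $$\begin{pmatrix}-T_{\mathsf v}-2\mu & T_{\mathsf v}\\ P^{(d)}_{\mathsf v}T_{\mathsf v} & (P^{(d)}_{\mathsf v}B_{\mathsf v}^*-\mu\,\mathrm{Id})Q_{\mathsf v}+Q_{\mathsf v}(B_{\mathsf v}-\mu\,\mathrm{Id})\end{pmatrix}$$ is nonpositive on the subspace $\mathbb Y^*_{\mathsf v}$ (defined in the context). Suppose that $$\mathrm{Re}\,\xi\in\bigoplus_{\mathsf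 v\in\mathsf V}Y_{\mathsf v}\ \text{ for all }\xi\in\bigoplus_{\mathsf v\in\mathsf V}Y_{\mathsf v}\qquad\text{and}\qquad \mathrm{Re}\,\mathsf x\in\bigoplus_{\mathsf v\in\mathsf V}Y^{(d)}_{\mathsf v}\ \text{ for all }\mathsf x\in\bigoplus_{\mathsf v\in\mathsf V}Y^{(d)}_{\mathsf v},$$ that the matrix-valued mapping $Q_{\mathsf e}$ is real-valued for all $\mathsf e\in\mathsf E$, and that the matrices $Q_{\mathsf v},B_{\mathsf v},C_{\mathsf v}$ are real for all $\mathsf v\in\mathsf V$. Then the semigroup generated by $\mathbb A$ is real if the matrix-valued mappings $M_{\mathsf e},N_{\mathsf e}$ are real-valued for all $\mathsf e\in\mathsf E$.
   Context: Graph. $\mathsf G=(\mathsf V,\mathsf E)$ is a nonempty finite graph, each edge $\mathsf e$ being oriented (with an initial and a terminal endpoint) and identified with an interval $[0,\ell_{\mathsf e}]$, $\ell_{\mathsf e}>0$, where $0$ corresponds to the initial and $\ell_{\mathsf e}$ to the terminal endpoint. $(k_{\mathsf e})_{\mathsf e\in\mathsf E}$ are positive integers, $\mathsf E_{\mathsf v}$ is the set of edges incident with $\mathsf v$, $k:=\sum_{\mathsf e\in\mathsf E}k_{\mathsf e}$, $k_{\mathsf v}:=\sum_{\mathsf e\in\mathsf E_{\mathsf v}}k_{\mathsf e}$, so that $\sum_{\mathsf v\in\mathsf V}k_{\mathsf v}=2k$. Let $\iota_{\mathsf v\mathsf e}=1$ if $\mathsf v$ is the terminal endpoint of $\mathsf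 e$, $-1$ if it is the initial endpoint, and $0$ otherwise. For a function $f$ on $[0,\ell_{\mathsf e}]$, $f(\mathsf v)$ is its value at the endpoint corresponding to $\mathsf v$. Coefficients. For each $\mathsf e$: $M_{\mathsf e}:[0,\ell_{\mathsf e}]\to M_{k_{\mathsf e}}(\mathbb C)$ is Lipschitz continuous with $M_{\mathsf e}(x)$ invertible for every $x$; $N_{\mathsf e}:[0,\ell_{\mathsf e}]\to M_{k_{\mathsf e}}(\mathbb C)$ is of class $L^\infty$; $Q_{\mathsf e}:[0,\ell_{\mathsf e}]\to M_{k_{\mathsf e}}(\mathbb C)$ is Lipschitz continuous, $Q_{\mathsf e}(x)$ and $Q_{\mathsf e}(x)M_{\mathsf e}(x)$ are Hermitian for all $x$, and there is $q>0$ with $Q_{\mathsf e}(x)\xi\cdot\bar\xi\ge q\|\xi\|^2$ for all $\xi\in\mathbb C^{k_{\mathsf e}}$ and all $x$. Here $M_n(\mathbb C)$ is the space of complex $n\times n$ matrices and $a\cdot b=\sum_i a_ib_i$. Vertex data. For each $\mathsf v\in\mathsf V$: $Y^{(d)}_{\mathsf v}\subset Y_{\mathsf v}$ are subspaces of $\mathbb C^{k_{\mathsf v}}$; $B_{\mathsf v}:Y_{\mathsf v}\to Y^{(d)}_{\mathsf v}$ and $C_{\mathsf v}:Y^{(d)}_{\mathsf v}\to Y^{(d)}_{\mathsf v}$ are linear; $Q_{\mathsf v}$ is a Hermitian positive definite operator on $Y^{(d)}_{\mathsf v}$. Calling such an operator between subspaces a real matrix means that it is the restriction of a real matrix. Adjoints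 ($B_{\mathsf v}^*:Y^{(d)}_{\mathsf v}\to Y_{\mathsf v}$) and orthogonality are with respect to the Euclidean inner product. $P^{(d)}_{\mathsf v}$ is the orthogonal projector of $\mathbb C^{k_{\mathsf v}}$ onto $Y^{(d)}_{\mathsf v}$, $P^{(d),\perp}_{\mathsf v}$ is the orthogonal projector onto the orthogonal complement of $Y^{(d)}_{\mathsf v}$ in $Y_{\mathsf v}$, and $U^\perp$ is the orthogonal complement of $U$ in $\mathbb C^{k_{\mathsf v}}$. Put $\gamma_{\mathsf v}(u):=(u_{\mathsf e}(\mathsf v))_{\mathsf e\in\mathsf E_{\mathsf v}}\in\mathbb C^{k_{\mathsf v}}$ and $T_{\mathsf v}:=\mathrm{diag}\big(Q_{\mathsf e}(\mathsf v)M_{\mathsf e}(\mathsf v)\iota_{\mathsf v\mathsf e}\big)_{\mathsf e\in\mathsf E_{\mathsf v}}$. Let $\mathbb Y^*_{\mathsf v}:=\{(\xi,\mathsf y)\in\mathbb C^{k_{\mathsf v}}\oplus Y^{(d)}_{\mathsf v}:\ P^{(d),\perp}_{\mathsf v}T_{\mathsf v}\xi+P^{(d),\perp}_{\mathsf v}B_{\mathsf v}^*Q_{\mathsf v}\mathsf y=0\}$. Spaces and operator. $\mathbf L^2(\mathcal G):=\bigoplus_{\mathsf e}L^2(0,\ell_{\mathsf e})^{k_{\mathsf e}}$, $Y^{(d)}:=\bigoplus_{\mathsf v}Y^{(d)}_{\mathsf v}$, and $\mathbf L^2_d(\mathcal G):=\mathbf L^2(\mathcal G)\oplus Y^{(d)}$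 with inner product $\big((u,\mathsf x),(v,\mathsf y)\big)_d=\sum_{\mathsf e}\int_0^{\ell_{\mathsf e}}Q_{\mathsf e}u_{\mathsf e}\cdot\bar v_{\mathsf e}\,dx+\sum_{\mathsf v}Q_{\mathsf v}\mathsf x_{\mathsf v}\cdot\bar{\mathsf y}_{\mathsf v}$. With $D_{\max}:=\bigoplus_{\mathsf e}H^1(0,\ell_{\mathsf e})^{k_{\mathsf e}}$, the operator $\mathbb A$ on $\mathbf L^2_d(\mathcal G)$ has domain $$D(\mathbb A)=\{(u,\mathsf x)\in D_{\max}\oplus Y^{(d)}:\ \gamma_{\mathsf v}(u)\in Y_{\mathsf v}\text{ and }\mathsf x_{\mathsf v}=P^{(d)}_{\mathsf v}\gamma_{\mathsf v}(u)\text{ for all }\mathsf v\in\mathsf V\}$$ and acts as $\mathbb A(u,\mathsf x)=\big((M_{\mathsf e}u_{\mathsf e}'+N_{\mathsf e}u_{\mathsf e})_{\mathsf e\in\mathsf E},\ (B_{\mathsf v}\gamma_{\mathsf v}(u)+C_{\mathsf v}\mathsf x_{\mathsf v})_{\mathsf v\in\mathsf V}\big)$. A semigroup on $\mathbf L^2_d(\mathcal G)$ is real if it leaves invariant the set of those $(u,\mathsf x)\in\mathbf L^2_d(\mathcal G)$ for which $u$ is real-valued a.e. and $\mathsf x$ has real entries. The set $\widetilde{\mathcal W}$. For each $\mathsf v$ fix bases $\{\mathsf w^{(\mathsf v,i)}\}_i$ of $Y_{\mathsf v}^\perp$, $\{\mathsf y^{(\mathsf v,j)}\}_j$ of $\mathrm{Ran}\,B_{\mathsf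 v}$, and $\{\mathsf w^{(\mathsf v,l)}_{KB^*}\}_l$ of $\mathrm{Ker}\,B_{\mathsf v}^*\subset Y^{(d)}_{\mathsf v}$, and let $\mathsf w^{(\mathsf v,j)}_{RB^*}:=B_{\mathsf v}^*\mathsf y^{(\mathsf v,j)}$. For $\mathsf w\in\mathbb C^{k_{\mathsf v}}$, written as $(\mathsf w_{\mathsf e})_{\mathsf e\in\mathsf E_{\mathsf v}}$, let $\widetilde{\mathsf w}\in\mathbb C^k$ be its extension by $0$ to the components $\mathsf e\notin\mathsf E_{\mathsf v}$. Then $\widetilde{\mathcal W}$ is the set (over all $\mathsf v\in\mathsf V$ and all indices $i,j,l$) of all the vectors $\widetilde{\mathsf w}^{(\mathsf v,i)}$, $\widetilde{\mathsf w}^{(\mathsf v,j)}_{RB^*}$, $\widetilde{\mathsf w}^{(\mathsf v,l)}_{KB^*}$ in $\mathbb C^k$.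
   Formalization: That 𝔸 generates a strongly continuous semigroup is assumed, not derived from (a) or (b): as stated, (b) does not ensure it (one edge, M=Q=1, N=0, Y_v=ℂ and Y_v^(d)={0} at both ends satisfies (b), but 𝔸=d/dx on all of H¹ generates no semigroup). *)

theory Defs
  imports
    "HOL-Analysis.Analysis"
    "HOL-Library.Function_Algebras"
    "HOL-Library.FuncSet"
    "Graph_Theory.Digraph"
    "Jordan_Normal_Form.Matrix"
    "Jordan_Normal_Form.Schur_Decomposition"
begin

no_notation vec_nth (infixl \<open>$\<close> 90)
no_notation inner (infix \<open>\<bullet>\<close> 70)

section \<open>Finite-dimensional spaces with an arbitrary index set\<close>

text \<open>
  For a finite index set \<open>I\<close>, the space \<open>\<complex>\<^sup>I\<close> is rendered as the set of functions that vanish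
  outside \<open>I\<close>.  With this encoding the extension by \<open>0\<close> from \<open>\<complex>\<^sup>I\<close> to \<open>\<complex>\<^sup>J\<close>, for \<open>I \<subseteq> J\<close>, is
  the inclusion map.
\<close>

definition cscale :: "complex \<Rightarrow> ('i \<Rightarrow> complex) \<Rightarrow> 'i \<Rightarrow> complex" where
  "cscale c f = (\<lambda>j. c * f j)"

interpretation cfun: vector_space "cscale :: complex \<Rightarrow> ('i \<Rightarrow> complex) \<Rightarrow> 'i \<Rightarrow> complex"
  by unfold_locales (auto simp: cscale_def fun_eq_iff algebra_simps)

definition cspace :: "'i set \<Rightarrow> ('i \<Rightarrow> complex) set" where
  "cspace I = {\<xi>. \<forall>j. j \<notin> I \<longrightarrow> \<xi> j = 0}"

text \<open>The Euclidean inner product \<open>\<xi> \<cdot> conj \<eta>\<close>, antilinear in the second argument.\<close>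

definition ip :: "'i set \<Rightarrow> ('i \<Rightarrow> complex) \<Rightarrow> ('i \<Rightarrow> complex) \<Rightarrow> complex" where
  "ip I \<xi> \<eta> = (\<Sum>j\<in>I. \<xi> j * cnj (\<eta> j))"

definition orth :: "'i set \<Rightarrow> ('i \<Rightarrow> complex) set \<Rightarrow> ('i \<Rightarrow> complex) set" where
  "orth I U = {\<xi> \<in> cspace I. \<forall>\<eta>\<in>U. ip I \<xi> \<eta> = 0}"

definition proj :: "'i set \<Rightarrow> ('i \<Rightarrow> complex) set \<Rightarrow> ('i \<Rightarrow> complex) \<Rightarrow> 'i \<Rightarrow> complex" where
  "proj I U \<xi> = (THE \<eta>. \<eta> \<in> U \<and> (\<forall>\<zeta>\<in>U. ip I (\<xi> - \<eta>) \<zeta> = 0))"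

definition linear_between ::
  "('i \<Rightarrow> complex) set \<Rightarrow> ('i \<Rightarrow> complex) set \<Rightarrow> (('i \<Rightarrow> complex) \<Rightarrow> 'i \<Rightarrow> complex) \<Rightarrow> bool" where
  "linear_between U W F \<longleftrightarrow>
     (\<forall>\<xi>\<in>U. F \<xi> \<in> W) \<and>
     (\<forall>\<xi>\<in>U. \<forall>\<eta>\<in>U. F (\<xi> + \<eta>) = F \<xi> + F \<eta>) \<and>
     (\<forall>c. \<forall>\<xi>\<in>U. F (cscale c \<xi>) = cscale c (F \<xi>))"

text \<open>The adjoint \<open>W \<rightarrow> U\<close> of a linear map \<open>F : U \<rightarrow> W\<close> between subspaces of \<open>\<complex>\<^sup>I\<close>.\<close>

definition adj :: "'i set \<Rightarrow> ('i \<Rightarrow> complex) set \<Rightarrow> (('i \<Rightarrow> complex) \<Rightarrow> 'i \<Rightarrow> complex)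
    \<Rightarrow> ('i \<Rightarrow> complex) \<Rightarrow> 'i \<Rightarrow> complex" where
  "adj I U F y = (THE z. z \<in> U \<and> (\<forall>\<xi>\<in>U. ip I (F \<xi>) y = ip I \<xi> z))"

definition real_matrix_on :: "'i set \<Rightarrow> ('i \<Rightarrow> complex) set \<Rightarrow> (('i \<Rightarrow> complex) \<Rightarrow> 'i \<Rightarrow> complex) \<Rightarrow> bool" where
  "real_matrix_on I U F \<longleftrightarrow>
     (\<exists>R :: 'i \<Rightarrow> 'i \<Rightarrow> real. \<forall>\<xi>\<in>U. \<forall>i\<in>I. F \<xi> i = (\<Sum>j\<in>I. complex_of_real (R i j) * \<xi> j))"

definition is_basis :: "('i \<Rightarrow> complex) set \<Rightarrow> ('i \<Rightarrow> complex) set \<Rightarrow> bool" where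
  "is_basis A U \<longleftrightarrow> cfun.independent A \<and> cfun.span A = U"


section \<open>Function spaces on an interval\<close>

definition L2 :: "real \<Rightarrow> (real \<Rightarrow> complex) set" where
  "L2 l = {f. f \<in> borel_measurable (lebesgue_on {0..l}) \<and>
              integrable (lebesgue_on {0..l}) (\<lambda>s. (cmod (f s))\<^sup>2)}"

definition Linfty :: "real \<Rightarrow> (real \<Rightarrow> complex) set" where
  "Linfty l = {f. f \<in> borel_measurable (lebesgue_on {0..l}) \<and>
                  (\<exists>c. AE s in lebesgue_on {0..l}. cmod (f s) \<le> c)}"

text \<open>Smooth functions with compact support in the open interval \<open>(0, l)\<close>.\<close>

definition test_function :: "real \<Rightarrow> (real \<Rightarrow> real) \<Rightarrow> bool" where
  "test_function l \<phi> \<longleftrightarrow>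
     (\<forall>n. ((deriv ^^ n) \<phi>) differentiable_on UNIV) \<and>
     (\<exists>a b. 0 < a \<and> b < l \<and> (\<forall>s. s \<notin> {a..b} \<longrightarrow> \<phi> s = 0))"

definition weak_derivative :: "real \<Rightarrow> (real \<Rightarrow> complex) \<Rightarrow> (real \<Rightarrow> complex) \<Rightarrow> bool" where
  "weak_derivative l f g \<longleftrightarrow>
     (\<forall>\<phi>. test_function l \<phi> \<longrightarrow>
        (LINT s|lebesgue_on {0..l}. f s * complex_of_real (deriv \<phi> s)) =
        - (LINT s|lebesgue_on {0..l}. g s * complex_of_real (\<phi> s)))"

text \<open>
  An element of \<open>H\<^sup>1(0, l)\<close> is represented by its continuous representative on \<open>[0, l]\<close>, so that
  its endpoint values are plain function values.
\<close>

definition H1 :: "real \<Rightarrow> (real \<Rightarrow> complex) set" where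
  "H1 l = {f \<in> L2 l. continuous_on {0..l} f \<and> (\<exists>g\<in>L2 l. weak_derivative l f g)}"


section \<open>Strongly continuous semigroups\<close>

text \<open>
  The elements of the space are given by representatives \<open>f \<in> X\<close>; two representatives denote the
  same element iff their distance in the (semi)norm \<open>nrm\<close> is \<open>0\<close>, and all identities are to be
  read in this sense.  Boundedness makes the operators well defined on the elements.
\<close>

definition C0_semigroup :: "('a::ab_group_add) set \<Rightarrow> (complex \<Rightarrow> 'a \<Rightarrow> 'a) \<Rightarrow> ('a \<Rightarrow> real) \<Rightarrow>
    (real \<Rightarrow> 'a \<Rightarrow> 'a) \<Rightarrow> bool" where
  "C0_semigroup X sc nrm S \<longleftrightarrow>
     (\<forall>t\<ge>0. \<forall>f\<in>X. S t f \<in> X) \<and>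
     (\<forall>t\<ge>0. \<forall>f\<in>X. \<forall>g\<in>X. nrm (S t (f + g) - (S t f + S t g)) = 0) \<and>
     (\<forall>t\<ge>0. \<forall>c. \<forall>f\<in>X. nrm (S t (sc c f) - sc c (S t f)) = 0) \<and>
     (\<forall>t\<ge>0. \<exists>K. \<forall>f\<in>X. nrm (S t f) \<le> K * nrm f) \<and>
     (\<forall>f\<in>X. nrm (S 0 f - f) = 0) \<and>
     (\<forall>s\<ge>0. \<forall>t\<ge>0. \<forall>f\<in>X. nrm (S (s + t) f - S s (S t f)) = 0) \<and>
     (\<forall>f\<in>X. ((\<lambda>t. nrm (S t f - f)) \<longlongrightarrow> 0) (at_right 0))"

text \<open>The infinitesimal generator, as a graph.\<close>

definition generator :: "('a::ab_group_add) set \<Rightarrow> (complex \<Rightarrow> 'a \<Rightarrow> 'a) \<Rightarrow> ('a \<Rightarrow> real) \<Rightarrow>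
    (real \<Rightarrow> 'a \<Rightarrow> 'a) \<Rightarrow> ('a \<times> 'a) set" where
  "generator X sc nrm S =
     {(f, g). f \<in> X \<and> g \<in> X \<and>
        ((\<lambda>h. nrm (sc (complex_of_real (1 / h)) (S h f - f) - g)) \<longlongrightarrow> 0) (at_right 0)}"

text \<open>
  \<open>S\<close> is a strongly continuous semigroup whose generator is the operator with graph \<open>A\<close>
  (the graph being closed up under changing representatives).
\<close>

definition generated_by :: "('a::ab_group_add) set \<Rightarrow> (complex \<Rightarrow> 'a \<Rightarrow> 'a) \<Rightarrow> ('a \<Rightarrow> real) \<Rightarrow>
    ('a \<times> 'a) set \<Rightarrow> (real \<Rightarrow> 'a \<Rightarrow> 'a) \<Rightarrow> bool" where
  "generated_by X sc nrm A S \<longleftrightarrow>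
     C0_semigroup X sc nrm S \<and>
     generator X sc nrm S =
       {(f, g). f \<in> X \<and> g \<in> X \<and> (\<exists>(f', g')\<in>A. nrm (f - f') = 0 \<and> nrm (g - g') = 0)}"


section \<open>The network\<close>

text \<open>
  Component \<open>i < ncomp e\<close> of the edge \<open>e\<close> has index \<open>(e, i)\<close>.  Operators between
  subspaces of \<open>\<complex>\<^bsup>k\<^sub>v\<^esup>\<close> are total functions of which only the restriction to their domain matters.
\<close>

record ('v, 'e) network =
  graph :: "('v, 'e) pre_digraph"
  len :: "'e \<Rightarrow> real"
  ncomp :: "'e \<Rightarrow> nat"
  Me :: "'e \<Rightarrow> real \<Rightarrow> complex mat"
  Ne :: "'e \<Rightarrow> real \<Rightarrow> complex mat"
  Qe :: "'e \<Rightarrow> real \<Rightarrow> complex mat"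
  Yv :: "'v \<Rightarrow> ('e \<times> nat \<Rightarrow> complex) set"
  Yd :: "'v \<Rightarrow> ('e \<times> nat \<Rightarrow> complex) set"
  Bv :: "'v \<Rightarrow> ('e \<times> nat \<Rightarrow> complex) \<Rightarrow> ('e \<times> nat \<Rightarrow> complex)"
  Cv :: "'v \<Rightarrow> ('e \<times> nat \<Rightarrow> complex) \<Rightarrow> ('e \<times> nat \<Rightarrow> complex)"
  Qv :: "'v \<Rightarrow> ('e \<times> nat \<Rightarrow> complex) \<Rightarrow> ('e \<times> nat \<Rightarrow> complex)"

abbreviation Vs :: "('v, 'e) network \<Rightarrow> 'v set" where
  "Vs \<N> \<equiv> verts (graph \<N>)"

abbreviation Es :: "('v, 'e) network \<Rightarrow> 'e set" where
  "Es \<N> \<equiv> arcs (graph \<N>)"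

definition Ev :: "('v, 'e) network \<Rightarrow> 'v \<Rightarrow> 'e set" where
  "Ev \<N> v = {e \<in> Es \<N>. tail (graph \<N>) e = v \<or> head (graph \<N>) e = v}"

text \<open>\<open>cspace (idx \<N>)\<close> and \<open>cspace (idxv \<N> v)\<close> are \<open>\<complex>\<^sup>k\<close> and \<open>\<complex>\<^bsup>k\<^sub>v\<^esup>\<close>.\<close>

definition idx :: "('v, 'e) network \<Rightarrow> ('e \<times> nat) set" where
  "idx \<N> = {(e, i). e \<in> Es \<N> \<and> i < ncomp \<N> e}"

definition idxv :: "('v, 'e) network \<Rightarrow> 'v \<Rightarrow> ('e \<times> nat) set" where
  "idxv \<N> v = {(e, i). e \<in> Ev \<N> v \<and> i < ncomp \<N> e}"

definition iota :: "('v, 'e) network \<Rightarrow> 'v \<Rightarrow> 'e \<Rightarrow> complex" where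
  "iota \<N> v e = (if e \<in> Es \<N> \<and> head (graph \<N>) e = v then 1
                 else if e \<in> Es \<N> \<and> tail (graph \<N>) e = v then - 1 else 0)"

text \<open>The point of \<open>[0, len e]\<close> that corresponds to the endpoint \<open>v\<close> of \<open>e\<close>.\<close>

definition endpt :: "('v, 'e) network \<Rightarrow> 'v \<Rightarrow> 'e \<Rightarrow> real" where
  "endpt \<N> v e = (if head (graph \<N>) e = v then len \<N> e else 0)"

definition block :: "('v, 'e) network \<Rightarrow> 'e \<Rightarrow> ('e \<times> nat \<Rightarrow> complex) \<Rightarrow> complex vec" where
  "block \<N> e \<xi> = Matrix.vec (ncomp \<N> e) (\<lambda>i. \<xi> (e, i))"

definition lipschitz_mat :: "real \<Rightarrow> nat \<Rightarrow> (real \<Rightarrow> complex mat) \<Rightarrow> bool" where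
  "lipschitz_mat l n F \<longleftrightarrow>
     (\<forall>s\<in>{0..l}. F s \<in> carrier_mat n n) \<and>
     (\<forall>i<n. \<forall>j<n. \<exists>K. K-lipschitz_on {0..l} (\<lambda>s. F s $$ (i, j)))"

definition Linfty_mat :: "real \<Rightarrow> nat \<Rightarrow> (real \<Rightarrow> complex mat) \<Rightarrow> bool" where
  "Linfty_mat l n F \<longleftrightarrow>
     (\<forall>s\<in>{0..l}. F s \<in> carrier_mat n n) \<and>
     (\<forall>i<n. \<forall>j<n. (\<lambda>s. F s $$ (i, j)) \<in> Linfty l)"

text \<open>The standing assumptions on the graph, the coefficients and the vertex data.\<close>

definition network :: "('v, 'e) network \<Rightarrow> bool" where
  "network \<N> \<longleftrightarrow>
     fin_digraph (graph \<N>) \<and> loopfree_digraph (graph \<N>) \<and> Vs \<N> \<noteq> {} \<and>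
     (\<forall>e\<in>Es \<N>.
        len \<N> e > 0 \<and> ncomp \<N> e > 0 \<and>
        lipschitz_mat (len \<N> e) (ncomp \<N> e) (Me \<N> e) \<and>
        (\<forall>s\<in>{0..len \<N> e}. invertible_mat (Me \<N> e s)) \<and>
        Linfty_mat (len \<N> e) (ncomp \<N> e) (Ne \<N> e) \<and>
        lipschitz_mat (len \<N> e) (ncomp \<N> e) (Qe \<N> e) \<and>
        (\<forall>s\<in>{0..len \<N> e}. mat_adjoint (Qe \<N> e s) = Qe \<N> e s \<and>
           mat_adjoint (Qe \<N> e s * Me \<N> e s) = Qe \<N> e s * Me \<N> e s) \<and>
        (\<exists>q>0. \<forall>s\<in>{0..len \<N> e}. \<forall>\<xi>\<in>carrier_vec (ncomp \<N> e).
           Re ((Qe \<N> e s *\<^sub>v \<xi>) \<bullet>c \<xi>) \<ge> q * Re (\<xi> \<bullet>c \<xi>))) \<and>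
     (\<forall>v\<in>Vs \<N>.
        cfun.subspace (Yv \<N> v) \<and> cfun.subspace (Yd \<N> v) \<and>
        Yd \<N> v \<subseteq> Yv \<N> v \<and> Yv \<N> v \<subseteq> cspace (idxv \<N> v) \<and>
        linear_between (Yv \<N> v) (Yd \<N> v) (Bv \<N> v) \<and>
        linear_between (Yd \<N> v) (Yd \<N> v) (Cv \<N> v) \<and>
        linear_between (Yd \<N> v) (Yd \<N> v) (Qv \<N> v) \<and>
        (\<forall>x\<in>Yd \<N> v. \<forall>y\<in>Yd \<N> v.
           ip (idxv \<N> v) (Qv \<N> v x) y = ip (idxv \<N> v) x (Qv \<N> v y)) \<and>
        (\<forall>x\<in>Yd \<N> v. x \<noteq> 0 \<longrightarrow> Re (ip (idxv \<N> v) (Qv \<N> v x) x) > 0))"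

definition Bstar :: "('v, 'e) network \<Rightarrow> 'v \<Rightarrow> ('e \<times> nat \<Rightarrow> complex) \<Rightarrow> 'e \<times> nat \<Rightarrow> complex" where
  "Bstar \<N> v = adj (idxv \<N> v) (Yv \<N> v) (Bv \<N> v)"

definition Pd :: "('v, 'e) network \<Rightarrow> 'v \<Rightarrow> ('e \<times> nat \<Rightarrow> complex) \<Rightarrow> 'e \<times> nat \<Rightarrow> complex" where
  "Pd \<N> v = proj (idxv \<N> v) (Yd \<N> v)"

text \<open>The projector onto the orthogonal complement of \<open>Yd\<close> in \<open>Yv\<close> (not in the whole space).\<close>

definition Pd_perp :: "('v, 'e) network \<Rightarrow> 'v \<Rightarrow> ('e \<times> nat \<Rightarrow> complex) \<Rightarrow> 'e \<times> nat \<Rightarrow> complex" where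
  "Pd_perp \<N> v = proj (idxv \<N> v) (Yv \<N> v \<inter> orth (idxv \<N> v) (Yd \<N> v))"

definition gamma :: "('v, 'e) network \<Rightarrow> 'v \<Rightarrow> ('e \<times> nat \<Rightarrow> real \<Rightarrow> complex) \<Rightarrow> 'e \<times> nat \<Rightarrow> complex" where
  "gamma \<N> v u = (\<lambda>(e, i). if (e, i) \<in> idxv \<N> v then u (e, i) (endpt \<N> v e) else 0)"

definition Tv :: "('v, 'e) network \<Rightarrow> 'v \<Rightarrow> ('e \<times> nat \<Rightarrow> complex) \<Rightarrow> 'e \<times> nat \<Rightarrow> complex" where
  "Tv \<N> v \<xi> = (\<lambda>(e, i). if (e, i) \<in> idxv \<N> v
      then iota \<N> v e *
           ((Qe \<N> e (endpt \<N> v e) * Me \<N> e (endpt \<N> v e)) *\<^sub>v block \<N> e \<xi>) $ i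
      else 0)"


section \<open>The state space and the operator\<close>

type_synonym ('v, 'e) state = "('e \<times> nat \<Rightarrow> real \<Rightarrow> complex) \<times> ('v \<Rightarrow> 'e \<times> nat \<Rightarrow> complex)"

definition L2d :: "('v, 'e) network \<Rightarrow> ('v, 'e) state set" where
  "L2d \<N> = {(u, x). (\<forall>(e, i)\<in>idx \<N>. u (e, i) \<in> L2 (len \<N> e)) \<and> x \<in> Pi (Vs \<N>) (Yd \<N>)}"

definition scale_d :: "complex \<Rightarrow> ('v, 'e) state \<Rightarrow> ('v, 'e) state" where
  "scale_d c = (\<lambda>(u, x). (\<lambda>j s. c * u j s, \<lambda>v j. c * x v j))"

definition inner_d :: "('v, 'e) network \<Rightarrow> ('v, 'e) state \<Rightarrow> ('v, 'e) state \<Rightarrow> complex" where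
  "inner_d \<N> = (\<lambda>(u, x) (w, y).
     (\<Sum>e\<in>Es \<N>. LINT s|lebesgue_on {0..len \<N> e}.
        (Qe \<N> e s *\<^sub>v block \<N> e (\<lambda>j. u j s)) \<bullet>c block \<N> e (\<lambda>j. w j s)) +
     (\<Sum>v\<in>Vs \<N>. ip (idxv \<N> v) (Qv \<N> v (x v)) (y v)))"

definition norm_d :: "('v, 'e) network \<Rightarrow> ('v, 'e) state \<Rightarrow> real" where
  "norm_d \<N> f = sqrt (Re (inner_d \<N> f f))"

definition dom_A :: "('v, 'e) network \<Rightarrow> ('v, 'e) state set" where
  "dom_A \<N> = {(u, x). (\<forall>(e, i)\<in>idx \<N>. u (e, i) \<in> H1 (len \<N> e)) \<and> x \<in> Pi (Vs \<N>) (Yd \<N>) \<and>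
     (\<forall>v\<in>Vs \<N>. gamma \<N> v u \<in> Yv \<N> v \<and> x v = Pd \<N> v (gamma \<N> v u))}"

text \<open>The operator as its graph; \<open>u'\<close> is the weak derivative of \<open>u\<close>, unique up to null sets.\<close>

definition op_A :: "('v, 'e) network \<Rightarrow> (('v, 'e) state \<times> ('v, 'e) state) set" where
  "op_A \<N> = {((u, x), (f, y)). (u, x) \<in> dom_A \<N> \<and>
     (\<exists>u'. (\<forall>(e, i)\<in>idx \<N>. u' (e, i) \<in> L2 (len \<N> e) \<and>
              weak_derivative (len \<N> e) (u (e, i)) (u' (e, i))) \<and>
           (\<forall>(e, i)\<in>idx \<N>. AE s in lebesgue_on {0..len \<N> e}.
              f (e, i) s = (Me \<N> e s *\<^sub>v block \<N> e (\<lambda>j. u' j s) +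
                            Ne \<N> e s *\<^sub>v block \<N> e (\<lambda>j. u j s)) $ i)) \<and>
     (\<forall>v\<in>Vs \<N>. y v = Bv \<N> v (gamma \<N> v u) + Cv \<N> v (x v))}"

definition generated_semigroup ::
  "('v, 'e) network \<Rightarrow> (real \<Rightarrow> ('v, 'e) state \<Rightarrow> ('v, 'e) state) \<Rightarrow> bool" where
  "generated_semigroup \<N> S \<longleftrightarrow> generated_by (L2d \<N>) scale_d (norm_d \<N>) (op_A \<N>) S"

definition real_states :: "('v, 'e) network \<Rightarrow> ('v, 'e) state set" where
  "real_states \<N> = {(u, x) \<in> L2d \<N>.
     (\<forall>(e, i)\<in>idx \<N>. AE s in lebesgue_on {0..len \<N> e}. u (e, i) s \<in> \<real>) \<and>
     (\<forall>v\<in>Vs \<N>. \<forall>j\<in>idxv \<N> v. x v j \<in> \<real>)}"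

definition real_semigroup ::
  "('v, 'e) network \<Rightarrow> (real \<Rightarrow> ('v, 'e) state \<Rightarrow> ('v, 'e) state) \<Rightarrow> bool" where
  "real_semigroup \<N> S \<longleftrightarrow> (\<forall>t\<ge>0. \<forall>f\<in>real_states \<N>. S t f \<in> real_states \<N>)"


section \<open>The conditions at the vertices\<close>

definition vertex_bases :: "('v, 'e) network \<Rightarrow> ('v \<Rightarrow> ('e \<times> nat \<Rightarrow> complex) set) \<Rightarrow>
    ('v \<Rightarrow> ('e \<times> nat \<Rightarrow> complex) set) \<Rightarrow> ('v \<Rightarrow> ('e \<times> nat \<Rightarrow> complex) set) \<Rightarrow> bool" where
  "vertex_bases \<N> W YB WK \<longleftrightarrow>
     (\<forall>v\<in>Vs \<N>. is_basis (W v) (orth (idxv \<N> v) (Yv \<N> v)) \<and>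
                is_basis (YB v) (Bv \<N> v ` Yv \<N> v) \<and>
                is_basis (WK v) {y \<in> Yd \<N> v. Bstar \<N> v y = 0})"

definition W_tilde :: "('v, 'e) network \<Rightarrow> ('v \<Rightarrow> ('e \<times> nat \<Rightarrow> complex) set) \<Rightarrow>
    ('v \<Rightarrow> ('e \<times> nat \<Rightarrow> complex) set) \<Rightarrow> ('v \<Rightarrow> ('e \<times> nat \<Rightarrow> complex) set) \<Rightarrow>
    ('e \<times> nat \<Rightarrow> complex) set" where
  "W_tilde \<N> W YB WK = (\<Union>v\<in>Vs \<N>. W v \<union> Bstar \<N> v ` YB v \<union> WK v)"

definition vertex_form :: "('v, 'e) network \<Rightarrow> real \<Rightarrow> 'v \<Rightarrow> ('e \<times> nat \<Rightarrow> complex) \<Rightarrow> real" where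
  "vertex_form \<N> c v \<xi> =
     Re (ip (idxv \<N> v) (Tv \<N> v \<xi>) \<xi>) +
     2 * Re (ip (idxv \<N> v) (Qv \<N> v (Bv \<N> v \<xi>)) \<xi>) -
     c * Re (ip (idxv \<N> v) (Qv \<N> v (Pd \<N> v \<xi>)) (Pd \<N> v \<xi>))"

definition Y_star :: "('v, 'e) network \<Rightarrow> 'v \<Rightarrow>
    (('e \<times> nat \<Rightarrow> complex) \<times> ('e \<times> nat \<Rightarrow> complex)) set" where
  "Y_star \<N> v = {(\<xi>, y). \<xi> \<in> cspace (idxv \<N> v) \<and> y \<in> Yd \<N> v \<and>
     Pd_perp \<N> v (Tv \<N> v \<xi>) + Pd_perp \<N> v (Bstar \<N> v (Qv \<N> v y)) = 0}"

text \<open>The two summands are the two rows of the block operator applied to \<open>(\<xi>, y)\<close>, paired with \<open>\<xi>\<close> and \<open>y\<close>.\<close>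

definition dual_form :: "('v, 'e) network \<Rightarrow> real \<Rightarrow> 'v \<Rightarrow>
    ('e \<times> nat \<Rightarrow> complex) \<Rightarrow> ('e \<times> nat \<Rightarrow> complex) \<Rightarrow> real" where
  "dual_form \<N> \<mu> v \<xi> y =
     Re (ip (idxv \<N> v)
       ((- Tv \<N> v \<xi> - cscale (complex_of_real (2 * \<mu>)) \<xi>) + Tv \<N> v y) \<xi>) +
     Re (ip (idxv \<N> v)
       (Pd \<N> v (Tv \<N> v \<xi>) +
        ((Pd \<N> v (Bstar \<N> v (Qv \<N> v y)) - cscale (complex_of_real \<mu>) (Qv \<N> v y)) +
         Qv \<N> v (Bv \<N> v y - cscale (complex_of_real \<mu>) y))) y)"

definition re_vec :: "('v \<Rightarrow> 'i \<Rightarrow> complex) \<Rightarrow> 'v \<Rightarrow> 'i \<Rightarrow> complex" where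
  "re_vec x = (\<lambda>v j. complex_of_real (Re (x v j)))"

end

theory Submission
  imports Defs
begin

text \<open>
  Let \<open>J\<close> be the pointwise complex conjugation of states (\<open>cnj_state\<close>).  A state is real if and only if it is fixed by \<open>J\<close>
  up to null sets, so the claim is that the semigroup \<open>S\<close> commutes with \<open>J\<close>.  The operators
  \<open>J S(t) J\<close> again form a strongly continuous semigroup, whose generator is \<open>J A J\<close>.  Because all coefficients
  and all vertex matrices are real, and because the spaces \<open>Y\<^sub>v\<close>, \<open>Y\<^sub>v\<^sup>d\<close>, which are closed under real parts,
  are closed under conjugation, the operator satisfies \<open>J A J = A\<close>
  (\<open>cnj_state_op_A\<close>).  A strongly continuous semigroup is determined by its generator
  (\<open>generator_determines_semigroup\<close>), so \<open>J S(t) J = S(t)\<close>.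

  The uniqueness theorem is proved for complete spaces with a seminorm, whose elements are
  representatives of classes of functions.  It rests on three facts.  First, a strongly continuous semigroup
  is bounded on compact time intervals; this is the uniform boundedness principle (\<open>uniform_boundedness\<close>,
  \<open>locally_bounded\<close>).  Secondly, the domain of the generator is dense, since it contains the
  integral means of all orbits (\<open>generator_dense\<close>).  Thirdly, if two semigroups \<open>S\<close> and \<open>R\<close> have the
  same generator, then for \<open>f\<close> in its domain the curve \<open>s \<mapsto> S(t - s) R(s) f\<close> is continuous with vanishing right
  derivative and is therefore constant, so that its end values \<open>S(t) f\<close> and \<open>R(t) f\<close> agree.

  It remains to see that \<open>L2d\<close> is complete for \<open>norm_d\<close> (\<open>banach_L2d\<close>).  On the
  edges \<open>Q\<^sub>e\<close> is bounded above and below, so this is the completeness of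
  \<open>L\<^sup>2\<close> (\<open>square_integrable_fast_limit\<close>); at the vertices \<open>Q\<^sub>v\<close> is an inner product on a finite-dimensional space,
  where coordinates with respect to an orthonormal basis converge (\<open>finite_inner_space\<close>).
\<close>

section \<open>Seminormed spaces and the uniform boundedness principle\<close>

text \<open>
  Function classes are handled through representatives: \<open>x\<close> and \<open>y\<close> stand for the same element
  if \<open>nrm (x - y) = 0\<close>.  Hence only a seminorm is required, on a subspace \<open>X\<close> of a vector space
  whose operations are defined everywhere.
\<close>

locale seminormed_space = vector_space sc
  for sc :: "complex \<Rightarrow> 'a::ab_group_add \<Rightarrow> 'a" +
  fixes X :: "'a set" and nrm :: "'a \<Rightarrow> real"
  assumes X_subspace: "subspace X"
    and nrm_triangle: "\<And>x y. x \<in> X \<Longrightarrow> y \<in> X \<Longrightarrow> nrm (x + y) \<le> nrm x + nrm y"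
    and nrm_sc: "\<And>c x. x \<in> X \<Longrightarrow> nrm (sc c x) = cmod c * nrm x"
begin

lemma X_0 [simp]: "0 \<in> X"
  and X_add [simp]: "x \<in> X \<Longrightarrow> y \<in> X \<Longrightarrow> x + y \<in> X"
  and X_diff [simp]: "x \<in> X \<Longrightarrow> y \<in> X \<Longrightarrow> x - y \<in> X"
  and X_sc [simp]: "x \<in> X \<Longrightarrow> sc c x \<in> X"
  and X_minus [simp]: "x \<in> X \<Longrightarrow> - x \<in> X"
  using X_subspace by (auto intro: subspace_0 subspace_add subspace_diff subspace_scale subspace_neg)

lemma X_sum [simp]: "(\<And>i. i \<in> I \<Longrightarrow> x i \<in> X) \<Longrightarrow> sum x I \<in> X"
  using X_subspace by (rule subspace_sum)

lemma nrm_0 [simp]: "nrm 0 = 0"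
  using nrm_sc[of 0 0] by simp

lemma nrm_minus [simp]: "x \<in> X \<Longrightarrow> nrm (- x) = nrm x"
  using nrm_sc[of x "-1"] by simp

lemma nrm_minus_commute: "x \<in> X \<Longrightarrow> y \<in> X \<Longrightarrow> nrm (x - y) = nrm (y - x)"
  using nrm_minus[of "x - y"] by simp

lemma nrm_nonneg [simp]: "x \<in> X \<Longrightarrow> 0 \<le> nrm x"
  using nrm_triangle[of x "- x"] by simp

lemma nrm_diff: "x \<in> X \<Longrightarrow> y \<in> X \<Longrightarrow> nrm (x - y) \<le> nrm x + nrm y"
  using nrm_triangle[of x "- y"] by simp

lemma nrm_via: "x \<in> X \<Longrightarrow> y \<in> X \<Longrightarrow> z \<in> X \<Longrightarrow> nrm (x - z) \<le> nrm (x - y) + nrm (y - z)"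
  using nrm_triangle[of "x - y" "y - z"] by simp

lemma nrm_le_via: "x \<in> X \<Longrightarrow> y \<in> X \<Longrightarrow> nrm x \<le> nrm (x - y) + nrm y"
  using nrm_triangle[of "x - y" "y"] by simp

lemma nrm_diff_diff:
  "x \<in> X \<Longrightarrow> y \<in> X \<Longrightarrow> x' \<in> X \<Longrightarrow> y' \<in> X \<Longrightarrow> nrm (x - y - (x' - y')) \<le> nrm (x - x') + nrm (y - y')"
  using nrm_diff[of "x - x'" "y - y'"] by (simp add: algebra_simps)

lemma nrm_sum_le: "(\<And>i. i \<in> I \<Longrightarrow> x i \<in> X) \<Longrightarrow> nrm (sum x I) \<le> (\<Sum>i\<in>I. nrm (x i))"
proof (induction I rule: infinite_finite_induct)
  case (insert i I)
  then show ?case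
    using nrm_triangle[of "x i" "sum x I"] by (fastforce intro: order_trans)
qed auto

lemma nrm_sc_real: "x \<in> X \<Longrightarrow> nrm (sc (complex_of_real r) x) = \<bar>r\<bar> * nrm x"
  by (simp add: nrm_sc)

lemma null_sym: "x \<in> X \<Longrightarrow> y \<in> X \<Longrightarrow> nrm (x - y) = 0 \<Longrightarrow> nrm (y - x) = 0"
  using nrm_minus_commute[of x y] by simp

lemma null_trans:
  assumes "x \<in> X" "y \<in> X" "z \<in> X" "nrm (x - y) = 0" "nrm (y - z) = 0"
  shows "nrm (x - z) = 0"
  using nrm_via[of x y z] assms nrm_nonneg[of "x - z"] by (simp add: order_antisym)

lemma null_sc: "x \<in> X \<Longrightarrow> y \<in> X \<Longrightarrow> nrm (x - y) = 0 \<Longrightarrow> nrm (sc c x - sc c y) = 0"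
  using nrm_sc[of "x - y" c] by (simp add: scale_right_diff_distrib)

end

text \<open>
  Every Cauchy sequence has a subsequence with increments at most \<open>2\<^sup>-\<^sup>n\<close>, so this condition is
  equivalent to completeness.
\<close>

locale banach_seminormed_space = seminormed_space +
  assumes fast_Cauchy: "\<And>x :: nat \<Rightarrow> _. (\<And>n. x n \<in> X) \<Longrightarrow>
    (\<And>n. nrm (x (Suc n) - x n) \<le> (1/2) ^ n) \<Longrightarrow> \<exists>z\<in>X. (\<lambda>n. nrm (x n - z)) \<longlonglongrightarrow> 0"
begin

text \<open>
  The principle is stated for seminorms \<open>p n\<close>, in applications \<open>p n x = nrm (T\<^sub>n x)\<close>, because the operators
  \<open>T\<^sub>n\<close> are linear only up to null elements while these seminorms satisfy exact laws.  If no common bound exists, then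
  the \<open>p n\<close> are unbounded on every ball, and nested balls on which some \<open>p n\<close> exceeds \<open>1, 2, 3, \<dots>\<close>
  shrink to a point where the family is unbounded.
\<close>

lemma uniform_boundedness:
  fixes p :: "nat \<Rightarrow> 'a \<Rightarrow> real"
  assumes p_triangle: "\<And>n x y. x \<in> X \<Longrightarrow> y \<in> X \<Longrightarrow> p n (x + y) \<le> p n x + p n y"
    and p_sc: "\<And>n c x. x \<in> X \<Longrightarrow> p n (sc c x) = cmod c * p n x"
    and p_le: "\<And>n. \<exists>K. \<forall>x\<in>X. p n x \<le> K * nrm x"
    and p_bdd: "\<And>x. x \<in> X \<Longrightarrow> \<exists>C. \<forall>n. p n x \<le> C"
  shows "\<exists>K. \<forall>n. \<forall>x\<in>X. p n x \<le> K * nrm x"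
proof (rule ccontr)
  assume "\<not> ?thesis"
  then have unb: "\<exists>n. \<exists>x\<in>X. p n x > K * nrm x" for K by (auto simp: not_le)
  have p_0: "p n 0 = 0" for n using p_sc[of 0 n 0] by simp
  have p_minus: "p n (- x) = p n x" if "x \<in> X" for n x
    using p_sc[OF that, of n "-1"] by simp
  have p_nonneg: "0 \<le> p n x" if "x \<in> X" for n x
    using p_triangle[of x "- x" n] that by (simp add: p_minus p_0)
  have unb_ball: "\<exists>n. \<exists>y\<in>X. nrm (y - x) \<le> r \<and> p n y > B" if "x \<in> X" "r > 0" for x r B
  proof -
    obtain n f where f: "f \<in> X" "p n f > (B / r) * nrm f" and f2: "p n f > 0"
    proof -
      obtain n f where nf: "f \<in> X" "p n f > (\<bar>B\<bar> / r) * nrm f" using unb by blast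
      have "0 \<le> (\<bar>B\<bar> / r) * nrm f" using nf \<open>r > 0\<close> by simp
      moreover have "(B / r) * nrm f \<le> (\<bar>B\<bar> / r) * nrm f"
        using nf \<open>r > 0\<close> by (intro mult_right_mono divide_right_mono) auto
      ultimately show ?thesis using nf that[of f n] by linarith
    qed
    obtain K where K: "\<And>x. x \<in> X \<Longrightarrow> p n x \<le> K * nrm x" using p_le by blast
    have pos: "nrm f > 0"
      using K[OF f(1)] f2 nrm_nonneg[OF f(1)] by (cases "nrm f = 0") auto
    define g where "g = sc (complex_of_real (r / nrm f)) f"
    have g: "g \<in> X" "nrm g = r" using f pos \<open>r > 0\<close> by (auto simp: g_def nrm_sc norm_divide)
    have pg: "p n g > B"
    proof -
      have "p n g = r / nrm f * p n f" using f pos \<open>r > 0\<close> by (simp add: g_def p_sc norm_divide)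
      also have "\<dots> > r / nrm f * ((B / r) * nrm f)"
        using f pos \<open>r > 0\<close> by (intro mult_strict_left_mono) auto
      also have "r / nrm f * ((B / r) * nrm f) = B" using pos \<open>r > 0\<close> by simp
      finally show ?thesis .
    qed
    \<comment> \<open>One of the two points \<open>x + g\<close>, \<open>x - g\<close> carries at least the value \<open>p n g\<close>.\<close>
    have "2 * p n g = p n (sc 2 g)" using p_sc[OF g(1), of n 2] by simp
    also have "sc 2 g = (x + g) + - (x - g)"
      using scale_left_distrib[of 1 1 g] by simp
    also have "p n \<dots> \<le> p n (x + g) + p n (- (x - g))"
      using that g by (intro p_triangle X_minus) auto
    also have "p n (- (x - g)) = p n (x - g)" using that g by (intro p_minus) auto
    finally have "p n (x + g) > B \<or> p n (x - g) > B" using pg by linarith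
    moreover have "nrm (x + g - x) \<le> r" "nrm (x - g - x) \<le> r" using g by auto
    ultimately show ?thesis using that g by (meson X_add X_diff)
  qed
  define P where "P = (\<lambda>j (x, r). x \<in> X \<and> r > 0 \<and> r \<le> (1/2) ^ j \<and>
     (j > 0 \<longrightarrow> (\<exists>n. \<forall>y\<in>X. nrm (y - x) \<le> r \<longrightarrow> p n y > real j)))"
  define Q where "Q = (\<lambda>(j::nat) (x, r) (x', r'). nrm (x' - x) + r' \<le> (r::real))"
  \<comment> \<open>Centre and radius of the \<open>j\<close>-th ball; \<open>Q\<close> says that the next ball lies inside.\<close>
  have "\<exists>xr. \<forall>j. P j (xr j) \<and> Q j (xr j) (xr (Suc j))"
  proof (rule dependent_nat_choice)
    show "\<exists>x. P 0 x" by (rule exI[of _ "(0, 1)"]) (auto simp: P_def)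
  next
    fix xr and j :: nat
    assume "P j xr"
    then obtain x r where xr: "xr = (x, r)" "x \<in> X" "r > 0" "r \<le> (1/2) ^ j"
      by (cases xr) (auto simp: P_def)
    from unb_ball[of x "r / 2" "real (Suc j) + 1"] xr obtain n y
      where y: "y \<in> X" "nrm (y - x) \<le> r / 2" "p n y > real (Suc j) + 1" by auto
    obtain K where K: "\<And>x. x \<in> X \<Longrightarrow> p n x \<le> K * nrm x" using p_le by blast
    \<comment> \<open>A ball of radius \<open>1 / K\<close> changes \<open>p n\<close> by at most one, which is the margin in the choice of \<open>y\<close>.\<close>
    define r' where "r' = min (r / 2) (1 / (\<bar>K\<bar> + 1))"
    have r': "r' > 0" "r' \<le> r / 2" "r' \<le> 1 / (\<bar>K\<bar> + 1)" using xr by (auto simp: r'_def)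
    have "p n w > real (Suc j)" if w: "w \<in> X" "nrm (w - y) \<le> r'" for w
    proof -
      have "p n (y - w) \<le> K * nrm (y - w)" using w y by (intro K) auto
      also have "\<dots> \<le> (\<bar>K\<bar> + 1) * (1 / (\<bar>K\<bar> + 1))"
        using w y r' by (intro mult_mono) (auto simp: nrm_minus_commute)
      also have "\<dots> = 1" by simp
      finally have "p n (y - w) \<le> 1" .
      moreover have "p n y \<le> p n w + p n (y - w)" using p_triangle[of w "y - w" n] w y by simp
      ultimately show ?thesis using y by linarith
    qed
    then have "P (Suc j) (y, r')" using r' y xr unfolding P_def by auto
    moreover have "Q j xr (y, r')" using r' y xr by (simp add: Q_def)
    ultimately show "\<exists>xr'. P (Suc j) xr' \<and> Q j xr xr'" by blast
  qed
  then obtain xr where xr: "\<And>j. P j (xr j)" "\<And>j. Q j (xr j) (xr (Suc j))" by blast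
  define x where "x j = fst (xr j)" for j
  define r where "r j = snd (xr j)" for j
  have x: "x j \<in> X" and r: "r j > 0" "r j \<le> (1/2) ^ j" for j
    using xr(1)[of j] by (auto simp: P_def x_def r_def case_prod_beta)
  have step: "nrm (x (Suc j) - x j) + r (Suc j) \<le> r j" for j
    using xr(2)[of j] by (auto simp: Q_def x_def r_def case_prod_beta)
  have "nrm (x (Suc j) - x j) \<le> (1/2) ^ j" for j using step[of j] r[of j] r[of "Suc j"] by linarith
  with fast_Cauchy[of x] x obtain z where z: "z \<in> X" "(\<lambda>n. nrm (x n - z)) \<longlonglongrightarrow> 0" by blast
  have nested: "nrm (x (j + i) - x j) + r (j + i) \<le> r j" for i j
  proof (induction i)
    case (Suc i)
    have "nrm (x (j + Suc i) - x j) \<le> nrm (x (j + Suc i) - x (j + i)) + nrm (x (j + i) - x j)"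
      using x by (intro nrm_via) auto
    then show ?case using step[of "j + i"] Suc by simp
  qed simp
  have "nrm (z - x j) \<le> r j" for j
  proof (rule LIMSEQ_le_const)
    show "(\<lambda>i. nrm (x (i + j) - z) + r j) \<longlonglongrightarrow> r j"
      using tendsto_add[OF LIMSEQ_ignore_initial_segment[OF z(2), of j] tendsto_const[of "r j"]] by simp
    have "nrm (z - x j) \<le> nrm (x (i + j) - z) + r j" for i
      using nrm_via[of z "x (i + j)" "x j"] nested[of j i] r(1)[of "j + i"] x z
      by (simp add: nrm_minus_commute[of z] add.commute)
    then show "\<exists>N. \<forall>n\<ge>N. nrm (z - x j) \<le> nrm (x (n + j) - z) + r j" by blast
  qed
  then have big: "\<exists>n. p n z > real j" if "j > 0" for j
    using xr(1)[of j] that z(1) by (auto simp: P_def x_def r_def case_prod_beta)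
  obtain C where C: "\<And>n. p n z \<le> C" using p_bdd z by blast
  obtain j where "real j > max C 0" using reals_Archimedean2 by blast
  with big[of j] C show False by (auto simp: not_less[symmetric] dest: order.strict_trans)
qed

end

section \<open>Strongly continuous semigroups on a complete seminormed space\<close>

text \<open>
  Both hypotheses are one-sided.  For \<open>\<epsilon> > 0\<close> let \<open>\<sigma>\<close> be the supremum of the times with \<open>\<psi> s \<le> \<epsilon> s\<close>: the condition
  from the left puts \<open>\<sigma>\<close> itself into this set, and the condition on the right derivative lets
  one step beyond \<open>\<sigma>\<close> unless \<open>\<sigma> = t\<close>.
\<close>

lemma nonpos_of_zero_right_derivative:
  fixes \<psi> :: "real \<Rightarrow> real"
  assumes t: "0 \<le> t" and start: "\<psi> 0 \<le> 0"
    and right: "\<And>s \<epsilon>. 0 \<le> s \<Longrightarrow> s < t \<Longrightarrow> \<epsilon> > 0 \<Longrightarrow>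
      \<exists>d>0. \<forall>h. 0 < h \<and> h < d \<and> s + h \<le> t \<longrightarrow> \<psi> (s + h) \<le> \<psi> s + \<epsilon> * h"
    and left: "\<And>s \<epsilon>. 0 < s \<Longrightarrow> s \<le> t \<Longrightarrow> \<epsilon> > 0 \<Longrightarrow>
      \<exists>d>0. \<forall>h. 0 < h \<and> h < d \<and> h \<le> s \<longrightarrow> \<psi> s \<le> \<psi> (s - h) + \<epsilon>"
  shows "\<psi> t \<le> 0"
proof -
  have bound: "\<psi> t \<le> \<epsilon> * t" if \<epsilon>: "\<epsilon> > 0" for \<epsilon>
  proof -
    define A where "A = {s. 0 \<le> s \<and> s \<le> t \<and> \<psi> s \<le> \<epsilon> * s}"
    define \<sigma> where "\<sigma> = Sup A"
    have A0: "0 \<in> A" using t start by (simp add: A_def)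
    have bdd: "bdd_above A" by (rule bdd_aboveI[of _ t]) (simp add: A_def)
    have upper: "s \<le> \<sigma>" if "s \<in> A" for s
      unfolding \<sigma>_def using that bdd by (rule cSup_upper)
    have "\<sigma> \<le> t"
      unfolding \<sigma>_def using A0 by (intro cSup_least) (auto simp: A_def)
    with upper[OF A0] have \<sigma>: "0 \<le> \<sigma>" "\<sigma> \<le> t" by auto
    have "\<psi> \<sigma> \<le> \<epsilon> * \<sigma>"
    proof (rule field_le_epsilon)
      fix e :: real assume "e > 0"
      show "\<psi> \<sigma> \<le> \<epsilon> * \<sigma> + e"
      proof (cases "\<sigma> \<in> A")
        case True then show ?thesis using \<open>e > 0\<close> by (simp add: A_def)
      next
        case False
        then have "\<sigma> > 0" using A0 \<sigma> by (cases "\<sigma> = 0") auto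
        from left[OF this \<sigma>(2) \<open>e > 0\<close>] obtain d
          where d: "d > 0" "\<And>h. 0 < h \<Longrightarrow> h < d \<Longrightarrow> h \<le> \<sigma> \<Longrightarrow> \<psi> \<sigma> \<le> \<psi> (\<sigma> - h) + e" by blast
        obtain s where s: "s \<in> A" "\<sigma> - d < s"
          using less_cSup_iff[OF _ bdd, of "\<sigma> - d"] A0 d(1) unfolding \<sigma>_def by auto
        have "s < \<sigma>" using s False upper[of s] by (cases "s = \<sigma>") auto
        then have "\<psi> \<sigma> \<le> \<psi> (\<sigma> - (\<sigma> - s)) + e"
          using s by (intro d(2)) (auto simp: A_def)
        also have "\<dots> \<le> \<epsilon> * s + e" using s by (simp add: A_def)
        also have "\<dots> \<le> \<epsilon> * \<sigma> + e" using \<open>s < \<sigma>\<close> \<epsilon> by simp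
        finally show ?thesis .
      qed
    qed
    moreover have "\<sigma> = t"
    proof (rule ccontr)
      assume "\<sigma> \<noteq> t"
      with \<sigma> have "\<sigma> < t" by simp
      from right[OF \<sigma>(1) this \<epsilon>] obtain d where d: "d > 0"
        "\<And>h. 0 < h \<Longrightarrow> h < d \<Longrightarrow> \<sigma> + h \<le> t \<Longrightarrow> \<psi> (\<sigma> + h) \<le> \<psi> \<sigma> + \<epsilon> * h" by blast
      define h where "h = min (d / 2) (t - \<sigma>)"
      have h: "0 < h" "h < d" "\<sigma> + h \<le> t" using d(1) \<open>\<sigma> < t\<close> by (auto simp: h_def min_def)
      have "\<psi> (\<sigma> + h) \<le> \<epsilon> * (\<sigma> + h)"
        using d(2)[OF h] \<open>\<psi> \<sigma> \<le> \<epsilon> * \<sigma>\<close> by (simp add: distrib_left)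
      then have "\<sigma> + h \<in> A" using h \<sigma> by (simp add: A_def)
      from upper[OF this] h show False by simp
    qed
    ultimately show ?thesis by simp
  qed
  have "\<psi> t \<le> 0 + e" if "e > 0" for e
    using bound[of "e / t"] that t start by (cases "t = 0") auto
  then show ?thesis by (rule field_le_epsilon)
qed

locale C0_semigroup_on = banach_seminormed_space +
  fixes S
  assumes C0: "C0_semigroup X sc nrm S"
begin

lemma S_in [simp]: "0 \<le> t \<Longrightarrow> x \<in> X \<Longrightarrow> S t x \<in> X"
  and S_add: "0 \<le> t \<Longrightarrow> x \<in> X \<Longrightarrow> y \<in> X \<Longrightarrow> nrm (S t (x + y) - (S t x + S t y)) = 0"
  and S_sc: "0 \<le> t \<Longrightarrow> x \<in> X \<Longrightarrow> nrm (S t (sc c x) - sc c (S t x)) = 0"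
  and S_bounded: "0 \<le> t \<Longrightarrow> \<exists>K. \<forall>x\<in>X. nrm (S t x) \<le> K * nrm x"
  and S_0: "x \<in> X \<Longrightarrow> nrm (S 0 x - x) = 0"
  and S_semigroup: "0 \<le> s \<Longrightarrow> 0 \<le> t \<Longrightarrow> x \<in> X \<Longrightarrow> nrm (S (s + t) x - S s (S t x)) = 0"
  and S_tendsto: "x \<in> X \<Longrightarrow> ((\<lambda>t. nrm (S t x - x)) \<longlongrightarrow> 0) (at_right 0)"
  using C0 unfolding C0_semigroup_def by blast+

lemma S_diff:
  assumes "0 \<le> t" "x \<in> X" "y \<in> X"
  shows "nrm (S t (x - y) - (S t x - S t y)) = 0"
proof -
  have "nrm (S t (x - y) - (S t x - S t y)) = nrm (S t x - (S t (x - y) + S t y))"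
    using nrm_minus_commute[of "S t (x - y)" "S t x - S t y"] assms by (simp add: algebra_simps)
  with S_add[of t "x - y" y] assms show ?thesis by simp
qed

lemma nrm_S_diff:
  assumes "0 \<le> t" "x \<in> X" "y \<in> X"
  shows "nrm (S t x - S t y) = nrm (S t (x - y))"
  using S_diff[OF assms] nrm_le_via[of "S t x - S t y" "S t (x - y)"]
    nrm_le_via[of "S t (x - y)" "S t x - S t y"]
    nrm_minus_commute[of "S t x - S t y" "S t (x - y)"] assms by simp

lemma S_sum:
  assumes "0 \<le> t" "finite I" "\<And>i. i \<in> I \<Longrightarrow> x i \<in> X"
  shows "nrm (S t (sum x I) - (\<Sum>i\<in>I. S t (x i))) = 0"
  using assms(2,3)
proof (induction I rule: finite_induct)
  case empty
  have "nrm (S t 0) = nrm (S t 0 - (S t 0 + S t 0))" using assms by (simp add: nrm_minus)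
  then show ?case using S_add[of t 0 0] assms by simp
next
  case (insert i I)
  have "nrm (S t (x i + sum x I) - (S t (x i) + (\<Sum>i\<in>I. S t (x i))))
    \<le> nrm (S t (x i + sum x I) - (S t (x i) + S t (sum x I)))
      + nrm ((S t (x i) + S t (sum x I)) - (S t (x i) + (\<Sum>i\<in>I. S t (x i))))"
    using insert assms(1) by (intro nrm_via) auto
  also have "\<dots> = 0" using insert assms(1) S_add[of t "x i" "sum x I"] by simp
  finally show ?case using insert assms(1) nrm_nonneg
    by (metis (mono_tags, lifting) S_in X_add X_diff X_sum insertCI order_antisym sum.insert)
qed

lemma S_continuous_0:
  assumes "x \<in> X" "\<epsilon> > 0"
  shows "\<exists>d>0. \<forall>h. 0 \<le> h \<and> h \<le> d \<longrightarrow> nrm (S h x - x) \<le> \<epsilon>"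
proof -
  have "eventually (\<lambda>h. nrm (S h x - x) < \<epsilon>) (at_right 0)"
    using S_tendsto[OF assms(1)] assms(2) by (rule order_tendstoD)
  then obtain d where d: "d > 0" "\<And>h. 0 < h \<Longrightarrow> h < d \<Longrightarrow> nrm (S h x - x) < \<epsilon>"
    by (auto simp: eventually_at_right_field)
  have "nrm (S h x - x) \<le> \<epsilon>" if "0 \<le> h" "h \<le> d / 2" for h
    using d(1) d(2)[of h] that S_0[OF assms(1)] assms(2) by (cases "h = 0") auto
  then show ?thesis using d(1) by (intro exI[of _ "d / 2"]) auto
qed

text \<open>
  Otherwise there are times \<open>h\<^sub>n \<rightarrow> 0\<close> with \<open>\<parallel>S(h\<^sub>n)\<parallel> > n\<close>, although \<open>S(h\<^sub>n) x \<rightarrow> x\<close> is bounded for each \<open>x\<close>.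
\<close>

lemma bounded_near_0: "\<exists>d>0. \<exists>M. \<forall>h. 0 \<le> h \<and> h \<le> d \<longrightarrow> (\<forall>x\<in>X. nrm (S h x) \<le> M * nrm x)"
proof (rule ccontr)
  assume "\<not> ?thesis"
  then have "\<exists>h. 0 \<le> h \<and> h \<le> d \<and> (\<exists>x\<in>X. nrm (S h x) > M * nrm x)" if "d > 0" for d M
    using that by (meson not_le)
  then have "\<exists>h. 0 \<le> h \<and> h \<le> 1 / real (Suc n) \<and> (\<exists>x\<in>X. nrm (S h x) > real n * nrm x)" for n
    by simp
  then obtain h where h: "\<And>n. 0 \<le> h n" "\<And>n. h n \<le> 1 / real (Suc n)"
    and unb: "\<And>n. \<exists>x\<in>X. nrm (S (h n) x) > real n * nrm x" by metis
  have "h \<longlonglongrightarrow> 0"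
    by (rule tendsto_sandwich[of "\<lambda>_. 0" _ _ "\<lambda>n. 1 / real (Suc n)"])
      (use h LIMSEQ_inverse_real_of_nat in \<open>auto simp: inverse_eq_divide\<close>)
  have "\<exists>K. \<forall>n. \<forall>x\<in>X. nrm (S (h n) x) \<le> K * nrm x"
  proof (rule uniform_boundedness)
    fix n x y assume "x \<in> X" "y \<in> X"
    then show "nrm (S (h n) (x + y)) \<le> nrm (S (h n) x) + nrm (S (h n) y)"
      using nrm_le_via[of "S (h n) (x + y)" "S (h n) x + S (h n) y"] S_add[OF h(1), of x y n] h(1)
        nrm_triangle[of "S (h n) x" "S (h n) y"] by simp
  next
    fix n c x assume x: "x \<in> X"
    then show "nrm (S (h n) (sc c x)) = cmod c * nrm (S (h n) x)"
      using nrm_le_via[of "S (h n) (sc c x)" "sc c (S (h n) x)"] h(1) S_sc[OF h(1), of x n c]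
        nrm_le_via[of "sc c (S (h n) x)" "S (h n) (sc c x)"]
        nrm_minus_commute[of "S (h n) (sc c x)" "sc c (S (h n) x)"] by (simp add: nrm_sc)
  next
    show "\<exists>K. \<forall>x\<in>X. nrm (S (h n) x) \<le> K * nrm x" for n using S_bounded h(1) by blast
  next
    fix x assume x: "x \<in> X"
    from S_continuous_0[OF x, of 1] obtain d where d: "d > 0"
      "\<And>h. 0 \<le> h \<Longrightarrow> h \<le> d \<Longrightarrow> nrm (S h x - x) \<le> 1" by auto
    have "eventually (\<lambda>n. h n < d) sequentially"
      using \<open>h \<longlonglongrightarrow> 0\<close> d(1) by (rule order_tendstoD)
    then obtain N where N: "\<And>n. n \<ge> N \<Longrightarrow> h n < d" by (auto simp: eventually_sequentially)
    have "nrm (S (h n) x) \<le> max (1 + nrm x) (Max ((\<lambda>n. nrm (S (h n) x)) ` {..N}))" for n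
    proof (cases "n \<le> N")
      case True then show ?thesis by (intro max.coboundedI2 Max_ge) auto
    next
      case False
      then have "nrm (S (h n) x - x) \<le> 1" using N[of n] h(1) by (intro d(2)) auto
      then show ?thesis using nrm_le_via[of "S (h n) x" x] h(1) x by (intro max.coboundedI1) auto
    qed
    then show "\<exists>C. \<forall>n. nrm (S (h n) x) \<le> C" by blast
  qed
  then obtain K where K: "\<And>n x. x \<in> X \<Longrightarrow> nrm (S (h n) x) \<le> K * nrm x" by blast
  obtain n where "real n > K" using reals_Archimedean2 by blast
  with unb[of n] obtain x where "x \<in> X" "nrm (S (h n) x) > real n * nrm x" by blast
  moreover have "K * nrm x \<le> real n * nrm x"
    using \<open>real n > K\<close> \<open>x \<in> X\<close> by (intro mult_right_mono) auto
  ultimately show False using K[of x n] by simp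
qed

lemma locally_bounded:
  "\<exists>M\<ge>1. \<forall>s. 0 \<le> s \<and> s \<le> t \<longrightarrow> (\<forall>x\<in>X. nrm (S s x) \<le> M * nrm x)"
proof -
  obtain d M where d: "d > 0"
    and "\<And>h x. 0 \<le> h \<Longrightarrow> h \<le> d \<Longrightarrow> x \<in> X \<Longrightarrow> nrm (S h x) \<le> M * nrm x"
    using bounded_near_0 by blast
  moreover have "M * nrm x \<le> max 1 M * nrm x" if "x \<in> X" for x
    using that by (intro mult_right_mono) auto
  ultimately have M: "nrm (S h x) \<le> max 1 M * nrm x" if "0 \<le> h" "h \<le> d" "x \<in> X" for h x
    using that by (meson order_trans)
  have step: "\<forall>s. 0 \<le> s \<and> s \<le> real (Suc n) * d \<longrightarrow> (\<forall>x\<in>X. nrm (S s x) \<le> (max 1 M) ^ (Suc n) * nrm x)" for n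
  proof (induction n)
    case 0 then show ?case using M by simp
  next
    case (Suc n)
    show ?case
    proof (intro allI impI ballI)
      fix s x assume s: "0 \<le> s \<and> s \<le> real (Suc (Suc n)) * d" and x: "x \<in> X"
      show "nrm (S s x) \<le> max 1 M ^ Suc (Suc n) * nrm x"
      proof (cases "s \<le> d")
        case True
        have "max 1 M * nrm x \<le> max 1 M ^ Suc (Suc n) * nrm x"
          using x self_le_power[of "max 1 M" "Suc (Suc n)"] by (intro mult_right_mono) auto
        then show ?thesis using M[of s x] s x True by simp
      next
        case False
        have "nrm (S s x) \<le> nrm (S s x - S d (S (s - d) x)) + nrm (S d (S (s - d) x))"
          using False d x s by (intro nrm_le_via) auto
        also have "\<dots> = nrm (S d (S (s - d) x))"
          using S_semigroup[of d "s - d" x] False d x by simp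
        also have "\<dots> \<le> max 1 M * nrm (S (s - d) x)" using False d x by (intro M) auto
        also have "\<dots> \<le> max 1 M * (max 1 M ^ Suc n * nrm x)"
        proof (rule mult_left_mono)
          have "0 \<le> s - d \<and> s - d \<le> real (Suc n) * d" using s False by (auto simp: algebra_simps)
          then show "nrm (S (s - d) x) \<le> max 1 M ^ Suc n * nrm x" using Suc x by blast
        qed auto
        finally show ?thesis by (simp add: mult.assoc)
      qed
    qed
  qed
  obtain n where "t / d < real n" using reals_Archimedean2 by blast
  then have "t \<le> real (Suc n) * d" using d by (simp add: field_simps)
  then show ?thesis using step[of n] one_le_power[of "max 1 M" "Suc n"]
    by (intro exI[of _ "max 1 M ^ Suc n"]) (auto simp del: power_Suc)
qed

lemma generator_iff:
  "(x, y) \<in> generator X sc nrm S \<longleftrightarrow> x \<in> X \<and> y \<in> X \<and>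
     ((\<lambda>h. nrm (sc (complex_of_real (1 / h)) (S h x - x) - y)) \<longlongrightarrow> 0) (at_right 0)"
  by (auto simp: generator_def)

text \<open>
  The operator \<open>S s\<close> is bounded and commutes with the difference quotients that define the generator.
\<close>

lemma generator_invariant:
  assumes "0 \<le> s" and gen: "(x, y) \<in> generator X sc nrm S"
  shows "(S s x, S s y) \<in> generator X sc nrm S"
proof -
  have x: "x \<in> X" and y: "y \<in> X"
    and lim: "((\<lambda>h. nrm (sc (complex_of_real (1 / h)) (S h x - x) - y)) \<longlongrightarrow> 0) (at_right 0)"
    using gen by (auto simp: generator_iff)
  obtain K where K: "\<And>x. x \<in> X \<Longrightarrow> nrm (S s x) \<le> K * nrm x" using S_bounded[OF assms(1)] by blast
  have "nrm (sc (complex_of_real (1 / h)) (S h (S s x) - S s x) - S s y)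
     \<le> K * nrm (sc (complex_of_real (1 / h)) (S h x - x) - y)" if h: "0 < h" for h
  proof -
    let ?c = "complex_of_real (1 / h)"
    have "nrm (S h (S s x) - S s (S h x)) \<le> nrm (S h (S s x) - S (h + s) x) + nrm (S (h + s) x - S s (S h x))"
      using x assms(1) h by (intro nrm_via) auto
    also have "\<dots> = 0" using S_semigroup[of h s x] S_semigroup[of s h x] x assms(1) h
      nrm_minus_commute[of "S h (S s x)" "S (h + s) x"] by (simp add: add.commute)
    finally have 1: "nrm (S h (S s x) - S s (S h x)) \<le> 0" .
    have 2: "nrm (S h (S s x) - S s x - S s (S h x - x)) \<le> 0"
    proof -
      have "nrm (S h (S s x) - S s x - S s (S h x - x)) \<le>
         nrm (S h (S s x) - S s x - (S s (S h x) - S s x)) + nrm (S s (S h x) - S s x - S s (S h x - x))"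
        using x assms(1) h by (intro nrm_via) auto
      also have "\<dots> \<le> 0" using 1 S_diff[of s "S h x" x] x assms(1) h
        nrm_minus_commute[of "S s (S h x) - S s x" "S s (S h x - x)"] by simp
      finally show ?thesis .
    qed
    have 3: "nrm (sc ?c (S h (S s x) - S s x) - S s (sc ?c (S h x - x))) \<le> 0"
    proof -
      have "nrm (sc ?c (S h (S s x) - S s x) - S s (sc ?c (S h x - x))) \<le>
         nrm (sc ?c (S h (S s x) - S s x) - sc ?c (S s (S h x - x)))
         + nrm (sc ?c (S s (S h x - x)) - S s (sc ?c (S h x - x)))"
        using x assms(1) h by (intro nrm_via) auto
      also have "nrm (sc ?c (S h (S s x) - S s x) - sc ?c (S s (S h x - x))) =
          cmod ?c * nrm (S h (S s x) - S s x - S s (S h x - x))"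
        using x assms(1) h by (subst nrm_sc[symmetric]) (auto simp: scale_right_diff_distrib)
      also have "\<dots> = 0"
      proof -
        have "0 \<le> nrm (S h (S s x) - S s x - S s (S h x - x))" using x assms(1) h by simp
        with 2 show ?thesis by (metis mult_zero_right order_antisym)
      qed
      also have "nrm (sc ?c (S s (S h x - x)) - S s (sc ?c (S h x - x))) = 0"
        using S_sc[of s "S h x - x" ?c] x assms(1) h
          nrm_minus_commute[of "sc ?c (S s (S h x - x))" "S s (sc ?c (S h x - x))"] by simp
      finally show ?thesis by simp
    qed
    have "nrm (sc ?c (S h (S s x) - S s x) - S s y) \<le>
       nrm (sc ?c (S h (S s x) - S s x) - S s (sc ?c (S h x - x))) + nrm (S s (sc ?c (S h x - x)) - S s y)"
      using x y assms(1) h by (intro nrm_via) auto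
    also have "\<dots> \<le> nrm (S s (sc ?c (S h x - x) - y))"
      using 3 nrm_S_diff[of s "sc ?c (S h x - x)" y] x y assms(1) h by simp
    also have "\<dots> \<le> K * nrm (sc ?c (S h x - x) - y)" using x y h by (intro K) auto
    finally show ?thesis .
  qed
  then have "((\<lambda>h. nrm (sc (complex_of_real (1 / h)) (S h (S s x) - S s x) - S s y)) \<longlongrightarrow> 0) (at_right 0)"
    using x y assms(1)
    by (intro tendsto_sandwich[OF _ _ tendsto_const tendsto_mult_right_zero[OF lim, of K]])
      (auto intro!: eventually_mono[OF eventually_at_right_less[of 0]])
  then show ?thesis using x y assms(1) by (simp add: generator_iff)
qed

end

section \<open>Density of the domain of the generator\<close>

context C0_semigroup_on
begin

text \<open>
  These Riemann sums approximate the integral mean of the orbit of \<open>x\<close> over \<open>[0, a]\<close>, which lies in the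
  domain of the generator.
\<close>

definition riemann_mean :: "real \<Rightarrow> nat \<Rightarrow> 'a \<Rightarrow> 'a" where
  "riemann_mean a N x = sc (complex_of_real (1 / real N)) (\<Sum>k<N. S (real k * (a / real N)) x)"

lemma riemann_mean_in [simp]: "0 \<le> a \<Longrightarrow> x \<in> X \<Longrightarrow> riemann_mean a N x \<in> X"
  by (simp add: riemann_mean_def)

lemma nrm_mean_le:
  assumes "N > 0" "\<And>k. k < N \<Longrightarrow> y k \<in> X" "\<And>k. k < N \<Longrightarrow> nrm (y k) \<le> w"
  shows "nrm (sc (complex_of_real (1 / real N)) (\<Sum>k<N. y k)) \<le> w"
proof -
  have "nrm (\<Sum>k<N. y k) \<le> (\<Sum>k<N. nrm (y k))" using assms by (intro nrm_sum_le) auto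
  also have "\<dots> \<le> (\<Sum>k<N. w)" using assms by (intro sum_mono) auto
  finally have sum_le: "nrm (\<Sum>k<N. y k) \<le> real N * w" by simp
  have "nrm (sc (complex_of_real (1 / real N)) (\<Sum>k<N. y k)) = (1 / real N) * nrm (\<Sum>k<N. y k)"
    using assms by (subst nrm_sc_real) (auto intro!: X_sum)
  also have "\<dots> \<le> (1 / real N) * (real N * w)"
    using sum_le by (intro mult_left_mono) auto
  finally show ?thesis using assms(1) by simp
qed

lemma riemann_mean_near:
  assumes "0 \<le> a" "x \<in> X" "N > 0" and w: "\<And>r. 0 \<le> r \<Longrightarrow> r \<le> a \<Longrightarrow> nrm (S r x - x) \<le> w"
  shows "nrm (riemann_mean a N x - x) \<le> w"
proof -
  have "sc (complex_of_real (1 / real N)) (\<Sum>k<N. x) = x"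
    using assms(3) by (simp add: sum_constant_scale)
  then have "riemann_mean a N x - x
      = sc (complex_of_real (1 / real N)) (\<Sum>k<N. S (real k * (a / real N)) x - x)"
    by (simp add: riemann_mean_def sum_subtractf scale_right_diff_distrib)
  also have "nrm \<dots> \<le> w"
  proof (intro nrm_mean_le w)
    fix k assume "k < N"
    then have "real k * (a / real N) \<le> real N * (a / real N)"
      using assms by (intro mult_right_mono) auto
    then show "real k * (a / real N) \<le> a" using assms by simp
  qed (use assms in auto)
  finally show ?thesis .
qed

text \<open>
  Every node of the refined grid lies within \<open>a / N\<close> to the right of a node of the old grid, and
  \<open>S(s + r) x - S(s) x = S(s) (S(r) x - x)\<close> is small uniformly in \<open>s\<close>.  Hence refining grids yield a
  Cauchy sequence.
\<close>

lemma riemann_mean_refine: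
  assumes "0 \<le> a" "x \<in> X" "N > 0" "q > 0"
    and M: "\<And>s x. 0 \<le> s \<Longrightarrow> s \<le> a \<Longrightarrow> x \<in> X \<Longrightarrow> nrm (S s x) \<le> M * nrm x"
    and w: "\<And>r. 0 \<le> r \<Longrightarrow> r \<le> a / real N \<Longrightarrow> M * nrm (S r x - x) \<le> w"
  shows "nrm (riemann_mean a (N * q) x - riemann_mean a N x) \<le> w"
proof -
  let ?c = "complex_of_real (1 / real (N * q))"
  have "(\<Sum>j<N * q. S (real (j div q) * (a / real N)) x)
      = (\<Sum>k<N. \<Sum>j\<in>{k * q..<k * q + q}. S (real (j div q) * (a / real N)) x)"
    by (rule sum.nat_group[symmetric])
  also have "\<dots> = (\<Sum>k<N. \<Sum>j\<in>{k * q..<k * q + q}. S (real k * (a / real N)) x)"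
  proof (intro sum.cong refl)
    fix k j assume "j \<in> {k * q..<k * q + q}"
    then have "j div q = k" by (intro div_nat_eqI) (auto simp: algebra_simps)
    then show "S (real (j div q) * (a / real N)) x = S (real k * (a / real N)) x" by simp
  qed
  also have "\<dots> = (\<Sum>k<N. sc (of_nat q) (S (real k * (a / real N)) x))"
    by (simp add: sum_constant_scale)
  finally have "riemann_mean a N x = sc ?c (\<Sum>j<N * q. S (real (j div q) * (a / real N)) x)"
    using assms(4) by (simp add: riemann_mean_def flip: scale_sum_right)
  then have "riemann_mean a (N * q) x - riemann_mean a N x
     = sc ?c (\<Sum>j<N * q. S (real j * (a / real (N * q))) x - S (real (j div q) * (a / real N)) x)"
    by (simp add: riemann_mean_def sum_subtractf scale_right_diff_distrib)
  also have "nrm \<dots> \<le> w"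
  proof (rule nrm_mean_le)
    fix j assume j: "j < N * q"
    define k r where "k = j div q" and "r = real (j mod q) * (a / real (N * q))"
    have "k < N" using j by (simp add: k_def less_mult_imp_div_less)
    have s: "0 \<le> real k * (a / real N)" "real k * (a / real N) \<le> a"
      using \<open>k < N\<close> assms by (auto simp: field_simps intro: mult_mono)
    have r: "0 \<le> r" "r \<le> a / real N"
    proof -
      have "real (j mod q) \<le> real q" using assms(4) by (simp add: less_imp_le)
      then have "r \<le> real q * (a / real (N * q))"
        unfolding r_def using assms by (intro mult_right_mono) auto
      then show "r \<le> a / real N" using assms by simp
    qed (use assms in \<open>simp add: r_def\<close>)
    have "real j = real k * real q + real (j mod q)"
      unfolding k_def by (metis div_mult_mod_eq of_nat_add of_nat_mult)
    then have eq: "real j * (a / real (N * q)) = real k * (a / real N) + r"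
      using assms by (simp add: r_def field_simps)
    have "nrm (S (real k * (a / real N) + r) x - S (real k * (a / real N)) x)
        \<le> nrm (S (real k * (a / real N) + r) x - S (real k * (a / real N)) (S r x))
          + nrm (S (real k * (a / real N)) (S r x) - S (real k * (a / real N)) x)"
      using s r assms by (intro nrm_via) auto
    also have "\<dots> = nrm (S (real k * (a / real N)) (S r x - x))"
      using S_semigroup[OF s(1) r(1)] nrm_S_diff[OF s(1)] r assms by simp
    also have "\<dots> \<le> M * nrm (S r x - x)" using s r assms by (intro M) auto
    also have "\<dots> \<le> w" using r by (rule w)
    finally show "nrm (S (real j * (a / real (N * q))) x - S (real (j div q) * (a / real N)) x) \<le> w"
      unfolding eq k_def .
  qed (use assms in auto)
  finally show ?thesis .
qed

text \<open>
  Round \<open>r\<close> down to \<open>m \<delta>\<close>, where \<open>\<delta> = a / N\<close> is the mesh.  Then \<open>S(r)\<close> shifts the nodes by \<open>m\<close> places, and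
  in the difference of the two sums only the last \<open>m\<close> shifted and the first \<open>m\<close> original nodes survive.  They pair
  up to \<open>S(k \<delta>) (S(a) x - x)\<close>, which is close to \<open>S(a) x - x\<close>.  The three terms of the bound come from
  the rounding of \<open>r\<close>, from this last approximation and from replacing \<open>m / N\<close> by \<open>r / a\<close>.
\<close>

lemma S_riemann_mean:
  assumes "0 < a" "x \<in> X" "N > 0" "0 \<le> r" "r \<le> a"
    and M: "\<And>s x. 0 \<le> s \<Longrightarrow> s \<le> 2 * a \<Longrightarrow> x \<in> X \<Longrightarrow> nrm (S s x) \<le> M * nrm x"
    and w: "\<And>h. 0 \<le> h \<Longrightarrow> h \<le> a / real N \<Longrightarrow> M * nrm (S h x - x) \<le> w"
    and \<eta>: "\<And>s. 0 \<le> s \<Longrightarrow> s \<le> r \<Longrightarrow> nrm (S s (S a x - x) - (S a x - x)) \<le> \<eta>"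
  shows "nrm (S r (riemann_mean a N x) - riemann_mean a N x - sc (complex_of_real (r / a)) (S a x - x))
    \<le> w + (r / a) * \<eta> + nrm (S a x - x) / real N"
proof -
  let ?c = "complex_of_real (1 / real N)"
  define \<delta> where "\<delta> = a / real N"
  have \<delta>: "\<delta> > 0" "real N * \<delta> = a" using assms by (auto simp: \<delta>_def)
  define G where "G = S a x - x"
  have G: "G \<in> X" using assms by (simp add: G_def)
  define m where "m = nat \<lfloor>r / \<delta>\<rfloor>"
  define \<rho> where "\<rho> = r - real m * \<delta>"
  have "0 \<le> r / \<delta>" using \<delta> assms by simp
  then have fl: "real m \<le> r / \<delta>" "r / \<delta> < real m + 1"
    unfolding m_def by linarith+
  then have \<rho>: "0 \<le> \<rho>" "\<rho> \<le> \<delta>" and m\<delta>: "real m * \<delta> \<le> r"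
    using \<delta> by (auto simp: \<rho>_def field_simps)
  define y where "y k = S (real k * \<delta>) x" for k
  have y: "y k \<in> X" for k using \<delta> assms by (simp add: y_def)
  have mean: "riemann_mean a N x = sc ?c (\<Sum>k<N. y k)"
    by (simp add: riemann_mean_def y_def \<delta>_def)
  have 1: "nrm (S r (riemann_mean a N x) - sc ?c (\<Sum>k<N. S r (y k))) = 0"
  proof -
    have "nrm (S r (sc ?c (\<Sum>k<N. y k)) - sc ?c (S r (\<Sum>k<N. y k))) = 0"
      using y assms by (intro S_sc) auto
    moreover have "nrm (sc ?c (S r (\<Sum>k<N. y k)) - sc ?c (\<Sum>k<N. S r (y k))) = 0"
      using y assms by (intro null_sc[OF _ _ S_sum]) auto
    moreover have "sc ?c (\<Sum>k<N. y k) \<in> X" "sc ?c (S r (\<Sum>k<N. y k)) \<in> X" "sc ?c (\<Sum>k<N. S r (y k)) \<in> X"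
      using y assms by (auto intro!: X_sum)
    ultimately show ?thesis unfolding mean using assms(4) null_trans S_in by blast
  qed
  have 2: "nrm (S r (y k) - y (m + k)) \<le> w" if "k < N" for k
  proof -
    have s: "0 \<le> real (m + k) * \<delta>" "real (m + k) * \<delta> \<le> 2 * a"
    proof -
      have "real k * \<delta> \<le> real N * \<delta>" using that \<delta> by (intro mult_right_mono) auto
      then show "real (m + k) * \<delta> \<le> 2 * a" using m\<delta> \<delta> assms by (simp add: distrib_right)
    qed (use \<delta> in auto)
    have k: "0 \<le> real k * \<delta>" using \<delta> by simp
    have "nrm (S r (y k) - S (r + real k * \<delta>) x) = 0"
      unfolding y_def using assms k by - (rule null_sym[OF _ _ S_semigroup], auto)
    moreover have "nrm (S (real (m + k) * \<delta> + \<rho>) x - S (real (m + k) * \<delta>) (S \<rho> x)) = 0"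
      using assms s \<rho> by (intro S_semigroup) auto
    moreover have "r + real k * \<delta> = real (m + k) * \<delta> + \<rho>"
      by (simp add: \<rho>_def algebra_simps)
    ultimately have "nrm (S r (y k) - S (real (m + k) * \<delta>) (S \<rho> x)) = 0"
      using null_trans[of "S r (y k)" "S (r + real k * \<delta>) x" "S (real (m + k) * \<delta>) (S \<rho> x)"]
        y s \<rho> k assms by simp
    then have "nrm (S r (y k) - y (m + k)) \<le> nrm (S (real (m + k) * \<delta>) (S \<rho> x) - y (m + k))"
      using nrm_via[of "S r (y k)" "S (real (m + k) * \<delta>) (S \<rho> x)" "y (m + k)"] y s \<rho> assms by simp
    also have "\<dots> = nrm (S (real (m + k) * \<delta>) (S \<rho> x - x))"
      unfolding y_def using s \<rho> assms by (intro nrm_S_diff) auto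
    also have "\<dots> \<le> M * nrm (S \<rho> x - x)" using s \<rho> assms by (intro M) auto
    also have "\<dots> \<le> w" using \<rho> by (intro w) (auto simp: \<delta>_def)
    finally show ?thesis .
  qed
  have 2: "nrm (sc ?c (\<Sum>k<N. S r (y k)) - sc ?c (\<Sum>k<N. y (m + k))) \<le> w"
    using nrm_mean_le[of N "\<lambda>k. S r (y k) - y (m + k)" w] assms y 2
    by (simp add: sum_subtractf scale_right_diff_distrib)
  have split: "(\<Sum>k<i + j. y k) = (\<Sum>k<i. y k) + (\<Sum>k<j. y (i + k))" for i j
    by (induction j) (simp_all add: add.assoc)
  have "(\<Sum>k<N. y (m + k)) + (\<Sum>k<m. y k) = (\<Sum>k<m. y (N + k)) + (\<Sum>k<N. y k)"
    using split[of m N] split[of N m] by (simp add: add.commute)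
  then have 3: "sc ?c (\<Sum>k<N. y (m + k)) - riemann_mean a N x = sc ?c (\<Sum>k<m. y (N + k) - y k)"
    by (simp add: mean sum_subtractf algebra_simps flip: scale_right_diff_distrib)
  have 4: "nrm (y (N + k) - y k - G) \<le> \<eta>" if "k < m" for k
  proof -
    have k: "0 \<le> real k * \<delta>" "real k * \<delta> \<le> r"
    proof -
      have "real k * \<delta> \<le> real m * \<delta>" using that \<delta> by (intro mult_right_mono) auto
      then show "real k * \<delta> \<le> r" using m\<delta> by simp
    qed (use \<delta> in auto)
    have "nrm (y (N + k) - S (real k * \<delta>) (S a x)) = 0"
      using S_semigroup[of "real k * \<delta>" a x] k assms \<delta> by (simp add: y_def distrib_right add.commute)
    then have "nrm (y (N + k) - y k - (S (real k * \<delta>) (S a x) - y k)) = 0" by simp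
    moreover have "nrm (S (real k * \<delta>) (S a x) - y k - S (real k * \<delta>) G) = 0"
      unfolding y_def G_def using k assms by - (rule null_sym[OF _ _ S_diff], auto)
    ultimately have "nrm (y (N + k) - y k - S (real k * \<delta>) G) = 0"
      using null_trans[of "y (N + k) - y k" "S (real k * \<delta>) (S a x) - y k" "S (real k * \<delta>) G"]
        y k assms G by simp
    then have "nrm (y (N + k) - y k - G) \<le> nrm (S (real k * \<delta>) G - G)"
      using nrm_via[of "y (N + k) - y k" "S (real k * \<delta>) G" G] y k G by simp
    also have "\<dots> \<le> \<eta>" unfolding G_def using k by (rule \<eta>)
    finally show ?thesis .
  qed
  have "nrm (\<Sum>k<m. y (N + k) - y k - G) \<le> (\<Sum>k<m. nrm (y (N + k) - y k - G))"
    using y G by (intro nrm_sum_le) auto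
  also have "\<dots> \<le> (\<Sum>k<m. \<eta>)" using 4 by (intro sum_mono) auto
  finally have "nrm (\<Sum>k<m. y (N + k) - y k - G) \<le> real m * \<eta>" by simp
  then have sum_G: "nrm (sc ?c (\<Sum>k<m. y (N + k) - y k - G)) \<le> (real m / real N) * \<eta>"
    using y G assms by (subst nrm_sc_real) (auto simp: field_simps)
  have G_split: "sc ?c (\<Sum>k<m. y (N + k) - y k - G)
      = sc ?c (\<Sum>k<m. y (N + k) - y k) - sc (complex_of_real (real m / real N)) G"
    by (simp add: sum_subtractf scale_right_diff_distrib sum_constant_scale)
  have mN: "real m / real N \<le> r / a" "r / a \<le> real m / real N + 1 / real N"
    using fl \<delta>(1) assms by (auto simp: \<delta>_def field_simps)
  have "S 0 (S a x - x) - (S a x - x) \<in> X" using assms by simp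
  then have "0 \<le> \<eta>" using \<eta>[of 0] assms(4) nrm_nonneg order_trans by blast
  then have m_le: "(real m / real N) * \<eta> \<le> (r / a) * \<eta>" using mN by (intro mult_right_mono)
  have 5: "nrm (sc ?c (\<Sum>k<m. y (N + k) - y k) - sc (complex_of_real (real m / real N)) G) \<le> (r / a) * \<eta>"
    using sum_G m_le unfolding G_split by simp
  have "nrm (sc (complex_of_real (real m / real N)) G - sc (complex_of_real (r / a)) G)
      = \<bar>real m / real N - r / a\<bar> * nrm G"
    using nrm_sc_real[OF G, of "real m / real N - r / a"]
    unfolding of_real_diff scale_left_diff_distrib .
  also have "\<dots> \<le> (1 / real N) * nrm G"
    using mN G by (intro mult_right_mono) auto
  finally have 6: "nrm (sc (complex_of_real (real m / real N)) G - sc (complex_of_real (r / a)) G) \<le> nrm G / real N"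
    by simp
  let ?A = "S r (riemann_mean a N x)" and ?B = "sc ?c (\<Sum>k<N. S r (y k))" and ?C = "sc ?c (\<Sum>k<N. y (m + k))"
    and ?R = "riemann_mean a N x"
    and ?D = "sc (complex_of_real (real m / real N)) G" and ?E = "sc (complex_of_real (r / a)) G"
  have inX: "?A \<in> X" "?B \<in> X" "?C \<in> X" "?R \<in> X" "?D \<in> X" "?E \<in> X"
    using y G assms by auto
  have "nrm (?A - ?C) \<le> w" using nrm_via[of ?A ?B ?C] 1 2 inX by simp
  moreover have "nrm (?C - ?R - ?E) \<le> (r / a) * \<eta> + nrm G / real N"
    using nrm_via[OF X_diff[OF inX(3,4)] inX(5,6)] 5 6 unfolding 3 by linarith
  moreover have "nrm (?A - ?R - ?E) \<le> nrm (?A - ?C) + nrm (?C - ?R - ?E)"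
    using nrm_via[OF X_diff[OF inX(1,4)] X_diff[OF inX(3,4)] inX(6)] by simp
  ultimately show ?thesis unfolding G_def by simp
qed

text \<open>
  Let \<open>F\<close> be the limit of the Riemann means along grids refined fast enough.  The previous
  estimate yields \<open>S(r) F - F = (r / a) (S(a) x - x) + o(r)\<close>, so \<open>F\<close> is in the domain, and \<open>F\<close> is close to \<open>x\<close>
  when \<open>a\<close> is small.
\<close>

lemma generator_dense:
  assumes x: "x \<in> X" and \<epsilon>: "\<epsilon> > 0"
  shows "\<exists>(F, G)\<in>generator X sc nrm S. nrm (F - x) \<le> \<epsilon>"
proof -
  obtain a where a: "a > 0" "\<And>h. 0 \<le> h \<Longrightarrow> h \<le> a \<Longrightarrow> nrm (S h x - x) \<le> \<epsilon>"
    using S_continuous_0[OF x \<epsilon>] by auto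
  obtain M where M1: "M \<ge> 1"
    and M: "\<And>s x. 0 \<le> s \<Longrightarrow> s \<le> 2 * a \<Longrightarrow> x \<in> X \<Longrightarrow> nrm (S s x) \<le> M * nrm x"
    using locally_bounded[of "2 * a"] by auto
  have Ma: "nrm (S s x) \<le> M * nrm x" if "0 \<le> s" "s \<le> a" "x \<in> X" for s x
    using M[of s x] that a(1) by simp
  define G where "G = S a x - x"
  have G: "G \<in> X" using a x by (simp add: G_def)
  have "\<exists>n\<ge>j. \<forall>h. 0 \<le> h \<and> h \<le> a / 2 ^ n \<longrightarrow> M * nrm (S h x - x) \<le> (1/2) ^ j" for j :: nat
  proof -
    from S_continuous_0[OF x, of "(1/2) ^ j / M"] M1 obtain d where d: "d > 0"
      "\<And>h. 0 \<le> h \<Longrightarrow> h \<le> d \<Longrightarrow> nrm (S h x - x) \<le> (1/2) ^ j / M" by auto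
    have "(\<lambda>n. a / 2 ^ n) \<longlonglongrightarrow> 0" by real_asymp
    then have "eventually (\<lambda>n. a / 2 ^ n < d) sequentially" using d(1) by (rule order_tendstoD)
    then obtain n0 where n0: "\<And>n. n \<ge> n0 \<Longrightarrow> a / 2 ^ n < d" by (auto simp: eventually_sequentially)
    show ?thesis
    proof (intro exI[of _ "max j n0"] conjI allI impI)
      fix h assume "0 \<le> h \<and> h \<le> a / 2 ^ max j n0"
      then have "nrm (S h x - x) \<le> (1/2) ^ j / M" using n0[of "max j n0"] by (intro d(2)) auto
      then show "M * nrm (S h x - x) \<le> (1/2) ^ j" using M1 by (simp add: field_simps)
    qed simp
  qed
  then obtain n where n: "\<And>j. n j \<ge> j"
    and small: "\<And>j h. 0 \<le> h \<Longrightarrow> h \<le> a / 2 ^ n j \<Longrightarrow> M * nrm (S h x - x) \<le> (1/2) ^ j" by metis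
  \<comment> \<open>Partial sums of the exponents make each grid a refinement of the one before.\<close>
  define N :: "nat \<Rightarrow> nat" where "N j = 2 ^ (\<Sum>i\<le>j. n i)" for j
  have N_pos: "N j > 0" for j by (simp add: N_def)
  have N_Suc: "N (Suc j) = N j * 2 ^ n (Suc j)" for j by (simp add: N_def power_add)
  have "n j \<le> (\<Sum>i\<le>j. n i)" for j by (rule member_le_sum) auto
  then have "(2::nat) ^ n j \<le> N j" for j by (simp add: N_def)
  then have N_ge: "(2::real) ^ n j \<le> real (N j)" for j
    by (metis of_nat_le_iff of_nat_numeral of_nat_power)
  have N_ge': "(2::real) ^ j \<le> real (N j)" for j
    using order_trans[OF power_increasing[OF n[of j], of "2::real"] N_ge[of j]] by simp
  have w: "M * nrm (S h x - x) \<le> (1/2) ^ j" if "0 \<le> h" "h \<le> a / real (N j)" for h j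
  proof (rule small)
    have "a / real (N j) \<le> a / 2 ^ n j" using N_ge[of j] a N_pos[of j] by (intro divide_left_mono) auto
    then show "h \<le> a / 2 ^ n j" using that by simp
  qed fact
  have "\<exists>F\<in>X. (\<lambda>j. nrm (riemann_mean a (N j) x - F)) \<longlonglongrightarrow> 0"
  proof (rule fast_Cauchy)
    show "nrm (riemann_mean a (N (Suc j)) x - riemann_mean a (N j) x) \<le> (1/2) ^ j" for j
      unfolding N_Suc using a x N_pos w by (intro riemann_mean_refine[where M = M]) (auto intro: Ma)
  qed (use a x in simp)
  then obtain F where F: "F \<in> X" and lim: "(\<lambda>j. nrm (riemann_mean a (N j) x - F)) \<longlonglongrightarrow> 0" by blast
  have near: "nrm (F - x) \<le> \<epsilon>"
  proof (rule LIMSEQ_le_const)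
    show "(\<lambda>j. nrm (riemann_mean a (N j) x - F) + \<epsilon>) \<longlonglongrightarrow> \<epsilon>"
      using tendsto_add[OF lim tendsto_const[of \<epsilon>]] by simp
    have "nrm (F - x) \<le> nrm (riemann_mean a (N j) x - F) + \<epsilon>" for j
      using nrm_via[of F "riemann_mean a (N j) x" x] riemann_mean_near[of a x "N j" \<epsilon>] a x F N_pos
      by (simp add: nrm_minus_commute[of F])
    then show "\<exists>N'. \<forall>j\<ge>N'. nrm (F - x) \<le> nrm (riemann_mean a (N j) x - F) + \<epsilon>" by blast
  qed
  have main: "nrm (S r F - F - sc (complex_of_real (r / a)) G) \<le> (r / a) * \<eta>"
    if r: "0 \<le> r" "r \<le> a" and \<eta>: "\<And>s. 0 \<le> s \<Longrightarrow> s \<le> r \<Longrightarrow> nrm (S s G - G) \<le> \<eta>" for r \<eta>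
  proof (rule LIMSEQ_le_const)
    let ?R = "\<lambda>j. riemann_mean a (N j) x" and ?E = "sc (complex_of_real (r / a)) G"
    let ?b = "\<lambda>j. M * nrm (?R j - F) + nrm (?R j - F) + ((1/2) ^ j + (r / a) * \<eta> + nrm G / real (N j))"
    have lim_N: "(\<lambda>j. nrm G / real (N j)) \<longlonglongrightarrow> 0"
    proof (rule tendsto_sandwich[OF _ _ tendsto_const])
      show "(\<lambda>j. nrm G / 2 ^ j) \<longlonglongrightarrow> 0" by real_asymp
      show "\<forall>\<^sub>F j in sequentially. nrm G / real (N j) \<le> nrm G / 2 ^ j"
        using N_ge' N_pos G by (intro always_eventually allI divide_left_mono) auto
    qed (use G in auto)
    have lim_2: "(\<lambda>j. (1/2::real) ^ j) \<longlonglongrightarrow> 0" by (rule LIMSEQ_power_zero) simp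
    have "?b \<longlonglongrightarrow> M * 0 + 0 + (0 + (r / a) * \<eta> + 0)"
      by (intro tendsto_add tendsto_mult tendsto_const lim lim_N lim_2)
    then show "?b \<longlonglongrightarrow> (r / a) * \<eta>" by simp
    have "nrm (S r F - F - ?E) \<le> ?b j" for j
    proof -
      have R: "?R j \<in> X" using a x by simp
      have "nrm (S r (?R j) - ?R j - ?E) \<le> (1/2) ^ j + (r / a) * \<eta> + nrm G / real (N j)"
        unfolding G_def using a x N_pos r w \<eta> by (intro S_riemann_mean[where M = M]) (auto simp: G_def intro: M)
      moreover have "nrm (S r F - S r (?R j)) \<le> M * nrm (?R j - F)"
        using nrm_S_diff[of r F "?R j"] M[of r "F - ?R j"] r a F R by (simp add: nrm_minus_commute)
      moreover have "nrm (S r F - F - ?E - (S r (?R j) - ?R j - ?E)) \<le> nrm (S r F - S r (?R j)) + nrm (?R j - F)"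
        using nrm_diff_diff[of "S r F" F "S r (?R j)" "?R j"] r F R
        by (simp add: nrm_minus_commute[of F])
      moreover have "nrm (S r F - F - ?E) \<le> nrm (S r F - F - ?E - (S r (?R j) - ?R j - ?E)) + nrm (S r (?R j) - ?R j - ?E)"
        using r F R G by (intro nrm_le_via) auto
      ultimately show ?thesis by linarith
    qed
    then show "\<exists>N'. \<forall>j\<ge>N'. nrm (S r F - F - ?E) \<le> ?b j" by blast
  qed
  have "((\<lambda>h. nrm (sc (complex_of_real (1 / h)) (S h F - F) - sc (complex_of_real (1 / a)) G)) \<longlongrightarrow> 0) (at_right 0)"
  proof (rule tendstoI)
    fix e :: real assume "e > 0"
    from S_continuous_0[OF G, of "a * e / 2"] a \<open>e > 0\<close> obtain d where d: "d > 0"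
      "\<And>h. 0 \<le> h \<Longrightarrow> h \<le> d \<Longrightarrow> nrm (S h G - G) \<le> a * e / 2" by auto
    have "nrm (sc (complex_of_real (1 / h)) (S h F - F) - sc (complex_of_real (1 / a)) G) < e"
      if h: "0 < h" "h < min a d" for h
    proof -
      have "sc (complex_of_real (1 / h)) (S h F - F) - sc (complex_of_real (1 / a)) G
        = sc (complex_of_real (1 / h)) (S h F - F - sc (complex_of_real (h / a)) G)"
        using h by (simp add: scale_right_diff_distrib)
      also have "nrm \<dots> = (1 / h) * nrm (S h F - F - sc (complex_of_real (h / a)) G)"
        using h F G by (subst nrm_sc_real) auto
      also have "\<dots> \<le> (1 / h) * ((h / a) * (a * e / 2))"
        using h d by (intro mult_left_mono main) auto
      also have "\<dots> = e / 2" using h a by simp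
      finally show ?thesis using \<open>e > 0\<close> by simp
    qed
    moreover have "eventually (\<lambda>h. 0 < h \<and> h < min a d) (at_right (0::real))"
      using a d by (auto simp: eventually_at_right_field intro!: exI[of _ "min a d"])
    ultimately show "eventually (\<lambda>h. dist (nrm (sc (complex_of_real (1 / h)) (S h F - F)
        - sc (complex_of_real (1 / a)) G)) 0 < e) (at_right 0)"
      using F G by (auto elim!: eventually_mono)
  qed
  then have "(F, sc (complex_of_real (1 / a)) G) \<in> generator X sc nrm S"
    using F G by (simp add: generator_iff)
  with near show ?thesis by blast
qed

end

section \<open>Uniqueness of the semigroup with a given generator\<close>

context banach_seminormed_space
begin

text \<open>
  For \<open>f\<close> in the domain, the curve \<open>\<phi> s = S(t - s) R(s) f\<close> satisfies
  \<open>\<phi>(s + h) - \<phi>(s) = S(t - s - h) (R(h) - S(h)) R(s) f\<close>.  Since \<open>R(s) f\<close> belongs to the domain, both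
  semigroups have the same derivative there and the difference is \<open>o(h)\<close>.  Local boundedness
  and density extend the equality of \<open>S(t)\<close> and \<open>R(t)\<close> from the domain to the whole space.
\<close>

lemma generator_determines_semigroup:
  assumes S: "C0_semigroup X sc nrm S" and R: "C0_semigroup X sc nrm R"
    and sub: "generator X sc nrm R \<subseteq> generator X sc nrm S"
    and "0 \<le> t" "x \<in> X"
  shows "nrm (S t x - R t x) = 0"
proof -
  interpret S: C0_semigroup_on sc X nrm S by unfold_locales (rule S)
  interpret R: C0_semigroup_on sc X nrm R by unfold_locales (rule R)
  obtain MS where MS: "MS \<ge> 1" "\<And>s x. 0 \<le> s \<Longrightarrow> s \<le> t \<Longrightarrow> x \<in> X \<Longrightarrow> nrm (S s x) \<le> MS * nrm x"
    using S.locally_bounded[of t] by auto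
  obtain MR where MR: "MR \<ge> 1" "\<And>s x. 0 \<le> s \<Longrightarrow> s \<le> t \<Longrightarrow> x \<in> X \<Longrightarrow> nrm (R s x) \<le> MR * nrm x"
    using R.locally_bounded[of t] by auto
  have on_domain: "nrm (S t f - R t f) = 0" if gen: "(f, g) \<in> generator X sc nrm R" for f g
  proof -
    have f: "f \<in> X" and g: "g \<in> X" using gen by (auto simp: R.generator_iff)
    define \<phi> where "\<phi> s = S (t - s) (R s f)" for s
    define \<psi> where "\<psi> s = nrm (\<phi> s - \<phi> 0)" for s
    have \<phi>: "\<phi> s \<in> X" if "0 \<le> s" "s \<le> t" for s using that f by (simp add: \<phi>_def)
    have step: "\<psi> (s + h) \<le> \<psi> s + MS * nrm (R h (R s f) - S h (R s f))"
      if "0 \<le> s" "0 \<le> h" "s + h \<le> t" for s h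
    proof -
      let ?u = "S (t - s - h)" and ?y = "R s f"
      have y: "?y \<in> X" using that f by simp
      have "nrm (\<phi> (s + h) - ?u (R h ?y)) = nrm (?u (R (s + h) f - R h ?y))"
        using that f S.nrm_S_diff[of "t - s - h" "R (s + h) f" "R h ?y"] by (simp add: \<phi>_def diff_diff_eq)
      also have "\<dots> \<le> MS * nrm (R (s + h) f - R h ?y)" using that f by (intro MS) auto
      also have "\<dots> = 0" using R.S_semigroup[of h s f] that f by (simp add: add.commute)
      finally have 1: "nrm (\<phi> (s + h) - ?u (R h ?y)) \<le> 0" .
      have 2: "nrm (\<phi> s - ?u (S h ?y)) = 0"
        using S.S_semigroup[of "t - s - h" h ?y] that y by (simp add: \<phi>_def)
      have 3: "nrm (?u (R h ?y) - ?u (S h ?y)) \<le> MS * nrm (R h ?y - S h ?y)"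
        using S.nrm_S_diff[of "t - s - h" "R h ?y" "S h ?y"] MS(2)[of "t - s - h" "R h ?y - S h ?y"] that y
        by simp
      have 4: "nrm (\<phi> (s + h) - ?u (S h ?y)) \<le> nrm (\<phi> (s + h) - ?u (R h ?y)) + nrm (?u (R h ?y) - ?u (S h ?y))"
        using that y \<phi> by (intro nrm_via) auto
      have 5: "nrm (\<phi> (s + h) - \<phi> s) \<le> nrm (\<phi> (s + h) - ?u (S h ?y)) + nrm (?u (S h ?y) - \<phi> s)"
        using that y \<phi> by (intro nrm_via) auto
      have 6: "nrm (?u (S h ?y) - \<phi> s) = 0"
        using 2 that y \<phi> by - (rule null_sym, auto)
      have "\<psi> (s + h) \<le> nrm (\<phi> (s + h) - \<phi> s) + \<psi> s"
        unfolding \<psi>_def using that \<phi> by (intro nrm_via) auto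
      with 1 3 4 5 6 show ?thesis by linarith
    qed
    have "\<psi> t \<le> 0"
    proof (rule nonpos_of_zero_right_derivative[OF \<open>0 \<le> t\<close>])
      show "\<psi> 0 \<le> 0" by (simp add: \<psi>_def)
    next
      \<comment> \<open>Right derivative: both difference quotients at \<open>R s f\<close> tend to the same limit \<open>R s g\<close>.\<close>
      fix s \<epsilon> :: real assume s: "0 \<le> s" "s < t" and \<epsilon>: "\<epsilon> > 0"
      let ?y = "R s f"
      have y: "?y \<in> X" using s f by simp
      have genR: "(?y, R s g) \<in> generator X sc nrm R" using R.generator_invariant[OF s(1) gen] .
      then have genS: "(?y, R s g) \<in> generator X sc nrm S" using sub by blast
      define e where "e = \<epsilon> / (2 * MS)"
      have e: "e > 0" using \<epsilon> MS(1) by (simp add: e_def)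
      have "eventually (\<lambda>h. nrm (sc (complex_of_real (1 / h)) (R h ?y - ?y) - R s g) < e) (at_right 0)"
        using genR e by (auto simp: R.generator_iff intro: order_tendstoD)
      moreover have "eventually (\<lambda>h. nrm (sc (complex_of_real (1 / h)) (S h ?y - ?y) - R s g) < e) (at_right 0)"
        using genS e by (auto simp: S.generator_iff intro: order_tendstoD)
      ultimately have "eventually (\<lambda>h. nrm (sc (complex_of_real (1 / h)) (R h ?y - ?y) - R s g) < e \<and>
          nrm (sc (complex_of_real (1 / h)) (S h ?y - ?y) - R s g) < e) (at_right 0)"
        by (rule eventually_conj)
      then obtain d where d: "d > 0"
        "\<And>h. 0 < h \<Longrightarrow> h < d \<Longrightarrow> nrm (sc (complex_of_real (1 / h)) (R h ?y - ?y) - R s g) < e \<and>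
          nrm (sc (complex_of_real (1 / h)) (S h ?y - ?y) - R s g) < e"
        unfolding eventually_at_right_field by blast
      have "\<psi> (s + h) \<le> \<psi> s + \<epsilon> * h" if h: "0 < h" "h < d" "s + h \<le> t" for h
      proof -
        let ?c = "complex_of_real (1 / h)"
        have "(1 / h) * nrm (R h ?y - S h ?y) = nrm (sc ?c (R h ?y - S h ?y))"
          using h y by (subst nrm_sc_real) auto
        also have "sc ?c (R h ?y - S h ?y) = (sc ?c (R h ?y - ?y) - R s g) - (sc ?c (S h ?y - ?y) - R s g)"
          by (simp add: algebra_simps)
        also have "nrm \<dots> \<le> nrm (sc ?c (R h ?y - ?y) - R s g) + nrm (sc ?c (S h ?y - ?y) - R s g)"
          using h y s g by (intro nrm_diff) auto
        also have "\<dots> \<le> 2 * e" using d(2)[of h] h by simp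
        finally have "nrm (R h ?y - S h ?y) \<le> 2 * e * h" using h by (simp add: field_simps)
        then have "MS * nrm (R h ?y - S h ?y) \<le> MS * (2 * e * h)" using MS(1) by (intro mult_left_mono) auto
        also have "\<dots> = \<epsilon> * h" using MS(1) by (simp add: e_def)
        finally show ?thesis using step[of s h] h s by simp
      qed
      then show "\<exists>d>0. \<forall>h. 0 < h \<and> h < d \<and> s + h \<le> t \<longrightarrow> \<psi> (s + h) \<le> \<psi> s + \<epsilon> * h"
        using d(1) by blast
    next
      \<comment> \<open>Continuity from the left: \<open>R (s - h) f\<close> differs from \<open>R s f\<close> by \<open>R (s - h)\<close> applied to \<open>R h f - f\<close>, which is bounded by \<open>MR * e\<close>.\<close>
      fix s \<epsilon> :: real assume s: "0 < s" "s \<le> t" and \<epsilon>: "\<epsilon> > 0"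
      let ?y = "R s f"
      have y: "?y \<in> X" using s f by simp
      define K where "K = 1 + MS * MR"
      define e where "e = \<epsilon> / (2 * MS * K)"
      have pos: "0 < K" using MS(1) MR(1) by (simp add: K_def add_pos_nonneg)
      then have e: "e > 0" using \<epsilon> MS(1) by (simp add: e_def)
      obtain d1 where d1: "d1 > 0" "\<And>h. 0 \<le> h \<Longrightarrow> h \<le> d1 \<Longrightarrow> nrm (S h ?y - ?y) \<le> e"
        using S.S_continuous_0[OF y e] by auto
      obtain d2 where d2: "d2 > 0" "\<And>h. 0 \<le> h \<Longrightarrow> h \<le> d2 \<Longrightarrow> nrm (R h f - f) \<le> e"
        using R.S_continuous_0[OF f e] by auto
      have "\<psi> s \<le> \<psi> (s - h) + \<epsilon>" if h: "0 < h" "h < min d1 d2" "h \<le> s" for h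
      proof -
        let ?z = "R (s - h) f"
        have z: "?z \<in> X" using h f by simp
        have "nrm (?y - R (s - h) (R h f)) = 0"
          using R.S_semigroup[of "s - h" h f] h f by simp
        moreover have "nrm (R (s - h) (R h f) - ?z) \<le> MR * nrm (R h f - f)"
          using R.nrm_S_diff[of "s - h" "R h f" f] MR(2)[of "s - h" "R h f - f"] h s f by simp
        moreover have "MR * nrm (R h f - f) \<le> MR * e" using MR(1) d2(2)[of h] h by (intro mult_left_mono) auto
        ultimately have yz: "nrm (?y - ?z) \<le> MR * e"
          using nrm_via[of ?y "R (s - h) (R h f)" ?z] h f y by simp
        have "nrm (R h ?z - ?y) = 0"
          using R.S_semigroup[of h "s - h" f] h f by - (rule null_sym, auto)
        moreover have "nrm (?y - S h ?y) \<le> e" using d1(2)[of h] h y nrm_minus_commute[of ?y "S h ?y"] by simp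
        moreover have "nrm (S h ?y - S h ?z) \<le> MS * (MR * e)"
        proof -
          have "nrm (S h ?y - S h ?z) \<le> MS * nrm (?y - ?z)"
            using S.nrm_S_diff[of h ?y ?z] MS(2)[of h "?y - ?z"] h s y z by simp
          also have "\<dots> \<le> MS * (MR * e)" using yz MS(1) by (intro mult_left_mono) auto
          finally show ?thesis .
        qed
        moreover have "nrm (R h ?z - S h ?z) \<le> nrm (R h ?z - ?y) + nrm (?y - S h ?z)"
          "nrm (?y - S h ?z) \<le> nrm (?y - S h ?y) + nrm (S h ?y - S h ?z)"
          using h y z by (auto intro: nrm_via)
        ultimately have "nrm (R h ?z - S h ?z) \<le> K * e" by (simp add: K_def algebra_simps)
        then have "MS * nrm (R h ?z - S h ?z) \<le> MS * (K * e)"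
          using MS(1) by (intro mult_left_mono) auto
        also have "\<dots> \<le> \<epsilon>" using MS(1) pos \<epsilon> by (simp add: e_def)
        finally show ?thesis using step[of "s - h" h] h s by simp
      qed
      then show "\<exists>d>0. \<forall>h. 0 < h \<and> h < d \<and> h \<le> s \<longrightarrow> \<psi> s \<le> \<psi> (s - h) + \<epsilon>"
        using d1(1) d2(1) by (intro exI[of _ "min d1 d2"]) auto
    qed
    moreover have "nrm (\<phi> t - R t f) = 0" using \<open>0 \<le> t\<close> f by (simp add: \<phi>_def S.S_0)
    moreover have "nrm (\<phi> 0 - S t f) = 0"
    proof -
      have "nrm (S t (R 0 f) - S t f) \<le> MS * nrm (R 0 f - f)"
        using S.nrm_S_diff[of t "R 0 f" f] MS(2)[of t "R 0 f - f"] \<open>0 \<le> t\<close> f by simp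
      then have "nrm (\<phi> 0 - S t f) \<le> 0" using R.S_0[OF f] by (simp add: \<phi>_def)
      then show ?thesis using \<phi>[of 0] \<open>0 \<le> t\<close> f by (intro order_antisym nrm_nonneg) auto
    qed
    moreover have "nrm (\<phi> t - \<phi> 0) = 0"
      using \<open>\<psi> t \<le> 0\<close> \<phi> \<open>0 \<le> t\<close> unfolding \<psi>_def by (intro order_antisym nrm_nonneg) auto
    ultimately show ?thesis using \<phi>[of 0] \<phi>[of t] \<open>0 \<le> t\<close> f
      by (meson R.S_in S.S_in null_sym null_trans order_refl)
  qed
  have "nrm (S t x - R t x) \<le> 0"
  proof (rule field_le_epsilon)
    fix e :: real assume "e > 0"
    define d where "d = e / (MS + MR)"
    have d: "d > 0" "(MS + MR) * d = e" using \<open>e > 0\<close> MS(1) MR(1) by (auto simp: d_def)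
    obtain F G where FG: "(F, G) \<in> generator X sc nrm R" "nrm (F - x) \<le> d"
      using R.generator_dense[OF \<open>x \<in> X\<close> d(1)] by blast
    have F: "F \<in> X" using FG(1) by (simp add: R.generator_iff)
    have "nrm (S t x - S t F) \<le> MS * d"
    proof -
      have "nrm (S t x - S t F) \<le> MS * nrm (x - F)"
        using S.nrm_S_diff[of t x F] MS(2)[of t "x - F"] assms F by simp
      also have "\<dots> \<le> MS * d" using FG(2) MS(1) assms F by (intro mult_left_mono) (auto simp: nrm_minus_commute)
      finally show ?thesis .
    qed
    moreover have "nrm (R t F - R t x) \<le> MR * d"
    proof -
      have "nrm (R t F - R t x) \<le> MR * nrm (F - x)"
        using R.nrm_S_diff[of t F x] MR(2)[of t "F - x"] assms F by simp
      also have "\<dots> \<le> MR * d" using FG(2) MR(1) by (intro mult_left_mono) auto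
      finally show ?thesis .
    qed
    moreover have "nrm (S t x - R t x) \<le> nrm (S t x - S t F) + nrm (S t F - R t x)"
      "nrm (S t F - R t x) \<le> nrm (S t F - R t F) + nrm (R t F - R t x)"
      using assms F by (auto intro: nrm_via)
    ultimately show "nrm (S t x - R t x) \<le> 0 + e"
      using on_domain[OF FG(1)] d(2) by (simp add: algebra_simps)
  qed
  then show ?thesis using assms by (intro order_antisym nrm_nonneg) auto
qed

text \<open>
  The family \<open>J S(t) J\<close> is a semigroup with the same generator; it is linear since \<open>J\<close> is
  antilinear and occurs twice.
\<close>

lemma semigroup_commutes_with_conjugation:
  assumes S: "C0_semigroup X sc nrm S"
    and J_in: "\<And>x. x \<in> X \<Longrightarrow> J x \<in> X"
    and J_add: "\<And>x y. J (x + y) = J x + J y"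
    and J_sc: "\<And>c x. J (sc c x) = sc (cnj c) (J x)"
    and J_J: "\<And>x. J (J x) = x"
    and nrm_J: "\<And>x. x \<in> X \<Longrightarrow> nrm (J x) = nrm x"
    and J_gen: "\<And>x y. (x, y) \<in> generator X sc nrm S \<Longrightarrow> (J x, J y) \<in> generator X sc nrm S"
    and "0 \<le> t" "x \<in> X"
  shows "nrm (J (S t x) - S t (J x)) = 0"
proof -
  interpret S: C0_semigroup_on sc X nrm S by unfold_locales (rule S)
  define R where "R t x = J (S t (J x))" for t x
  have J_diff: "J (x - y) = J x - J y" for x y using J_add[of "x - y" y] by (simp add: eq_diff_eq)
  have R: "C0_semigroup X sc nrm R"
    unfolding C0_semigroup_def
  proof (intro conjI allI impI ballI)
    fix t f assume t: "(0::real) \<le> t"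
    show "R t f \<in> X" if "f \<in> X" using that t by (simp add: R_def J_in)
    show "nrm (R t (f + g) - (R t f + R t g)) = 0" if "f \<in> X" "g \<in> X" for g
      using S.S_add[OF t, of "J f" "J g"] that t by (simp add: R_def J_add J_in nrm_J flip: J_add J_diff)
    show "nrm (R t (sc c f) - sc c (R t f)) = 0" if "f \<in> X" for c
    proof -
      have "R t (sc c f) - sc c (R t f) = J (S t (sc (cnj c) (J f)) - sc (cnj c) (S t (J f)))"
        by (simp add: R_def J_sc J_diff)
      then show ?thesis using S.S_sc[OF t, of "J f" "cnj c"] that t by (simp add: J_in nrm_J)
    qed
    show "\<exists>K. \<forall>f\<in>X. nrm (R t f) \<le> K * nrm f"
      using S.S_bounded[OF t] t by (metis J_in R_def S.S_in nrm_J)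
    show "nrm (R (t + s) f - R t (R s f)) = 0" if "0 \<le> s" "f \<in> X" for s
      using S.S_semigroup[OF t that(1), of "J f"] that t by (simp add: R_def J_J J_in nrm_J flip: J_diff)
  next
    fix f assume f: "f \<in> X"
    have eq: "nrm (R t f - f) = nrm (S t (J f) - J f)" if "0 \<le> t" for t
    proof -
      have "R t f - f = J (S t (J f) - J f)" by (simp add: R_def J_diff J_J)
      then show ?thesis using f that by (simp add: nrm_J J_in)
    qed
    show "nrm (R 0 f - f) = 0" using eq[of 0] S.S_0[of "J f"] f J_in by simp
    show "((\<lambda>t. nrm (R t f - f)) \<longlongrightarrow> 0) (at_right 0)"
      by (rule Lim_transform_eventually[OF S.S_tendsto[OF J_in[OF f]]])
        (auto simp: eq intro!: eventually_mono[OF eventually_at_right_less[of 0]])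
  qed
  have "generator X sc nrm R \<subseteq> generator X sc nrm S"
  proof safe
    fix f g assume "(f, g) \<in> generator X sc nrm R"
    then have f: "f \<in> X" and g: "g \<in> X"
      and lim: "((\<lambda>h. nrm (sc (complex_of_real (1 / h)) (R h f - f) - g)) \<longlongrightarrow> 0) (at_right 0)"
      by (auto simp: generator_def)
    have "nrm (sc (complex_of_real (1 / h)) (R h f - f) - g)
      = nrm (sc (complex_of_real (1 / h)) (S h (J f) - J f) - J g)" if "0 < h" for h
    proof -
      have "sc (complex_of_real (1 / h)) (R h f - f) - g
        = J (sc (complex_of_real (1 / h)) (S h (J f) - J f) - J g)"
        by (simp add: R_def J_diff J_J J_sc)
      then show ?thesis using f g that by (simp add: nrm_J J_in del: of_real_divide)
    qed
    then have "((\<lambda>h. nrm (sc (complex_of_real (1 / h)) (S h (J f) - J f) - J g)) \<longlongrightarrow> 0) (at_right 0)"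
      by (intro Lim_transform_eventually[OF lim])
        (auto intro!: eventually_mono[OF eventually_at_right_less[of 0]])
    then have "(J f, J g) \<in> generator X sc nrm S" using f g J_in by (simp add: generator_def)
    from J_gen[OF this] show "(f, g) \<in> generator X sc nrm S" by (simp add: J_J)
  qed
  from generator_determines_semigroup[OF S R this \<open>0 \<le> t\<close> J_in[OF \<open>x \<in> X\<close>]]
  have "nrm (S t (J x) - J (S t x)) = 0" by (simp add: R_def J_J)
  then show ?thesis using assms(8,9) J_in by - (rule null_sym, auto)
qed

end

section \<open>Completeness of spaces of square-integrable functions\<close>

lemma norm_add_sq_le: "(norm (a + b :: 'a::real_normed_vector))\<^sup>2 \<le> 2 * (norm a)\<^sup>2 + 2 * (norm b)\<^sup>2"
proof -
  have "(norm (a + b))\<^sup>2 \<le> (norm a + norm b)\<^sup>2" by (intro power_mono norm_triangle_ineq) auto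
  also have "\<dots> \<le> 2 * (norm a)\<^sup>2 + 2 * (norm b)\<^sup>2"
    using zero_le_power2[of "norm a - norm b"] by (simp add: power2_sum power2_diff)
  finally show ?thesis .
qed

lemma square_integrable_add:
  fixes f g :: "'a \<Rightarrow> complex"
  assumes "f \<in> borel_measurable M" "integrable M (\<lambda>s. (cmod (f s))\<^sup>2)"
    and "g \<in> borel_measurable M" "integrable M (\<lambda>s. (cmod (g s))\<^sup>2)"
  shows "integrable M (\<lambda>s. (cmod (f s + g s))\<^sup>2)"
proof (rule Bochner_Integration.integrable_bound)
  show "integrable M (\<lambda>s. 2 * (cmod (f s))\<^sup>2 + 2 * (cmod (g s))\<^sup>2)" using assms by auto
  show "AE s in M. norm ((cmod (f s + g s))\<^sup>2) \<le> norm (2 * (cmod (f s))\<^sup>2 + 2 * (cmod (g s))\<^sup>2)"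
    using norm_add_sq_le by (intro AE_I2) (simp add: norm_add_sq_le)
  show "(\<lambda>s. (cmod (f s + g s))\<^sup>2) \<in> borel_measurable M" using assms by measurable
qed

lemma square_integrable_mult:
  fixes f g :: "'a \<Rightarrow> complex"
  assumes "f \<in> borel_measurable M" "integrable M (\<lambda>s. (cmod (f s))\<^sup>2)"
    and "g \<in> borel_measurable M" "integrable M (\<lambda>s. (cmod (g s))\<^sup>2)"
  shows "integrable M (\<lambda>s. f s * g s)"
proof (rule Bochner_Integration.integrable_bound)
  show "integrable M (\<lambda>s. (cmod (f s))\<^sup>2 + (cmod (g s))\<^sup>2)" using assms by auto
  have "norm (f s * g s) \<le> norm ((cmod (f s))\<^sup>2 + (cmod (g s))\<^sup>2)" for s
  proof -
    have "2 * (cmod (f s) * cmod (g s)) \<le> (cmod (f s))\<^sup>2 + (cmod (g s))\<^sup>2"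
      using sum_squares_bound[of "cmod (f s)" "cmod (g s)"] by simp
    moreover have "0 \<le> cmod (f s) * cmod (g s)" by simp
    ultimately have "cmod (f s) * cmod (g s) \<le> (cmod (f s))\<^sup>2 + (cmod (g s))\<^sup>2" by linarith
    then show ?thesis by (simp add: norm_mult)
  qed
  then show "AE s in M. norm (f s * g s) \<le> norm ((cmod (f s))\<^sup>2 + (cmod (g s))\<^sup>2)" by (intro AE_I2)
  show "(\<lambda>s. f s * g s) \<in> borel_measurable M" using assms by measurable
qed

text \<open>
  The weights \<open>2\<^sup>n\<close> leave room to spare in the rate \<open>4\<^sup>-\<^sup>n\<close>: the function \<open>H = (\<Sum>n. 2\<^sup>n \<bar>f\<^sub>n\<^sub>+\<^sub>1 - f\<^sub>n\<bar>\<^sup>2)\<close>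
  is integrable, and \<open>\<bar>f\<^sub>n\<^sub>+\<^sub>1 - f\<^sub>n\<bar> \<le> 2\<^sup>-\<^sup>n\<^sup>/\<^sup>2 \<surd>H\<close> almost everywhere.  So \<open>f\<^sub>n\<close> converges pointwise, and summing the
  geometric tail gives \<open>\<bar>f\<^sub>n - g\<bar>\<^sup>2 \<le> c\<^sup>2 2\<^sup>-\<^sup>n H\<close>.
\<close>

lemma square_integrable_fast_limit:
  fixes f :: "nat \<Rightarrow> 'a \<Rightarrow> complex"
  assumes meas: "\<And>n. f n \<in> borel_measurable M"
    and int: "\<And>n. integrable M (\<lambda>s. (cmod (f n s))\<^sup>2)"
    and fast: "\<And>n. (LINT s|M. (cmod (f (Suc n) s - f n s))\<^sup>2) \<le> C * (1/4) ^ n"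
  shows "\<exists>g\<in>borel_measurable M. integrable M (\<lambda>s. (cmod (g s))\<^sup>2) \<and>
           (\<lambda>n. LINT s|M. (cmod (f n s - g s))\<^sup>2) \<longlonglongrightarrow> 0"
proof -
  define d where "d n s = f (Suc n) s - f n s" for n s
  define h where "h n s = 2 ^ n * (cmod (d n s))\<^sup>2" for n s
  have d_meas: "d n \<in> borel_measurable M" for n unfolding d_def using meas by measurable
  have d_int: "integrable M (\<lambda>s. (cmod (d n s))\<^sup>2)" for n
    using square_integrable_add[of "f (Suc n)" M "\<lambda>s. - f n s"] meas int by (simp add: d_def)
  have h_int: "integrable M (h n)" and h_nonneg: "0 \<le> h n s" for n s
    unfolding h_def using d_int by auto
  have h_le: "(LINT s|M. h n s) \<le> C * (1/2) ^ n" for n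
  proof -
    have "(LINT s|M. h n s) = 2 ^ n * (LINT s|M. (cmod (d n s))\<^sup>2)" by (simp add: h_def)
    also have "\<dots> \<le> 2 ^ n * (C * (1/4) ^ n)" using fast[of n] by (intro mult_left_mono) (auto simp: d_def)
    also have "\<dots> = C * (1/2) ^ n" by (simp add: power_divide flip: power_mult_distrib)
        (simp add: field_simps flip: power_mult_distrib)
    finally show ?thesis .
  qed
  have summ: "summable (\<lambda>n. LINT s|M. h n s)"
  proof (rule summable_comparison_test)
    show "summable (\<lambda>n. C * (1/2::real) ^ n)" by (intro summable_mult summable_geometric) simp
    show "\<exists>N. \<forall>n\<ge>N. norm (LINT s|M. h n s) \<le> C * (1/2) ^ n"
      using h_le h_nonneg by (auto simp: integral_nonneg_AE)
  qed
  have ae: "AE s in M. summable (\<lambda>n. h n s)"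
  proof -
    have "(\<integral>\<^sup>+s. (\<Sum>n. ennreal (h n s)) \<partial>M) = (\<Sum>n. \<integral>\<^sup>+s. ennreal (h n s) \<partial>M)"
      using h_int by (intro nn_integral_suminf) auto
    also have "\<dots> = (\<Sum>n. ennreal (LINT s|M. h n s))"
      using h_int h_nonneg by (intro suminf_cong nn_integral_eq_integral) auto
    also have "\<dots> = ennreal (\<Sum>n. LINT s|M. h n s)"
      using summ h_nonneg by (intro suminf_ennreal2) (auto simp: integral_nonneg_AE)
    finally have "(\<integral>\<^sup>+s. (\<Sum>n. ennreal (h n s)) \<partial>M) \<noteq> \<infinity>" by simp
    then have "AE s in M. (\<Sum>n. ennreal (h n s)) \<noteq> \<infinity>"
      using h_int by (intro nn_integral_PInf_AE) auto
    then show ?thesis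
      by eventually_elim (use h_nonneg in \<open>auto intro: summable_suminf_not_top\<close>)
  qed
  define H where "H s = (\<Sum>n. h n s)" for s
  have H_int: "integrable M H"
    unfolding H_def using h_int h_nonneg summ ae by (intro integrable_suminf) auto
  define r where "r = sqrt (1/2)"
  have r: "0 \<le> r" "r < 1" "r\<^sup>2 = 1/2" by (auto simp: r_def real_less_lsqrt)
  have rk: "(r ^ k)\<^sup>2 = (1/2) ^ k" for k using r(3) by (metis mult.commute power_mult)
  define c where "c = 1 / (1 - r)"
  define g where "g s = lim (\<lambda>n. f n s)" for s
  have g_meas: "g \<in> borel_measurable M" unfolding g_def using meas by (rule borel_measurable_lim_metric)
  have diff: "(cmod (f n s - g s))\<^sup>2 \<le> (c\<^sup>2 * (1/2) ^ n) * H s"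
    if "summable (\<lambda>n. h n s)" for s n
  proof -
    have "h k s \<le> H s" for k
      unfolding H_def using sum_le_suminf[OF that, of "{k}"] h_nonneg by simp
    then have "(cmod (d k s))\<^sup>2 \<le> (1/2) ^ k * H s" for k
      by (simp add: h_def field_simps)
    also have "(1/2) ^ k * H s = (r ^ k * sqrt (H s))\<^sup>2" for k
    proof -
      have "0 \<le> H s" unfolding H_def using that h_nonneg by (intro suminf_nonneg)
      then show ?thesis by (simp add: power_mult_distrib rk)
    qed
    finally have d_le: "cmod (d k s) \<le> r ^ k * sqrt (H s)" for k
    proof -
      assume *: "\<And>k. (cmod (d k s))\<^sup>2 \<le> (r ^ k * sqrt (H s))\<^sup>2"
      have "0 \<le> H s" unfolding H_def using that h_nonneg by (intro suminf_nonneg)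
      then show ?thesis using r by (intro power2_le_imp_le[OF *]) auto
    qed
    have geo: "(\<lambda>k. r ^ (k + n) * sqrt (H s)) sums (r ^ n * c * sqrt (H s))"
      using sums_mult2[OF sums_mult[OF geometric_sums[of r], of "r ^ n"], of "sqrt (H s)"] r
      by (simp add: c_def power_add mult_ac)
    have sum_d: "summable (\<lambda>k. norm (d (k + n) s))"
      using d_le by (intro summable_comparison_test'[OF sums_summable[OF geo], of 0]) auto
    have sum_d0: "summable (\<lambda>k. d k s)"
      using summable_norm_cancel[OF sum_d] by (rule summable_iff_shift[THEN iffD1])
    have f_eq: "f n s = f 0 s + (\<Sum>k<n. d k s)" for n
      unfolding d_def by (subst sum_lessThan_telescope) simp
    have "(\<lambda>n. f 0 s + (\<Sum>k<n. d k s)) \<longlonglongrightarrow> f 0 s + (\<Sum>k. d k s)"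
      using sum_d0 by (intro tendsto_add tendsto_const summable_LIMSEQ)
    then have "(\<lambda>n. f n s) \<longlonglongrightarrow> f 0 s + (\<Sum>k. d k s)"
      by (simp only: flip: f_eq)
    then have "g s = f 0 s + (\<Sum>k. d k s)" unfolding g_def by (rule limI)
    then have "g s - f n s = (\<Sum>k. d (k + n) s)"
      using suminf_split_initial_segment[OF sum_d0, of n] f_eq[of n] by simp
    then have "cmod (f n s - g s) \<le> (\<Sum>k. norm (d (k + n) s))"
      using summable_norm[OF sum_d] by (simp add: norm_minus_commute)
    also have "\<dots> \<le> r ^ n * c * sqrt (H s)"
      unfolding sums_unique[OF geo] using sum_d d_le by (intro suminf_le sums_summable[OF geo]) auto
    finally have "(cmod (f n s - g s))\<^sup>2 \<le> (r ^ n * c * sqrt (H s))\<^sup>2" by (intro power_mono) auto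
    also have "\<dots> = c\<^sup>2 * (1/2) ^ n * H s"
    proof -
      have "0 \<le> H s" unfolding H_def using that h_nonneg by (intro suminf_nonneg)
      then show ?thesis by (simp add: power_mult_distrib rk)
    qed
    finally show ?thesis .
  qed
  have diff_meas: "(\<lambda>s. (cmod (f n s - g s))\<^sup>2) \<in> borel_measurable M" for n
    using meas g_meas by measurable
  have diff_int: "integrable M (\<lambda>s. (cmod (f n s - g s))\<^sup>2)" for n
    by (rule Bochner_Integration.integrable_bound[OF integrable_mult_right[OF H_int, of "c\<^sup>2 * (1/2) ^ n"] diff_meas])
      (use ae diff in \<open>auto elim!: eventually_mono intro: order_trans[OF _ abs_ge_self]\<close>)
  have "integrable M (\<lambda>s. (cmod (g s))\<^sup>2)"
    using square_integrable_add[of "f 0" M "\<lambda>s. - (f 0 s - g s)"] meas int g_meas diff_int[of 0]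
    by (simp add: norm_minus_commute)
  moreover have "(\<lambda>n. LINT s|M. (cmod (f n s - g s))\<^sup>2) \<longlonglongrightarrow> 0"
  proof (rule tendsto_sandwich[OF _ _ tendsto_const])
    show "\<forall>\<^sub>F n in sequentially. 0 \<le> (LINT s|M. (cmod (f n s - g s))\<^sup>2)" by simp
    have "(LINT s|M. (cmod (f n s - g s))\<^sup>2) \<le> (LINT s|M. (c\<^sup>2 * (1/2) ^ n) * H s)" for n
      using ae diff by (intro integral_mono_AE diff_int integrable_mult_right H_int) (auto elim!: eventually_mono)
    then show "\<forall>\<^sub>F n in sequentially. (LINT s|M. (cmod (f n s - g s))\<^sup>2) \<le> (c\<^sup>2 * (LINT s|M. H s)) * (1/2) ^ n"
      by (simp add: mult_ac)
    show "(\<lambda>n. (c\<^sup>2 * (LINT s|M. H s)) * (1/2) ^ n) \<longlonglongrightarrow> 0"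
      by (intro tendsto_mult_right_zero LIMSEQ_power_zero) simp
  qed
  ultimately show ?thesis using g_meas by blast
qed

section \<open>Spaces with a positive semidefinite Hermitian form\<close>

text \<open>
  The form may be degenerate: on function spaces it vanishes on functions that are zero almost everywhere.
\<close>

locale semi_inner_space = vector_space sc
  for sc :: "complex \<Rightarrow> 'a::ab_group_add \<Rightarrow> 'a" +
  fixes X :: "'a set" and b :: "'a \<Rightarrow> 'a \<Rightarrow> complex"
  assumes subspace_X: "subspace X"
    and form_add: "\<And>x y z. x \<in> X \<Longrightarrow> y \<in> X \<Longrightarrow> z \<in> X \<Longrightarrow> b (x + y) z = b x z + b y z"
    and form_sc: "\<And>c x z. x \<in> X \<Longrightarrow> z \<in> X \<Longrightarrow> b (sc c x) z = c * b x z"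
    and form_cnj: "\<And>x y. x \<in> X \<Longrightarrow> y \<in> X \<Longrightarrow> b y x = cnj (b x y)"
    and form_nonneg: "\<And>x. x \<in> X \<Longrightarrow> 0 \<le> Re (b x x)"
begin

lemma X_mem: "0 \<in> X" "x \<in> X \<Longrightarrow> y \<in> X \<Longrightarrow> x + y \<in> X" "x \<in> X \<Longrightarrow> y \<in> X \<Longrightarrow> x - y \<in> X"
  "x \<in> X \<Longrightarrow> sc c x \<in> X" "x \<in> X \<Longrightarrow> - x \<in> X"
  using subspace_X by (auto intro: subspace_0 subspace_add subspace_diff subspace_scale subspace_neg)

lemma form_add_right:
  assumes "x \<in> X" "y \<in> X" "z \<in> X" shows "b z (x + y) = b z x + b z y"
  using form_add[OF assms] form_cnj[of z "x + y"] form_cnj[of z x] form_cnj[of z y] assms X_mem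
  by (metis complex_cnj_add complex_cnj_cnj)

lemma form_sc_right:
  assumes "x \<in> X" "z \<in> X" shows "b z (sc c x) = cnj c * b z x"
  using form_sc[OF assms, of c] form_cnj[of z "sc c x"] form_cnj[of z x] assms X_mem
  by (metis complex_cnj_cnj complex_cnj_mult)

lemma form_diff: "x \<in> X \<Longrightarrow> y \<in> X \<Longrightarrow> z \<in> X \<Longrightarrow> b (x - y) z = b x z - b y z"
  using form_add[of "x - y" y z] X_mem by simp

lemma form_0: "z \<in> X \<Longrightarrow> b 0 z = 0"
  using form_sc[of 0 z 0] X_mem by simp

lemma form_sum:
  assumes "\<And>i. i \<in> I \<Longrightarrow> x i \<in> X" "z \<in> X"
  shows "b (\<Sum>i\<in>I. x i) z = (\<Sum>i\<in>I. b (x i) z)"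
  using assms(1)
proof (induction I rule: infinite_finite_induct)
  case (insert i I)
  then show ?case using assms(2) subspace_sum[OF subspace_X, of I x] by (simp add: form_add)
qed (simp_all add: form_0 assms(2))

lemma Cauchy_Schwarz:
  assumes "x \<in> X" "y \<in> X"
  shows "(cmod (b x y))\<^sup>2 \<le> Re (b x x) * Re (b y y)"
proof (cases "b x y = 0")
  case True then show ?thesis using assms form_nonneg by simp
next
  case False
  \<comment> \<open>Multiplying \<open>y\<close> by the phase \<open>u\<close> of \<open>b x y\<close> makes the mixed term real and reduces to a real quadratic polynomial.\<close>
  define u where "u = b x y / cmod (b x y)"
  have u: "cnj u * b x y = cmod (b x y)" "cmod u = 1"
  proof -
    have "cnj (b x y) * b x y = complex_of_real ((cmod (b x y))\<^sup>2)"
      by (metis complex_norm_square mult.commute)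
    then show "cnj u * b x y = cmod (b x y)"
      using False by (simp add: u_def power2_eq_square)
  qed (use False in \<open>simp add: u_def norm_divide\<close>)
  have key: "0 \<le> Re (b x x) - 2 * t * cmod (b x y) + t\<^sup>2 * Re (b y y)" for t :: real
  proof -
    define w where "w = complex_of_real (- t) * u"
    have wy: "sc w y \<in> X" using assms X_mem by simp
    have "b (x + sc w y) (x + sc w y) = b x x + cnj w * b x y + (w * b y x + w * (cnj w * b y y))"
      using assms wy X_mem
      by (simp add: form_add form_add_right form_sc form_sc_right distrib_left mult.left_commute)
    also have "b y x = cnj (b x y)" using assms by (rule form_cnj)
    also have "w * cnj (b x y) = cnj (cnj w * b x y)" by simp
    also have "cnj w * b x y = complex_of_real (- t * cmod (b x y))"
      using u(1) by (simp add: w_def mult.assoc)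
    also have "w * (cnj w * b y y) = complex_of_real (t\<^sup>2) * b y y"
    proof -
      have "w * cnj w = complex_of_real ((cmod w)\<^sup>2)" by (metis complex_norm_square)
      also have "cmod w = \<bar>t\<bar>" using u(2) by (simp add: w_def norm_mult)
      finally show ?thesis by (simp add: mult.assoc[symmetric])
    qed
    finally have "Re (b (x + sc w y) (x + sc w y)) = Re (b x x) - 2 * t * cmod (b x y) + t\<^sup>2 * Re (b y y)"
      by simp
    then show ?thesis using form_nonneg[of "x + sc w y"] assms wy X_mem by simp
  qed
  show ?thesis
  proof (cases "Re (b y y) = 0")
    case True
    have "0 < cmod (b x y)" using False by simp
    then show ?thesis using key[of "(Re (b x x) + 1) / (2 * cmod (b x y))"] True by simp
  next
    case False
    then have pos: "Re (b y y) > 0" using form_nonneg[OF assms(2)] by simp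
    have "0 \<le> Re (b x x) - (cmod (b x y))\<^sup>2 / Re (b y y)"
      using key[of "cmod (b x y) / Re (b y y)"] pos by (simp add: power2_eq_square field_simps)
    then show ?thesis using pos by (simp add: field_simps)
  qed
qed

definition snorm :: "'a \<Rightarrow> real" where "snorm x = sqrt (Re (b x x))"

lemma cmod_form_le: "x \<in> X \<Longrightarrow> y \<in> X \<Longrightarrow> cmod (b x y) \<le> snorm x * snorm y"
  using Cauchy_Schwarz[of x y] by (auto simp: snorm_def real_le_rsqrt simp flip: real_sqrt_mult)

sublocale seminormed_space sc X snorm
proof
  show "subspace X" by (rule subspace_X)
  fix x y assume xy: "x \<in> X" "y \<in> X"
  have "Re (b (x + y) (x + y)) = Re (b x x) + Re (b y y) + 2 * Re (b x y)"
    using xy form_cnj[OF xy] X_mem by (simp add: form_add form_add_right)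
  also have "\<dots> \<le> (snorm x)\<^sup>2 + (snorm y)\<^sup>2 + 2 * (snorm x * snorm y)"
    using cmod_form_le[OF xy] complex_Re_le_cmod[of "b x y"] xy form_nonneg by (simp add: snorm_def)
  also have "\<dots> = (snorm x + snorm y)\<^sup>2" by (simp add: power2_sum)
  finally have "snorm (x + y) \<le> sqrt ((snorm x + snorm y)\<^sup>2)"
    unfolding snorm_def[of "x + y"] by (rule real_sqrt_le_mono)
  then show "snorm (x + y) \<le> snorm x + snorm y"
    using xy form_nonneg by (simp add: snorm_def)
next
  fix c x assume x: "x \<in> X"
  have "b (sc c x) (sc c x) = complex_of_real ((cmod c)\<^sup>2) * b x x"
    unfolding complex_norm_square using x X_mem by (simp add: form_sc form_sc_right mult_ac)
  then show "snorm (sc c x) = cmod c * snorm x" by (simp add: snorm_def real_sqrt_mult)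
qed

end

locale finite_inner_space = semi_inner_space +
  assumes definite: "\<And>x. x \<in> X \<Longrightarrow> x \<noteq> 0 \<Longrightarrow> 0 < Re (b x x)"
    and finite_spanned: "\<exists>A. finite A \<and> A \<subseteq> X \<and> X \<subseteq> span A"
begin

definition orthonormal :: "'a set \<Rightarrow> bool" where
  "orthonormal B \<longleftrightarrow> finite B \<and> B \<subseteq> X \<and> (\<forall>x\<in>B. \<forall>y\<in>B. b x y = (if x = y then 1 else 0))"

lemma form_expansion:
  assumes B: "orthonormal B" and "y \<in> B"
  shows "b (\<Sum>x\<in>B. sc (c x) x) y = c y"
proof -
  have "b (\<Sum>x\<in>B. sc (c x) x) y = (\<Sum>x\<in>B. c x * b x y)"
    using assms X_mem by (subst form_sum) (auto simp: orthonormal_def form_sc subset_iff)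
  also have "\<dots> = (\<Sum>x\<in>B. if x = y then c x else 0)"
    using assms by (intro sum.cong) (auto simp: orthonormal_def)
  finally show ?thesis using assms by (simp add: orthonormal_def)
qed

lemma orthonormal_in_span:
  assumes B: "orthonormal B" and x: "x \<in> span B"
  shows "x = (\<Sum>y\<in>B. sc (b x y) y)"
proof -
  from x B obtain c where c: "x = (\<Sum>y\<in>B. sc (c y) y)"
    by (auto simp: orthonormal_def span_finite)
  with form_expansion[OF B] show ?thesis by simp
qed

text \<open>
  One step of the Gram-Schmidt process.
\<close>

lemma orthonormal_extend:
  assumes B: "orthonormal B" and x: "x \<in> X"
  shows "\<exists>B'. orthonormal B' \<and> span (insert x B) \<subseteq> span B'"
proof -
  define y where "y = x - (\<Sum>z\<in>B. sc (b x z) z)"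
  have BX: "B \<subseteq> X" "finite B" using B by (auto simp: orthonormal_def)
  have sumX: "(\<Sum>z\<in>B. sc (b x z) z) \<in> X" using BX by (intro X_sum) auto
  have y: "y \<in> X" unfolding y_def using x sumX by simp
  have orth: "b y z = 0" "b z y = 0" if "z \<in> B" for z
  proof -
    show "b y z = 0" using that BX x sumX form_expansion[OF B that] by (simp add: y_def form_diff subset_iff)
    then show "b z y = 0" using form_cnj[of y z] y that BX by auto
  qed
  have sum_span: "(\<Sum>z\<in>B. sc (b x z) z) \<in> span B" by (intro span_sum span_scale span_base)
  show ?thesis
  proof (cases "y = 0")
    case True
    then have "x \<in> span B" using sum_span by (simp add: y_def)
    then show ?thesis using B by (intro exI[of _ B]) (simp add: span_redundant)
  next
    case False
    then have pos: "Re (b y y) > 0" using definite y by simp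
    have real: "b y y = complex_of_real (Re (b y y))"
      using arg_cong[OF form_cnj[OF y y], of Im] by (simp add: complex_eq_iff)
    define c where "c = complex_of_real (1 / sqrt (Re (b y y)))"
    define w where "w = sc c y"
    have "c * cnj c * complex_of_real (Re (b y y)) = 1"
      unfolding c_def using pos by (simp flip: of_real_mult)
    then have ww: "b w w = 1"
      using y X_mem unfolding real[symmetric] by (simp add: w_def form_sc form_sc_right mult_ac)
    have w: "w \<in> X" "\<And>z. z \<in> B \<Longrightarrow> b w z = 0" "\<And>z. z \<in> B \<Longrightarrow> b z w = 0"
      using y orth BX by (auto simp: w_def form_sc form_sc_right subset_iff)
    have "orthonormal (insert w B)"
      using B ww w unfolding orthonormal_def by auto
    moreover have "x \<in> span (insert w B)"
    proof -
      have "c \<noteq> 0" using pos by (simp add: c_def)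
      then have "y = sc (1 / c) w" by (simp add: w_def)
      then have "y \<in> span (insert w B)" by (simp add: span_base span_scale)
      moreover have "(\<Sum>z\<in>B. sc (b x z) z) \<in> span (insert w B)"
        using sum_span span_mono[of B "insert w B"] by blast
      ultimately have "y + (\<Sum>z\<in>B. sc (b x z) z) \<in> span (insert w B)" by (rule span_add)
      then show ?thesis by (simp add: y_def)
    qed
    then have "span (insert x B) \<subseteq> span (insert w B)"
      by (intro span_minimal subspace_span) (auto intro: span_base)
    ultimately show ?thesis by blast
  qed
qed

lemma orthonormal_basis: "\<exists>B. orthonormal B \<and> X \<subseteq> span B"
proof -
  obtain A where A: "finite A" "A \<subseteq> X" "X \<subseteq> span A" using finite_spanned by blast
  from A(1,2) have "\<exists>B. orthonormal B \<and> span A \<subseteq> span B"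
  proof (induction A rule: finite_induct)
    case empty
    have "orthonormal {}" by (simp add: orthonormal_def)
    then show ?case by blast
  next
    case (insert x A)
    then obtain B where B: "orthonormal B" "span A \<subseteq> span B" by auto
    obtain B' where B': "orthonormal B'" "span (insert x B) \<subseteq> span B'"
      using orthonormal_extend[OF B(1)] insert.prems by blast
    have "insert x A \<subseteq> span (insert x B)"
      using B(2) span_superset[of A] span_mono[of B "insert x B"] span_base[of x "insert x B"] by blast
    then have "span (insert x A) \<subseteq> span B'"
      using B'(2) by (intro span_minimal subspace_span) blast
    then show ?case using B'(1) by blast
  qed
  with A(3) show ?thesis by blast
qed

sublocale banach_seminormed_space sc X snorm
proof
  fix x :: "nat \<Rightarrow> 'a"
  assume x: "\<And>n. x n \<in> X" and fast: "\<And>n. snorm (x (Suc n) - x n) \<le> (1/2) ^ n"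
  obtain B where B: "orthonormal B" "X \<subseteq> span B" using orthonormal_basis by blast
  have BX: "y \<in> X" if "y \<in> B" for y using that B(1) by (auto simp: orthonormal_def)
  have nB: "snorm y = 1" if "y \<in> B" for y using that B(1) by (simp add: orthonormal_def snorm_def)
  define c where "c n y = b (x n) y" for n y
  have "\<exists>l. (\<lambda>n. c n y) \<longlonglongrightarrow> l" if y: "y \<in> B" for y
  proof -
    have "cmod (c (Suc n) y - c n y) \<le> (1/2) ^ n" for n
    proof -
      have "c (Suc n) y - c n y = b (x (Suc n) - x n) y"
        using x BX[OF y] by (simp add: c_def form_diff)
      then show ?thesis
        using cmod_form_le[of "x (Suc n) - x n" y] x BX[OF y] nB[OF y] fast[of n] by simp
    qed
    then have "summable (\<lambda>n. c (Suc n) y - c n y)"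
      by (intro summable_comparison_test'[OF summable_geometric[of "1/2::real"], of 0]) auto
    then have "(\<lambda>n. c 0 y + (\<Sum>k<n. c (Suc k) y - c k y)) \<longlonglongrightarrow> c 0 y + (\<Sum>k. c (Suc k) y - c k y)"
      by (intro tendsto_add tendsto_const summable_LIMSEQ)
    then show ?thesis by (subst (asm) sum_lessThan_telescope) auto
  qed
  then obtain l where l: "\<And>y. y \<in> B \<Longrightarrow> (\<lambda>n. c n y) \<longlonglongrightarrow> l y" by metis
  define z where "z = (\<Sum>y\<in>B. sc (l y) y)"
  have z: "z \<in> X" unfolding z_def using BX by (intro X_sum) auto
  have "snorm (x n - z) \<le> (\<Sum>y\<in>B. cmod (c n y - l y))" for n
  proof -
    have "x n = (\<Sum>y\<in>B. sc (c n y) y)"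
      unfolding c_def using B x by (intro orthonormal_in_span) auto
    then have "x n - z = (\<Sum>y\<in>B. sc (c n y - l y) y)"
      by (simp add: z_def sum_subtractf scale_left_diff_distrib)
    also have "snorm \<dots> \<le> (\<Sum>y\<in>B. snorm (sc (c n y - l y) y))" using BX by (intro nrm_sum_le) auto
    also have "\<dots> = (\<Sum>y\<in>B. cmod (c n y - l y))" using BX nB by (intro sum.cong) (auto simp: nrm_sc)
    finally show ?thesis .
  qed
  then have le: "\<forall>\<^sub>F n in sequentially. snorm (x n - z) \<le> (\<Sum>y\<in>B. cmod (c n y - l y))" by simp
  have ge: "\<forall>\<^sub>F n in sequentially. 0 \<le> snorm (x n - z)" using x z by simp
  have "(\<lambda>n. \<Sum>y\<in>B. cmod (c n y - l y)) \<longlonglongrightarrow> 0"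
    using l by (intro tendsto_null_sum) (simp add: tendsto_norm_zero_iff LIM_zero_iff)
  then have "(\<lambda>n. snorm (x n - z)) \<longlonglongrightarrow> 0"
    by (rule tendsto_sandwich[OF ge le tendsto_const])
  then show "\<exists>z\<in>X. (\<lambda>n. snorm (x n - z)) \<longlonglongrightarrow> 0" using z by blast
qed

end

section \<open>Conjugation and orthogonal projections in coordinate spaces\<close>

definition cnjf :: "('i \<Rightarrow> complex) \<Rightarrow> 'i \<Rightarrow> complex" where
  "cnjf \<xi> = (\<lambda>j. cnj (\<xi> j))"

lemma cnjf_cnjf [simp]: "cnjf (cnjf \<xi>) = \<xi>"
  by (simp add: cnjf_def)

lemma cnjf_add: "cnjf (\<xi> + \<eta>) = cnjf \<xi> + cnjf \<eta>"
  by (simp add: cnjf_def fun_eq_iff)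

lemma ip_add_left: "ip I (\<xi> + \<eta>) \<zeta> = ip I \<xi> \<zeta> + ip I \<eta> \<zeta>"
  by (simp add: ip_def distrib_right sum.distrib)

lemma ip_diff_left: "ip I (\<xi> - \<eta>) \<zeta> = ip I \<xi> \<zeta> - ip I \<eta> \<zeta>"
  by (simp add: ip_def left_diff_distrib sum_subtractf)

lemma ip_cscale_left: "ip I (cscale c \<xi>) \<zeta> = c * ip I \<xi> \<zeta>"
  by (simp add: ip_def cscale_def sum_distrib_left mult.assoc)

lemma ip_0_left: "ip I 0 \<zeta> = 0"
  by (simp add: ip_def)

lemma ip_commute: "ip I \<eta> \<xi> = cnj (ip I \<xi> \<eta>)"
  by (simp add: ip_def mult.commute)

lemma ip_cnjf: "ip I (cnjf \<xi>) (cnjf \<eta>) = cnj (ip I \<xi> \<eta>)"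
  by (simp add: ip_def cnjf_def)

lemma ip_self: "ip I \<xi> \<xi> = complex_of_real (\<Sum>j\<in>I. (cmod (\<xi> j))\<^sup>2)"
  by (simp add: ip_def complex_norm_square flip: of_real_power)

lemma ip_self_pos:
  assumes "finite I" "\<xi> \<in> cspace I" "\<xi> \<noteq> 0"
  shows "0 < Re (ip I \<xi> \<xi>)"
proof -
  obtain j where j: "\<xi> j \<noteq> 0" using assms(3) by (auto simp: fun_eq_iff)
  then have "j \<in> I" using assms(2) by (auto simp: cspace_def)
  then show ?thesis unfolding ip_self using assms(1) j by (auto intro: sum_pos2)
qed

lemma sum_apply: "(\<Sum>i\<in>I. f i) x = (\<Sum>i\<in>I. f i x)"
  by (induction I rule: infinite_finite_induct) auto

text \<open>
  In the encoding of coordinate spaces by functions that vanish outside \<open>I\<close>, finite dimension of a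
  subspace has to be derived from the unit vectors of \<open>\<complex>\<^sup>I\<close>.
\<close>

lemma subspace_finite_span:
  assumes "finite I" "cfun.subspace U" "U \<subseteq> cspace I"
  shows "\<exists>A. finite A \<and> A \<subseteq> U \<and> U \<subseteq> cfun.span A"
proof -
  define E where "E = (\<lambda>i j. if j = i then 1 else 0 :: complex) ` I"
  have "\<xi> \<in> cfun.span E" if "\<xi> \<in> cspace I" for \<xi>
  proof -
    have "\<xi> = (\<Sum>i\<in>I. cscale (\<xi> i) (\<lambda>j. if j = i then 1 else 0))"
    proof
      fix j
      have "(\<Sum>i\<in>I. cscale (\<xi> i) (\<lambda>j. if j = i then 1 else 0)) j = (\<Sum>i\<in>I. if i = j then \<xi> i else 0)"
        unfolding sum_apply cscale_def by (intro sum.cong) auto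
      then show "\<xi> j = (\<Sum>i\<in>I. cscale (\<xi> i) (\<lambda>j. if j = i then 1 else 0)) j"
        using assms(1) that by (auto simp: cspace_def)
    qed
    also have "\<dots> \<in> cfun.span E"
      by (intro cfun.span_sum cfun.span_scale cfun.span_base) (auto simp: E_def)
    finally show ?thesis .
  qed
  then have "U \<subseteq> cfun.span E" using assms(3) by blast
  moreover obtain B where B: "B \<subseteq> U" "cfun.independent B" "U \<subseteq> cfun.span B"
    using cfun.maximal_independent_subset by blast
  ultimately have "finite B"
    using cfun.independent_span_bound[of E B] assms(1) by (auto simp: E_def)
  with B show ?thesis by blast
qed

lemma finite_inner_space_ip:
  assumes "finite I" "cfun.subspace U" "U \<subseteq> cspace I"
  shows "finite_inner_space cscale U (ip I)"
proof unfold_locales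
  show "0 < Re (ip I \<xi> \<xi>)" if "\<xi> \<in> U" "\<xi> \<noteq> 0" for \<xi>
    using ip_self_pos that assms by blast
  show "\<exists>A. finite A \<and> A \<subseteq> U \<and> U \<subseteq> cfun.span A"
    using subspace_finite_span assms by blast
  show "0 \<le> Re (ip I \<xi> \<xi>)" for \<xi> by (simp add: ip_self sum_nonneg)
  show "ip I \<eta> \<xi> = cnj (ip I \<xi> \<eta>)" for \<xi> \<eta> by (rule ip_commute)
qed (use assms(2) in \<open>auto simp: ip_add_left ip_cscale_left\<close>)

lemma proj_unique:
  assumes "finite I" "cfun.subspace U" "U \<subseteq> cspace I"
    and "\<eta> \<in> U" "\<forall>\<zeta>\<in>U. ip I (\<xi> - \<eta>) \<zeta> = 0" "\<eta>' \<in> U" "\<forall>\<zeta>\<in>U. ip I (\<xi> - \<eta>') \<zeta> = 0"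
  shows "\<eta>' = \<eta>"
proof (rule ccontr)
  assume "\<eta>' \<noteq> \<eta>"
  have U: "\<eta> - \<eta>' \<in> U" using assms by (intro cfun.subspace_diff)
  have "ip I (\<eta> - \<eta>') (\<eta> - \<eta>') = ip I (\<xi> - \<eta>') (\<eta> - \<eta>') - ip I (\<xi> - \<eta>) (\<eta> - \<eta>')"
    by (simp add: ip_diff_left)
  also have "\<dots> = 0" using assms U by simp
  finally show False using ip_self_pos[of I "\<eta> - \<eta>'"] assms U \<open>\<eta>' \<noteq> \<eta>\<close> by auto
qed

lemma proj_exists:
  assumes "finite I" "cfun.subspace U" "U \<subseteq> cspace I"
  shows "\<exists>\<eta>\<in>U. \<forall>\<zeta>\<in>U. ip I (\<xi> - \<eta>) \<zeta> = 0"
proof -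
  interpret U: finite_inner_space cscale U "ip I" using assms by (rule finite_inner_space_ip)
  obtain B where B: "U.orthonormal B" "U \<subseteq> cfun.span B" using U.orthonormal_basis by blast
  have BU: "\<And>y. y \<in> B \<Longrightarrow> y \<in> U" using B(1) by (auto simp: U.orthonormal_def)
  define \<eta> where "\<eta> = (\<Sum>y\<in>B. cscale (ip I \<xi> y) y)"
  have \<eta>: "\<eta> \<in> U" unfolding \<eta>_def using BU by (intro U.X_sum U.X_sc)
  have orth: "ip I y (\<xi> - \<eta>) = 0" if "y \<in> B" for y
    using U.form_expansion[OF B(1) that, of "\<lambda>y. ip I \<xi> y"]
    by (subst ip_commute) (simp add: ip_diff_left \<eta>_def)
  have "ip I (\<xi> - \<eta>) \<zeta> = 0" if "\<zeta> \<in> U" for \<zeta>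
  proof -
    have ip_sum: "ip I (\<Sum>y\<in>C. cscale (c y) y) (\<xi> - \<eta>) = (\<Sum>y\<in>C. c y * ip I y (\<xi> - \<eta>))" for C c
      by (induction C rule: infinite_finite_induct)
        (simp_all only: sum.infinite sum.empty sum.insert ip_add_left ip_cscale_left ip_0_left not_False_eq_True)
    define z where "z = (\<Sum>y\<in>B. cscale (ip I \<zeta> y) y)"
    have "\<zeta> = z" unfolding z_def using B that by (intro U.orthonormal_in_span) auto
    then have "ip I \<zeta> (\<xi> - \<eta>) = ip I z (\<xi> - \<eta>)" by (rule arg_cong)
    also have "\<dots> = (\<Sum>y\<in>B. ip I \<zeta> y * ip I y (\<xi> - \<eta>))" unfolding z_def by (rule ip_sum)
    also have "\<dots> = 0" using orth by simp
    finally show ?thesis by (subst ip_commute) simp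
  qed
  with \<eta> show ?thesis by blast
qed

lemma proj_eqI:
  assumes "finite I" "cfun.subspace U" "U \<subseteq> cspace I" "\<eta> \<in> U" "\<forall>\<zeta>\<in>U. ip I (\<xi> - \<eta>) \<zeta> = 0"
  shows "proj I U \<xi> = \<eta>"
  unfolding proj_def
proof (rule the_equality)
  show "\<eta>' = \<eta>" if "\<eta>' \<in> U \<and> (\<forall>\<zeta>\<in>U. ip I (\<xi> - \<eta>') \<zeta> = 0)" for \<eta>'
    using that by (intro proj_unique[OF assms]) auto
qed (use assms in simp)

text \<open>
  Conjugation turns the orthogonality relation that characterizes the projection of \<open>\<xi>\<close> into the one for \<open>cnjf \<xi>\<close>,
  because the test vectors range over a space closed under conjugation.
\<close>

lemma proj_cnjf:
  assumes "finite I" "cfun.subspace U" "U \<subseteq> cspace I" and conj: "\<And>\<xi>. \<xi> \<in> U \<Longrightarrow> cnjf \<xi> \<in> U"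
  shows "proj I U (cnjf \<xi>) = cnjf (proj I U \<xi>)"
proof -
  obtain \<eta> where \<eta>: "\<eta> \<in> U" "\<forall>\<zeta>\<in>U. ip I (\<xi> - \<eta>) \<zeta> = 0" using proj_exists[OF assms(1-3)] by blast
  have "ip I (cnjf \<xi> - cnjf \<eta>) \<zeta> = 0" if "\<zeta> \<in> U" for \<zeta>
  proof -
    have "cnjf \<xi> - cnjf \<eta> = cnjf (\<xi> - \<eta>)" by (simp add: cnjf_def fun_eq_iff)
    then have "ip I (cnjf \<xi> - cnjf \<eta>) \<zeta> = ip I (cnjf (\<xi> - \<eta>)) (cnjf (cnjf \<zeta>))"
      by (simp only: cnjf_cnjf)
    also have "\<dots> = 0" unfolding ip_cnjf using \<eta>(2) conj[OF that] by simp
    finally show ?thesis .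
  qed
  then have "proj I U (cnjf \<xi>) = cnjf \<eta>"
    using conj[OF \<eta>(1)] by (intro proj_eqI[OF assms(1-3)]) blast+
  moreover have "proj I U \<xi> = \<eta>" using \<eta> by (intro proj_eqI[OF assms(1-3)]) blast+
  ultimately show ?thesis by (simp only:)
qed

text \<open>
  Here \<open>cnj \<xi> = 2 Re \<xi> - \<xi>\<close>.  The hypothesis speaks of families over all vertices, so \<open>\<xi>\<close> is extended by zero.
\<close>

lemma cnjf_closed:
  assumes "\<forall>x\<in>Pi V Y. re_vec x \<in> Pi V Y" and sub: "\<And>v. v \<in> V \<Longrightarrow> cfun.subspace (Y v)"
    and "v \<in> V" "\<xi> \<in> Y v"
  shows "cnjf \<xi> \<in> Y v"
proof -
  define x where "x = (\<lambda>w. if w = v then \<xi> else 0)"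
  have zero: "0 \<in> Y w" if "w \<in> V" for w using sub[OF that] by (rule cfun.subspace_0)
  have "x \<in> Pi V Y" using assms(4) zero by (simp add: x_def Pi_iff)
  then have "re_vec x \<in> Pi V Y" using assms(1) by blast
  then have "re_vec x v \<in> Y v" using assms(3) by blast
  then have "cscale 2 (re_vec x v) - \<xi> \<in> Y v"
    using sub assms(3,4) by (intro cfun.subspace_diff cfun.subspace_scale) auto
  also have "cscale 2 (re_vec x v) - \<xi> = cnjf \<xi>"
    by (simp add: cscale_def re_vec_def x_def cnjf_def fun_eq_iff complex_eq_iff)
  finally show ?thesis .
qed

text \<open>
  Being a real matrix concerns only the coordinates in \<open>I\<close>; all others vanish by the second hypothesis.
\<close>

lemma real_matrix_on_cnjf:
  assumes "real_matrix_on I U F" "\<And>\<xi>. \<xi> \<in> U \<Longrightarrow> F \<xi> \<in> cspace I" "\<xi> \<in> U" "cnjf \<xi> \<in> U"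
  shows "F (cnjf \<xi>) = cnjf (F \<xi>)"
proof
  fix i
  obtain R :: "'a \<Rightarrow> 'a \<Rightarrow> real"
    where R: "\<And>\<xi> i. \<xi> \<in> U \<Longrightarrow> i \<in> I \<Longrightarrow> F \<xi> i = (\<Sum>j\<in>I. complex_of_real (R i j) * \<xi> j)"
    using assms(1) by (auto simp: real_matrix_on_def)
  show "F (cnjf \<xi>) i = cnjf (F \<xi>) i"
  proof (cases "i \<in> I")
    case True then show ?thesis using R assms by (simp add: cnjf_def)
  next
    case False then show ?thesis using assms(2)[of \<xi>] assms(2)[of "cnjf \<xi>"] assms(3,4)
      by (simp add: cspace_def cnjf_def)
  qed
qed

section \<open>The quadratic form on an edge\<close>

lemma block_form:
  assumes "A \<in> carrier_mat (ncomp \<N> e) (ncomp \<N> e)"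
  shows "(A *\<^sub>v block \<N> e \<xi>) \<bullet>c block \<N> e \<eta> =
    (\<Sum>i<ncomp \<N> e. \<Sum>j<ncomp \<N> e. A $$ (i, j) * (\<xi> (e, j) * cnj (\<eta> (e, i))))"
  using assms
  by (simp add: scalar_prod_def block_def row_def sum_distrib_right mult.assoc atLeast0LessThan)

lemma block_sq: "block \<N> e \<xi> \<bullet>c block \<N> e \<xi> = complex_of_real (\<Sum>i<ncomp \<N> e. (cmod (\<xi> (e, i)))\<^sup>2)"
  by (simp add: scalar_prod_def block_def atLeast0LessThan complex_norm_square flip: of_real_power)

lemma adjoint_entries:
  assumes "mat_adjoint A = A" "A \<in> carrier_mat n n" "i < n" "j < n"
  shows "cnj (A $$ (i, j)) = A $$ (j, i)"
proof -
  have "A $$ (j, i) = mat_adjoint A $$ (j, i)" using assms(1) by simp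
  also have "\<dots> = cnj (A $$ (i, j))"
    using assms(2-4) by (simp add: mat_adjoint_def mat_of_rows_def cols_nth)
  finally show ?thesis by simp
qed

lemma L2_I: "f \<in> borel_measurable (lebesgue_on {0..l}) \<Longrightarrow>
    integrable (lebesgue_on {0..l}) (\<lambda>s. (cmod (f s))\<^sup>2) \<Longrightarrow> f \<in> L2 l"
  and L2_measurable: "f \<in> L2 l \<Longrightarrow> f \<in> borel_measurable (lebesgue_on {0..l})"
  and L2_integrable: "f \<in> L2 l \<Longrightarrow> integrable (lebesgue_on {0..l}) (\<lambda>s. (cmod (f s))\<^sup>2)"
  by (auto simp: L2_def)

lemma L2_add: "f \<in> L2 l \<Longrightarrow> g \<in> L2 l \<Longrightarrow> (\<lambda>s. f s + g s) \<in> L2 l"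
  by (rule L2_I[OF borel_measurable_add square_integrable_add])
    (simp_all add: L2_measurable L2_integrable)

lemma L2_scale: "f \<in> L2 l \<Longrightarrow> (\<lambda>s. c * f s) \<in> L2 l"
  by (rule L2_I[OF borel_measurable_times[OF borel_measurable_const L2_measurable]])
    (simp_all add: L2_integrable norm_mult power_mult_distrib)

lemma L2_cnj: "f \<in> L2 l \<Longrightarrow> (\<lambda>s. cnj (f s)) \<in> L2 l"
  by (rule L2_I[OF measurable_compose[OF L2_measurable
        borel_measurable_continuous_onI[OF continuous_on_cnj[OF continuous_on_id]]]])
    (simp_all add: L2_integrable)

lemma integrable_continuous_mult:
  fixes a f :: "real \<Rightarrow> complex"
  assumes "continuous_on {0..l} a" "integrable (lebesgue_on {0..l}) f"
  shows "integrable (lebesgue_on {0..l}) (\<lambda>s. a s * f s)"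
proof -
  have "compact (a ` {0..l})" using assms(1) by (intro compact_continuous_image) auto
  then obtain K where K: "\<And>s. s \<in> {0..l} \<Longrightarrow> cmod (a s) \<le> K"
    using compact_imp_bounded by (force simp: bounded_iff)
  show ?thesis
  proof (rule Bochner_Integration.integrable_bound)
    show "integrable (lebesgue_on {0..l}) (\<lambda>s. K * cmod (f s))" using assms(2) by auto
    show "(\<lambda>s. a s * f s) \<in> borel_measurable (lebesgue_on {0..l})"
      using assms continuous_imp_measurable_on_sets_lebesgue[OF assms(1)]
      by (intro borel_measurable_times) auto
    have "norm (a s * f s) \<le> norm (K * cmod (f s))" if "s \<in> {0..l}" for s
      using mult_right_mono[OF K[OF that], of "cmod (f s)"] by (simp add: norm_mult)
    then show "AE s in lebesgue_on {0..l}. norm (a s * f s) \<le> norm (K * cmod (f s))"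
      by (intro AE_I2) simp
  qed
qed

text \<open>
  The summands of \<open>inner_d\<close> that belong to the edges are treated one edge at a time.
\<close>

definition edge_states :: "('v, 'e) network \<Rightarrow> 'e \<Rightarrow> ('e \<times> nat \<Rightarrow> real \<Rightarrow> complex) set" where
  "edge_states \<N> e = {u. \<forall>i<ncomp \<N> e. u (e, i) \<in> L2 (len \<N> e)}"

definition edge_form :: "('v, 'e) network \<Rightarrow> 'e \<Rightarrow> ('e \<times> nat \<Rightarrow> real \<Rightarrow> complex) \<Rightarrow>
    ('e \<times> nat \<Rightarrow> real \<Rightarrow> complex) \<Rightarrow> complex" where
  "edge_form \<N> e u w = (LINT s|lebesgue_on {0..len \<N> e}.
     (Qe \<N> e s *\<^sub>v block \<N> e (\<lambda>j. u j s)) \<bullet>c block \<N> e (\<lambda>j. w j s))"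

lemma inner_d_eq:
  "inner_d \<N> f g = (\<Sum>e\<in>Es \<N>. edge_form \<N> e (fst f) (fst g)) +
     (\<Sum>v\<in>Vs \<N>. ip (idxv \<N> v) (Qv \<N> v (snd f v)) (snd g v))"
  by (simp add: inner_d_def edge_form_def case_prod_beta)

lemma lipschitz_mat_continuous:
  assumes "lipschitz_mat l n F" "i < n" "j < n"
  shows "continuous_on {0..l} (\<lambda>s. F s $$ (i, j))"
  using assms lipschitz_on_continuous_on unfolding lipschitz_mat_def by blast

context
  fixes \<N> :: "('v, 'e) network" and e
  assumes net: "network \<N>" and e: "e \<in> Es \<N>"
begin

lemma
  shows Qe_lipschitz: "lipschitz_mat (len \<N> e) (ncomp \<N> e) (Qe \<N> e)"
    and Qe_carrier: "\<And>s. s \<in> {0..len \<N> e} \<Longrightarrow> Qe \<N> e s \<in> carrier_mat (ncomp \<N> e) (ncomp \<N> e)"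
    and Qe_adjoint: "\<And>s. s \<in> {0..len \<N> e} \<Longrightarrow> mat_adjoint (Qe \<N> e s) = Qe \<N> e s"
    and Qe_elliptic: "\<exists>q>0. \<forall>s\<in>{0..len \<N> e}. \<forall>\<xi>\<in>carrier_vec (ncomp \<N> e).
           Re ((Qe \<N> e s *\<^sub>v \<xi>) \<bullet>c \<xi>) \<ge> q * Re (\<xi> \<bullet>c \<xi>)"
  using net e unfolding network_def lipschitz_mat_def by blast+

lemma edge_integrand_integrable:
  assumes u: "u \<in> edge_states \<N> e" and w: "w \<in> edge_states \<N> e"
  shows "integrable (lebesgue_on {0..len \<N> e})
    (\<lambda>s. (Qe \<N> e s *\<^sub>v block \<N> e (\<lambda>j. u j s)) \<bullet>c block \<N> e (\<lambda>j. w j s))"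
proof -
  have "integrable (lebesgue_on {0..len \<N> e}) (\<lambda>s. \<Sum>i<ncomp \<N> e. \<Sum>j<ncomp \<N> e.
      Qe \<N> e s $$ (i, j) * (u (e, j) s * cnj (w (e, i) s)))"
  proof (intro Bochner_Integration.integrable_sum, rule integrable_continuous_mult)
    fix i j assume ij: "i \<in> {..<ncomp \<N> e}" "j \<in> {..<ncomp \<N> e}"
    show "continuous_on {0..len \<N> e} (\<lambda>s. Qe \<N> e s $$ (i, j))"
      using ij by (intro lipschitz_mat_continuous[OF Qe_lipschitz]) auto
    show "integrable (lebesgue_on {0..len \<N> e}) (\<lambda>s. u (e, j) s * cnj (w (e, i) s))"
      using u w ij L2_cnj[of "w (e, i)" "len \<N> e"]
      by (intro square_integrable_mult L2_measurable L2_integrable) (auto simp: edge_states_def)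
  qed
  then show ?thesis
    by (subst Bochner_Integration.integrable_cong[OF refl block_form]) (auto intro: Qe_carrier)
qed

lemma edge_form_eq:
  "edge_form \<N> e u w = (LINT s|lebesgue_on {0..len \<N> e}. (\<Sum>i<ncomp \<N> e. \<Sum>j<ncomp \<N> e.
      Qe \<N> e s $$ (i, j) * (u (e, j) s * cnj (w (e, i) s))))"
  unfolding edge_form_def
  by (intro Bochner_Integration.integral_cong refl block_form) (auto intro: Qe_carrier)

lemma edge_form_add:
  assumes "u \<in> edge_states \<N> e" "u' \<in> edge_states \<N> e" "w \<in> edge_states \<N> e"
  shows "edge_form \<N> e (u + u') w = edge_form \<N> e u w + edge_form \<N> e u' w"
proof -
  have "edge_form \<N> e (u + u') w = (LINT s|lebesgue_on {0..len \<N> e}.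
     (Qe \<N> e s *\<^sub>v block \<N> e (\<lambda>j. u j s)) \<bullet>c block \<N> e (\<lambda>j. w j s) +
     (Qe \<N> e s *\<^sub>v block \<N> e (\<lambda>j. u' j s)) \<bullet>c block \<N> e (\<lambda>j. w j s))"
    unfolding edge_form_def
    by (intro Bochner_Integration.integral_cong refl)
      (simp add: block_form[OF Qe_carrier] distrib_left distrib_right sum.distrib)
  then show ?thesis
    unfolding edge_form_def
    using assms by (simp add: Bochner_Integration.integral_add edge_integrand_integrable)
qed

lemma edge_form_scale:
  "edge_form \<N> e (\<lambda>j s. c * u j s) w = c * edge_form \<N> e u w"
  by (simp add: edge_form_eq mult.assoc mult.left_commute[of _ c] flip: sum_distrib_left)

lemma edge_form_cnj: "edge_form \<N> e w u = cnj (edge_form \<N> e u w)"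
proof -
  have "cnj (\<Sum>i<ncomp \<N> e. \<Sum>j<ncomp \<N> e. Qe \<N> e s $$ (i, j) * (u (e, j) s * cnj (w (e, i) s)))
     = (\<Sum>i<ncomp \<N> e. \<Sum>j<ncomp \<N> e. Qe \<N> e s $$ (i, j) * (w (e, j) s * cnj (u (e, i) s)))"
    if "s \<in> {0..len \<N> e}" for s
    using adjoint_entries[OF Qe_adjoint[OF that] Qe_carrier[OF that]]
    by (subst sum.swap) (simp add: mult.commute[of "w _ _"])
  then have "(LINT s|lebesgue_on {0..len \<N> e}. cnj (\<Sum>i<ncomp \<N> e. \<Sum>j<ncomp \<N> e.
      Qe \<N> e s $$ (i, j) * (u (e, j) s * cnj (w (e, i) s)))) = edge_form \<N> e w u"
    unfolding edge_form_eq by (intro Bochner_Integration.integral_cong refl) auto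
  then show ?thesis unfolding Bochner_Integration.integral_cnj edge_form_eq[of u w] by (rule sym)
qed

text \<open>
  Together with the next lemma this compares the form on an edge with the \<open>L\<^sup>2\<close>-norms of its components: below by
  ellipticity of \<open>Q\<^sub>e\<close>, above by boundedness of its continuous entries on a compact interval.
\<close>

lemma edge_form_lower:
  "\<exists>q>0. \<forall>u\<in>edge_states \<N> e.
     0 \<le> Re (edge_form \<N> e u u) \<and>
     (\<forall>i<ncomp \<N> e. q * (LINT s|lebesgue_on {0..len \<N> e}. (cmod (u (e, i) s))\<^sup>2) \<le> Re (edge_form \<N> e u u))"
proof -
  obtain q where q: "q > 0" and ell: "\<And>s \<xi>. s \<in> {0..len \<N> e} \<Longrightarrow> \<xi> \<in> carrier_vec (ncomp \<N> e) \<Longrightarrow>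
    Re ((Qe \<N> e s *\<^sub>v \<xi>) \<bullet>c \<xi>) \<ge> q * Re (\<xi> \<bullet>c \<xi>)" using Qe_elliptic by blast
  have "0 \<le> Re (edge_form \<N> e u u) \<and>
     (\<forall>i<ncomp \<N> e. q * (LINT s|lebesgue_on {0..len \<N> e}. (cmod (u (e, i) s))\<^sup>2) \<le> Re (edge_form \<N> e u u))"
    if u: "u \<in> edge_states \<N> e" for u
  proof -
    let ?F = "\<lambda>s. (Qe \<N> e s *\<^sub>v block \<N> e (\<lambda>j. u j s)) \<bullet>c block \<N> e (\<lambda>j. u j s)"
    have int: "integrable (lebesgue_on {0..len \<N> e}) ?F" using u by (intro edge_integrand_integrable)
    have ReF: "Re (edge_form \<N> e u u) = (LINT s|lebesgue_on {0..len \<N> e}. Re (?F s))"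
      unfolding edge_form_def using int by (rule integral_Re[symmetric])
    have F: "q * (\<Sum>i<ncomp \<N> e. (cmod (u (e, i) s))\<^sup>2) \<le> Re (?F s)" if "s \<in> {0..len \<N> e}" for s
      using ell[OF that, of "block \<N> e (\<lambda>j. u j s)"] by (simp add: block_sq) (simp add: block_def)
    have F0: "0 \<le> Re (?F s)" if "s \<in> {0..len \<N> e}" for s
      using F[OF that] q by (meson mult_nonneg_nonneg order_trans less_imp_le sum_nonneg zero_le_power2)
    have "q * (LINT s|lebesgue_on {0..len \<N> e}. (cmod (u (e, i) s))\<^sup>2) \<le> Re (edge_form \<N> e u u)"
      if i: "i < ncomp \<N> e" for i
    proof -
      have "(cmod (u (e, i) s))\<^sup>2 \<le> (\<Sum>i<ncomp \<N> e. (cmod (u (e, i) s))\<^sup>2)" for s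
        using i by (intro member_le_sum) auto
      then have "q * (cmod (u (e, i) s))\<^sup>2 \<le> Re (?F s)" if "s \<in> {0..len \<N> e}" for s
        using F[OF that] q by (meson mult_left_mono order_trans less_imp_le)
      moreover have "integrable (lebesgue_on {0..len \<N> e}) (\<lambda>s. (cmod (u (e, i) s))\<^sup>2)"
        using u i by (intro L2_integrable) (auto simp: edge_states_def)
      ultimately have "(LINT s|lebesgue_on {0..len \<N> e}. q * (cmod (u (e, i) s))\<^sup>2)
          \<le> (LINT s|lebesgue_on {0..len \<N> e}. Re (?F s))"
        using int by (intro integral_mono) auto
      then show ?thesis by (simp add: ReF)
    qed
    moreover have "0 \<le> Re (edge_form \<N> e u u)"
      unfolding ReF using F0 by (intro integral_nonneg_AE AE_I2) auto
    ultimately show ?thesis by blast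
  qed
  with q show ?thesis by blast
qed

lemma edge_form_upper:
  "\<exists>K. \<forall>u\<in>edge_states \<N> e. Re (edge_form \<N> e u u)
     \<le> K * (\<Sum>i<ncomp \<N> e. LINT s|lebesgue_on {0..len \<N> e}. (cmod (u (e, i) s))\<^sup>2)"
proof -
  let ?n = "ncomp \<N> e" and ?I = "{0..len \<N> e}"
  have "\<exists>K. \<forall>s\<in>?I. cmod (Qe \<N> e s $$ (i, j)) \<le> K" if "i < ?n" "j < ?n" for i j
  proof -
    have "compact ((\<lambda>s. Qe \<N> e s $$ (i, j)) ` ?I)"
      using that by (intro compact_continuous_image lipschitz_mat_continuous[OF Qe_lipschitz]) auto
    then show ?thesis using compact_imp_bounded by (force simp: bounded_iff)
  qed
  then obtain K0 where K0: "\<And>i j s. i < ?n \<Longrightarrow> j < ?n \<Longrightarrow> s \<in> ?I \<Longrightarrow> cmod (Qe \<N> e s $$ (i, j)) \<le> K0 i j"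
    by metis
  define K where "K = (\<Sum>i<?n. \<Sum>j<?n. \<bar>K0 i j\<bar>)"
  have K: "cmod (Qe \<N> e s $$ (i, j)) \<le> K" if "i < ?n" "j < ?n" "s \<in> ?I" for i j s
  proof -
    have "cmod (Qe \<N> e s $$ (i, j)) \<le> \<bar>K0 i j\<bar>" using K0[OF that] by simp
    also have "\<dots> \<le> (\<Sum>j<?n. \<bar>K0 i j\<bar>)" using that by (intro member_le_sum) auto
    also have "\<dots> \<le> K" unfolding K_def
      using that by (intro member_le_sum[of i _ "\<lambda>i. \<Sum>j<?n. \<bar>K0 i j\<bar>"]) (auto intro: sum_nonneg)
    finally show ?thesis .
  qed
  have "0 \<le> K" unfolding K_def by (intro sum_nonneg) auto
  have "Re (edge_form \<N> e u u) \<le> (2 * K * real ?n) * (\<Sum>i<?n. LINT s|lebesgue_on ?I. (cmod (u (e, i) s))\<^sup>2)"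
    if u: "u \<in> edge_states \<N> e" for u
  proof -
    let ?F = "\<lambda>s. (Qe \<N> e s *\<^sub>v block \<N> e (\<lambda>j. u j s)) \<bullet>c block \<N> e (\<lambda>j. u j s)"
    let ?S = "\<lambda>s. \<Sum>i<?n. (cmod (u (e, i) s))\<^sup>2"
    have int: "integrable (lebesgue_on ?I) ?F" using u by (intro edge_integrand_integrable)
    have sq: "integrable (lebesgue_on ?I) (\<lambda>s. (cmod (u (e, i) s))\<^sup>2)" if "i < ?n" for i
      using u that by (intro L2_integrable) (auto simp: edge_states_def)
    have bound: "Re (?F s) \<le> (2 * K * real ?n) * ?S s" if s: "s \<in> ?I" for s
    proof -
      have "Re (?F s) \<le> cmod (\<Sum>i<?n. \<Sum>j<?n. Qe \<N> e s $$ (i, j) * (u (e, j) s * cnj (u (e, i) s)))"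
        unfolding block_form[OF Qe_carrier[OF s]] by (rule complex_Re_le_cmod)
      also have "\<dots> \<le> (\<Sum>i<?n. \<Sum>j<?n. cmod (Qe \<N> e s $$ (i, j) * (u (e, j) s * cnj (u (e, i) s))))"
        by (intro order_trans[OF norm_sum] sum_mono order_refl)
      also have "\<dots> \<le> (\<Sum>i<?n. \<Sum>j<?n. K * ((cmod (u (e, j) s))\<^sup>2 + (cmod (u (e, i) s))\<^sup>2))"
      proof (intro sum_mono)
        fix i j assume ij: "i \<in> {..<?n}" "j \<in> {..<?n}"
        have "cmod (u (e, j) s) * cmod (u (e, i) s) \<le> (cmod (u (e, j) s))\<^sup>2 + (cmod (u (e, i) s))\<^sup>2"
          using sum_squares_bound[of "cmod (u (e, j) s)" "cmod (u (e, i) s)"]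
            mult_nonneg_nonneg[OF norm_ge_zero norm_ge_zero, of "u (e, j) s" "u (e, i) s"] by linarith
        then have "cmod (Qe \<N> e s $$ (i, j)) * (cmod (u (e, j) s) * cmod (u (e, i) s))
          \<le> K * ((cmod (u (e, j) s))\<^sup>2 + (cmod (u (e, i) s))\<^sup>2)"
          using K[of i j s] ij s \<open>0 \<le> K\<close> by (intro mult_mono) auto
        then show "cmod (Qe \<N> e s $$ (i, j) * (u (e, j) s * cnj (u (e, i) s)))
          \<le> K * ((cmod (u (e, j) s))\<^sup>2 + (cmod (u (e, i) s))\<^sup>2)"
          by (simp add: norm_mult)
      qed
      also have "\<dots> = (2 * K * real ?n) * ?S s"
        by (simp add: sum.distrib flip: sum_distrib_left)
      finally show ?thesis .
    qed
    have "Re (edge_form \<N> e u u) = (LINT s|lebesgue_on ?I. Re (?F s))"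
      unfolding edge_form_def using int by (rule integral_Re[symmetric])
    also have "\<dots> \<le> (LINT s|lebesgue_on ?I. (2 * K * real ?n) * ?S s)"
      using int sq bound by (intro integral_mono) auto
    also have "\<dots> = (2 * K * real ?n) * (\<Sum>i<?n. LINT s|lebesgue_on ?I. (cmod (u (e, i) s))\<^sup>2)"
      using sq by (simp add: Bochner_Integration.integral_sum)
    finally show ?thesis .
  qed
  then show ?thesis by blast
qed

end

lemma network_vertexD:
  assumes "network \<N>" "v \<in> Vs \<N>"
  shows "cfun.subspace (Yv \<N> v)" "cfun.subspace (Yd \<N> v)" "Yd \<N> v \<subseteq> Yv \<N> v"
    "Yv \<N> v \<subseteq> cspace (idxv \<N> v)" "Yd \<N> v \<subseteq> cspace (idxv \<N> v)"
    "linear_between (Yv \<N> v) (Yd \<N> v) (Bv \<N> v)"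
    "linear_between (Yd \<N> v) (Yd \<N> v) (Cv \<N> v)"
    "linear_between (Yd \<N> v) (Yd \<N> v) (Qv \<N> v)"
    "\<And>x y. x \<in> Yd \<N> v \<Longrightarrow> y \<in> Yd \<N> v \<Longrightarrow>
      ip (idxv \<N> v) (Qv \<N> v x) y = ip (idxv \<N> v) x (Qv \<N> v y)"
    "\<And>x. x \<in> Yd \<N> v \<Longrightarrow> x \<noteq> 0 \<Longrightarrow> 0 < Re (ip (idxv \<N> v) (Qv \<N> v x) x)"
proof -
  note vertex = bspec[OF assms(1)[unfolded network_def, THEN conjunct2, THEN conjunct2,
      THEN conjunct2, THEN conjunct2] assms(2)]
  show "cfun.subspace (Yv \<N> v)" "cfun.subspace (Yd \<N> v)"
    and sub: "Yd \<N> v \<subseteq> Yv \<N> v" "Yv \<N> v \<subseteq> cspace (idxv \<N> v)"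
    and "linear_between (Yv \<N> v) (Yd \<N> v) (Bv \<N> v)"
      "linear_between (Yd \<N> v) (Yd \<N> v) (Cv \<N> v)"
      "linear_between (Yd \<N> v) (Yd \<N> v) (Qv \<N> v)"
    using vertex by - (elim conjE, assumption)+
  from sub show "Yd \<N> v \<subseteq> cspace (idxv \<N> v)" by (rule order_trans)
  show "\<And>x y. x \<in> Yd \<N> v \<Longrightarrow> y \<in> Yd \<N> v \<Longrightarrow>
      ip (idxv \<N> v) (Qv \<N> v x) y = ip (idxv \<N> v) x (Qv \<N> v y)"
    using vertex by blast
  show "\<And>x. x \<in> Yd \<N> v \<Longrightarrow> x \<noteq> 0 \<Longrightarrow> 0 < Re (ip (idxv \<N> v) (Qv \<N> v x) x)"
    using vertex by blast
qed

lemma network_finite: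
  assumes "network \<N>"
  shows "finite (Es \<N>)" "finite (Vs \<N>)" "finite (idxv \<N> v)"
proof -
  interpret fin_digraph "graph \<N>" using assms by (simp add: network_def)
  show "finite (Es \<N>)" "finite (Vs \<N>)" by auto
  have "idxv \<N> v = Sigma (Ev \<N> v) (\<lambda>e. {..<ncomp \<N> e})" by (auto simp: idxv_def)
  then show "finite (idxv \<N> v)" using \<open>finite (Es \<N>)\<close> by (simp add: Ev_def)
qed

lemma finite_inner_space_Qv:
  assumes net: "network \<N>" and v: "v \<in> Vs \<N>"
  shows "finite_inner_space cscale (Yd \<N> v) (\<lambda>x y. ip (idxv \<N> v) (Qv \<N> v x) y)"
proof unfold_locales
  note lin = network_vertexD(8)[OF assms]
  note sym = network_vertexD(9)[OF assms] and pos = network_vertexD(10)[OF assms]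
  show "cfun.subspace (Yd \<N> v)" by (rule network_vertexD(2)[OF assms])
  show "ip (idxv \<N> v) (Qv \<N> v (x + y)) z = ip (idxv \<N> v) (Qv \<N> v x) z + ip (idxv \<N> v) (Qv \<N> v y) z"
    if "x \<in> Yd \<N> v" "y \<in> Yd \<N> v" for x y z
    using lin that by (metis ip_add_left linear_between_def)
  show "ip (idxv \<N> v) (Qv \<N> v (cscale c x)) z = c * ip (idxv \<N> v) (Qv \<N> v x) z"
    if "x \<in> Yd \<N> v" for c x z
    using lin that by (metis ip_cscale_left linear_between_def)
  show "ip (idxv \<N> v) (Qv \<N> v y) x = cnj (ip (idxv \<N> v) (Qv \<N> v x) y)"
    if "x \<in> Yd \<N> v" "y \<in> Yd \<N> v" for x y
    unfolding sym[OF that] by (rule ip_commute)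
  show "0 < Re (ip (idxv \<N> v) (Qv \<N> v x) x)" if "x \<in> Yd \<N> v" "x \<noteq> 0" for x using pos that .
  show "0 \<le> Re (ip (idxv \<N> v) (Qv \<N> v x) x)" if "x \<in> Yd \<N> v" for x
    using pos[OF that] by (cases "x = 0") (simp_all add: ip_def)
  show "\<exists>A. finite A \<and> A \<subseteq> Yd \<N> v \<and> Yd \<N> v \<subseteq> cfun.span A"
    by (rule subspace_finite_span[OF network_finite(3)[OF net] network_vertexD(2,5)[OF assms]])
qed

section \<open>The state space\<close>

interpretation state: vector_space "scale_d :: complex \<Rightarrow> ('v, 'e) state \<Rightarrow> ('v, 'e) state"
  by unfold_locales (auto simp: scale_d_def fun_eq_iff algebra_simps)

lemma snd_scale_d: "snd (scale_d c f) v = cscale c (snd f v)"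
  by (simp add: scale_d_def cscale_def case_prod_beta)

lemma fst_scale_d: "fst (scale_d c f) = (\<lambda>j s. c * fst f j s)"
  by (simp add: scale_d_def case_prod_beta)

lemma snd_plus: "snd (f + g :: ('v, 'e) state) v = snd f v + snd g v"
  by simp

lemma snd_diff_apply: "snd (f - g :: ('v, 'e) state) v = snd f v - snd g v"
  by simp

lemma L2d_iff: "f \<in> L2d \<N> \<longleftrightarrow>
    (\<forall>e\<in>Es \<N>. fst f \<in> edge_states \<N> e) \<and> (\<forall>v\<in>Vs \<N>. snd f v \<in> Yd \<N> v)"
  by (cases f) (auto simp: L2d_def idx_def edge_states_def Pi_def)

lemma edge_states_add: "u \<in> edge_states \<N> e \<Longrightarrow> w \<in> edge_states \<N> e \<Longrightarrow> u + w \<in> edge_states \<N> e"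
  by (simp add: edge_states_def plus_fun_def L2_add)

lemma edge_states_scale: "u \<in> edge_states \<N> e \<Longrightarrow> (\<lambda>j s. c * u j s) \<in> edge_states \<N> e"
  by (simp add: edge_states_def L2_scale)

context
  fixes \<N> :: "('v, 'e) network"
  assumes net: "network \<N>"
begin

lemma L2d_subspace: "state.subspace (L2d \<N>)"
proof (rule state.subspaceI)
  show "0 \<in> L2d \<N>"
  proof -
    have "(0 :: 'e \<times> nat \<Rightarrow> real \<Rightarrow> complex) \<in> edge_states \<N> e" for e
      by (simp add: edge_states_def zero_fun_def L2_def)
    moreover have "0 \<in> Yd \<N> v" if "v \<in> Vs \<N>" for v
      by (rule cfun.subspace_0[OF network_vertexD(2)[OF net that]])
    ultimately show ?thesis by (simp add: L2d_iff)
  qed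
  show "f + g \<in> L2d \<N>" if "f \<in> L2d \<N>" "g \<in> L2d \<N>" for f g
    using that cfun.subspace_add[OF network_vertexD(2)[OF net]]
    unfolding L2d_iff fst_add snd_plus by (blast intro: edge_states_add)
  show "scale_d c f \<in> L2d \<N>" if "f \<in> L2d \<N>" for c f
    using that cfun.subspace_scale[OF network_vertexD(2)[OF net]]
    unfolding L2d_iff fst_scale_d snd_scale_d by (blast intro: edge_states_scale)
qed

lemma vertex_part_nonneg:
  assumes "f \<in> L2d \<N>" "v \<in> Vs \<N>"
  shows "0 \<le> Re (ip (idxv \<N> v) (Qv \<N> v (snd f v)) (snd f v))"
proof -
  interpret V: finite_inner_space cscale "Yd \<N> v" "\<lambda>x y. ip (idxv \<N> v) (Qv \<N> v x) y"
    using finite_inner_space_Qv[OF net assms(2)] .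
  show ?thesis using assms by (intro V.form_nonneg) (simp add: L2d_iff)
qed

lemma edge_part_nonneg:
  assumes "f \<in> L2d \<N>" "e \<in> Es \<N>"
  shows "0 \<le> Re (edge_form \<N> e (fst f) (fst f))"
  using edge_form_lower[OF net assms(2)] assms by (auto simp: L2d_iff)

lemma Re_inner_d: "Re (inner_d \<N> f f) = (\<Sum>e\<in>Es \<N>. Re (edge_form \<N> e (fst f) (fst f))) +
     (\<Sum>v\<in>Vs \<N>. Re (ip (idxv \<N> v) (Qv \<N> v (snd f v)) (snd f v)))"
  by (simp add: inner_d_eq)

lemma semi_inner_space_L2d: "semi_inner_space scale_d (L2d \<N>) (inner_d \<N>)"
proof unfold_locales
  show "state.subspace (L2d \<N>)" by (rule L2d_subspace)
  fix f g h :: "('v, 'e) state" and c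
  assume f: "f \<in> L2d \<N>" and g: "g \<in> L2d \<N>"
  show "0 \<le> Re (inner_d \<N> f f)"
    unfolding Re_inner_d using vertex_part_nonneg edge_part_nonneg f
    by (intro add_nonneg_nonneg sum_nonneg)
  show "inner_d \<N> (scale_d c f) g = c * inner_d \<N> f g"
  proof -
    have "edge_form \<N> e (fst (scale_d c f)) (fst g) = c * edge_form \<N> e (fst f) (fst g)" if "e \<in> Es \<N>" for e
      unfolding fst_scale_d by (rule edge_form_scale[OF net that])
    moreover have "ip (idxv \<N> v) (Qv \<N> v (snd (scale_d c f) v)) (snd g v)
      = c * ip (idxv \<N> v) (Qv \<N> v (snd f v)) (snd g v)" if v: "v \<in> Vs \<N>" for v
    proof -
      interpret V: finite_inner_space cscale "Yd \<N> v" "\<lambda>x y. ip (idxv \<N> v) (Qv \<N> v x) y"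
        using finite_inner_space_Qv[OF net v] .
      show ?thesis unfolding snd_scale_d using f g v by (intro V.form_sc) (auto simp: L2d_iff)
    qed
    ultimately show ?thesis by (simp add: inner_d_eq sum_distrib_left distrib_left)
  qed
  show "inner_d \<N> g f = cnj (inner_d \<N> f g)"
  proof -
    have "edge_form \<N> e (fst g) (fst f) = cnj (edge_form \<N> e (fst f) (fst g))" if "e \<in> Es \<N>" for e
      by (rule edge_form_cnj[OF net that])
    moreover have "ip (idxv \<N> v) (Qv \<N> v (snd g v)) (snd f v)
      = cnj (ip (idxv \<N> v) (Qv \<N> v (snd f v)) (snd g v))" if v: "v \<in> Vs \<N>" for v
    proof -
      interpret V: finite_inner_space cscale "Yd \<N> v" "\<lambda>x y. ip (idxv \<N> v) (Qv \<N> v x) y"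
        using finite_inner_space_Qv[OF net v] .
      show ?thesis using f g v by (intro V.form_cnj) (auto simp: L2d_iff)
    qed
    ultimately show ?thesis unfolding inner_d_eq complex_cnj_add cnj_sum by (simp cong: sum.cong)
  qed
  assume h: "h \<in> L2d \<N>"
  show "inner_d \<N> (f + g) h = inner_d \<N> f h + inner_d \<N> g h"
  proof -
    have "edge_form \<N> e (fst (f + g)) (fst h) = edge_form \<N> e (fst f) (fst h) + edge_form \<N> e (fst g) (fst h)"
      if "e \<in> Es \<N>" for e
      unfolding fst_add using f g h that by (intro edge_form_add[OF net that]) (auto simp: L2d_iff)
    moreover have "ip (idxv \<N> v) (Qv \<N> v (snd (f + g) v)) (snd h v)
      = ip (idxv \<N> v) (Qv \<N> v (snd f v)) (snd h v) + ip (idxv \<N> v) (Qv \<N> v (snd g v)) (snd h v)"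
      if v: "v \<in> Vs \<N>" for v
    proof -
      interpret V: finite_inner_space cscale "Yd \<N> v" "\<lambda>x y. ip (idxv \<N> v) (Qv \<N> v x) y"
        using finite_inner_space_Qv[OF net v] .
      show ?thesis unfolding snd_plus using f g h v by (intro V.form_add) (auto simp: L2d_iff)
    qed
    ultimately show ?thesis by (simp add: inner_d_eq sum.distrib)
  qed
qed

lemma norm_d_sq: "f \<in> L2d \<N> \<Longrightarrow> (norm_d \<N> f)\<^sup>2 = Re (inner_d \<N> f f)"
  using semi_inner_space.form_nonneg[OF semi_inner_space_L2d] by (simp add: norm_d_def)

lemma edge_part_le:
  assumes f: "f \<in> L2d \<N>" and e: "e \<in> Es \<N>"
  shows "Re (edge_form \<N> e (fst f) (fst f)) \<le> (norm_d \<N> f)\<^sup>2"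
proof -
  have "Re (edge_form \<N> e (fst f) (fst f)) \<le> (\<Sum>e\<in>Es \<N>. Re (edge_form \<N> e (fst f) (fst f)))"
    using e f edge_part_nonneg network_finite[OF net]
    by (intro member_le_sum[of e "Es \<N>" "\<lambda>e. Re (edge_form \<N> e (fst f) (fst f))"]) auto
  moreover have "0 \<le> (\<Sum>v\<in>Vs \<N>. Re (ip (idxv \<N> v) (Qv \<N> v (snd f v)) (snd f v)))"
    using f vertex_part_nonneg by (intro sum_nonneg)
  ultimately show ?thesis unfolding norm_d_sq[OF f] Re_inner_d by linarith
qed

lemma vertex_part_le:
  assumes f: "f \<in> L2d \<N>" and v: "v \<in> Vs \<N>"
  shows "Re (ip (idxv \<N> v) (Qv \<N> v (snd f v)) (snd f v)) \<le> (norm_d \<N> f)\<^sup>2"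
proof -
  have "Re (ip (idxv \<N> v) (Qv \<N> v (snd f v)) (snd f v))
     \<le> (\<Sum>v\<in>Vs \<N>. Re (ip (idxv \<N> v) (Qv \<N> v (snd f v)) (snd f v)))"
    using v f vertex_part_nonneg network_finite[OF net]
    by (intro member_le_sum[of v "Vs \<N>" "\<lambda>v. Re (ip (idxv \<N> v) (Qv \<N> v (snd f v)) (snd f v))"]) auto
  moreover have "0 \<le> (\<Sum>e\<in>Es \<N>. Re (edge_form \<N> e (fst f) (fst f)))"
    using f edge_part_nonneg by (intro sum_nonneg)
  ultimately show ?thesis unfolding norm_d_sq[OF f] Re_inner_d by linarith
qed

lemma norm_d_zeroD:
  assumes f: "f \<in> L2d \<N>" and null: "norm_d \<N> f = 0"
  shows "e \<in> Es \<N> \<Longrightarrow> i < ncomp \<N> e \<Longrightarrow> AE s in lebesgue_on {0..len \<N> e}. fst f (e, i) s = 0"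
    and "v \<in> Vs \<N> \<Longrightarrow> snd f v = 0"
proof -
  assume e: "e \<in> Es \<N>" and i: "i < ncomp \<N> e"
  have fe: "fst f \<in> edge_states \<N> e" using f e by (simp add: L2d_iff)
  then have int: "integrable (lebesgue_on {0..len \<N> e}) (\<lambda>s. (cmod (fst f (e, i) s))\<^sup>2)"
    using i by (intro L2_integrable) (simp add: edge_states_def)
  obtain q where q: "q > 0" "q * (LINT s|lebesgue_on {0..len \<N> e}. (cmod (fst f (e, i) s))\<^sup>2)
      \<le> Re (edge_form \<N> e (fst f) (fst f))"
    using edge_form_lower[OF net e] fe i by blast
  then have "q * (LINT s|lebesgue_on {0..len \<N> e}. (cmod (fst f (e, i) s))\<^sup>2) \<le> 0"
    using edge_part_le[OF f e] null by simp
  moreover have "0 \<le> (LINT s|lebesgue_on {0..len \<N> e}. (cmod (fst f (e, i) s))\<^sup>2)" by simp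
  ultimately have "(LINT s|lebesgue_on {0..len \<N> e}. (cmod (fst f (e, i) s))\<^sup>2) = 0"
    using q(1) by (simp add: mult_le_0_iff)
  then show "AE s in lebesgue_on {0..len \<N> e}. fst f (e, i) s = 0"
    using integral_nonneg_eq_0_iff_AE[OF int] by simp
next
  assume v: "v \<in> Vs \<N>"
  interpret V: finite_inner_space cscale "Yd \<N> v" "\<lambda>x y. ip (idxv \<N> v) (Qv \<N> v x) y"
    using finite_inner_space_Qv[OF net v] .
  have "snd f v \<in> Yd \<N> v" using f v by (simp add: L2d_iff)
  from V.definite[OF this] show "snd f v = 0"
    using vertex_part_le[OF f v] null by (cases "snd f v = 0") auto
qed

text \<open>
  Fast Cauchy sequences of states are fast Cauchy in each edge component and at each vertex; the limits found there are
  assembled to a state.  Convergence in \<open>norm_d\<close> follows since there are finitely many edges and vertices.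
\<close>

lemma banach_L2d: "banach_seminormed_space scale_d (L2d \<N>) (norm_d \<N>)"
proof -
  interpret semi_inner_space scale_d "L2d \<N>" "inner_d \<N>" by (rule semi_inner_space_L2d)
  have snorm: "snorm = norm_d \<N>" by (simp add: snorm_def norm_d_def fun_eq_iff)
  show ?thesis
  proof (intro banach_seminormed_space.intro banach_seminormed_space_axioms.intro)
    show "seminormed_space scale_d (L2d \<N>) (norm_d \<N>)"
      using seminormed_space_axioms unfolding snorm .
    fix f :: "nat \<Rightarrow> ('v, 'e) state"
    assume f: "\<And>n. f n \<in> L2d \<N>" and fast: "\<And>n. norm_d \<N> (f (Suc n) - f n) \<le> (1/2) ^ n"
    have step: "(norm_d \<N> (f (Suc n) - f n))\<^sup>2 \<le> (1/4) ^ n" for n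
    proof -
      have "(norm_d \<N> (f (Suc n) - f n))\<^sup>2 \<le> ((1/2) ^ n)\<^sup>2"
        using fast nrm_nonneg[of "f (Suc n) - f n"] f unfolding snorm by (intro power_mono) auto
      also have "\<dots> = (1/4 :: real) ^ n" by (simp add: power2_eq_square flip: power_mult_distrib)
      finally show ?thesis .
    qed
    have "\<exists>g\<in>L2 (len \<N> e). (\<lambda>n. LINT s|lebesgue_on {0..len \<N> e}. (cmod (fst (f n) (e, i) s - g s))\<^sup>2) \<longlonglongrightarrow> 0"
      if e: "e \<in> Es \<N>" and i: "i < ncomp \<N> e" for e i
    proof -
      obtain q where q: "q > 0" "\<And>u. u \<in> edge_states \<N> e \<Longrightarrow>
        q * (LINT s|lebesgue_on {0..len \<N> e}. (cmod (u (e, i) s))\<^sup>2) \<le> Re (edge_form \<N> e u u)"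
        using edge_form_lower[OF net e] i by blast
      have fe: "fst (f n) \<in> edge_states \<N> e" for n using f[of n] e by (simp add: L2d_iff)
      then have L2: "fst (f n) (e, i) \<in> L2 (len \<N> e)" for n using i by (simp add: edge_states_def)
      have "(LINT s|lebesgue_on {0..len \<N> e}. (cmod (fst (f (Suc n)) (e, i) s - fst (f n) (e, i) s))\<^sup>2)
         \<le> (1 / q) * (1/4) ^ n" for n
      proof -
        have d: "f (Suc n) - f n \<in> L2d \<N>" using f by simp
        have "q * (LINT s|lebesgue_on {0..len \<N> e}. (cmod (fst (f (Suc n) - f n) (e, i) s))\<^sup>2)
          \<le> Re (edge_form \<N> e (fst (f (Suc n) - f n)) (fst (f (Suc n) - f n)))"
          using d[unfolded L2d_iff] e by (intro q(2)) blast
        also have "\<dots> \<le> (norm_d \<N> (f (Suc n) - f n))\<^sup>2" by (rule edge_part_le[OF d e])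
        also have "\<dots> \<le> (1/4) ^ n" by (rule step)
        finally show ?thesis using q(1) by (simp add: field_simps)
      qed
      from square_integrable_fast_limit[OF L2_measurable[OF L2] L2_integrable[OF L2] this]
      show ?thesis by (auto intro: L2_I)
    qed
    then have "\<forall>p\<in>idx \<N>. \<exists>g. g \<in> L2 (len \<N> (fst p)) \<and>
        (\<lambda>n. LINT s|lebesgue_on {0..len \<N> (fst p)}. (cmod (fst (f n) p s - g s))\<^sup>2) \<longlonglongrightarrow> 0"
      by (force simp: idx_def)
    from bchoice[OF this] obtain g where "\<forall>p\<in>idx \<N>. g p \<in> L2 (len \<N> (fst p)) \<and>
        (\<lambda>n. LINT s|lebesgue_on {0..len \<N> (fst p)}. (cmod (fst (f n) p s - g p s))\<^sup>2) \<longlonglongrightarrow> 0" ..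
    then have g: "\<And>e i. e \<in> Es \<N> \<Longrightarrow> i < ncomp \<N> e \<Longrightarrow> g (e, i) \<in> L2 (len \<N> e)"
      "\<And>e i. e \<in> Es \<N> \<Longrightarrow> i < ncomp \<N> e \<Longrightarrow>
        (\<lambda>n. LINT s|lebesgue_on {0..len \<N> e}. (cmod (fst (f n) (e, i) s - g (e, i) s))\<^sup>2) \<longlonglongrightarrow> 0"
      unfolding idx_def by auto
    have "\<exists>y\<in>Yd \<N> v. (\<lambda>n. Re (ip (idxv \<N> v) (Qv \<N> v (snd (f n) v - y)) (snd (f n) v - y))) \<longlonglongrightarrow> 0"
      if v: "v \<in> Vs \<N>" for v
    proof -
      interpret V: finite_inner_space cscale "Yd \<N> v" "\<lambda>x y. ip (idxv \<N> v) (Qv \<N> v x) y"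
        using finite_inner_space_Qv[OF net v] .
      have fv: "snd (f n) v \<in> Yd \<N> v" for n using f[of n] v by (simp add: L2d_iff)
      have "V.snorm (snd (f (Suc n)) v - snd (f n) v) \<le> (1/2) ^ n" for n
      proof -
        have d: "f (Suc n) - f n \<in> L2d \<N>" using f by simp
        have "(V.snorm (snd (f (Suc n)) v - snd (f n) v))\<^sup>2 \<le> (norm_d \<N> (f (Suc n) - f n))\<^sup>2"
          using vertex_part_le[OF d v] V.form_nonneg[OF V.X_diff[OF fv fv, of "Suc n" n]]
          unfolding snd_diff_apply V.snorm_def by (subst real_sqrt_pow2)
        then have "V.snorm (snd (f (Suc n)) v - snd (f n) v) \<le> norm_d \<N> (f (Suc n) - f n)"
          using nrm_nonneg[OF d] unfolding snorm by (rule power2_le_imp_le)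
        then show ?thesis using fast[of n] by linarith
      qed
      from V.fast_Cauchy[of "\<lambda>n. snd (f n) v", OF fv this] obtain y
        where y: "y \<in> Yd \<N> v" "(\<lambda>n. V.snorm (snd (f n) v - y)) \<longlonglongrightarrow> 0" by blast
      have "(\<lambda>n. (V.snorm (snd (f n) v - y))\<^sup>2) \<longlonglongrightarrow> 0\<^sup>2" using y(2) by (rule tendsto_power)
      moreover have "(V.snorm (snd (f n) v - y))\<^sup>2
         = Re (ip (idxv \<N> v) (Qv \<N> v (snd (f n) v - y)) (snd (f n) v - y))" for n
        using V.form_nonneg[OF V.X_diff[OF fv y(1)]] unfolding V.snorm_def by (rule real_sqrt_pow2)
      ultimately show ?thesis using y(1) by (simp only: power_zero_numeral) blast
    qed
    then have "\<forall>v\<in>Vs \<N>. \<exists>y. y \<in> Yd \<N> v \<and>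
        (\<lambda>n. Re (ip (idxv \<N> v) (Qv \<N> v (snd (f n) v - y)) (snd (f n) v - y))) \<longlonglongrightarrow> 0"
      by blast
    from bchoice[OF this] obtain y where "\<forall>v\<in>Vs \<N>. y v \<in> Yd \<N> v \<and>
        (\<lambda>n. Re (ip (idxv \<N> v) (Qv \<N> v (snd (f n) v - y v)) (snd (f n) v - y v))) \<longlonglongrightarrow> 0" ..
    then have y: "\<And>v. v \<in> Vs \<N> \<Longrightarrow> y v \<in> Yd \<N> v"
      "\<And>v. v \<in> Vs \<N> \<Longrightarrow> (\<lambda>n. Re (ip (idxv \<N> v) (Qv \<N> v (snd (f n) v - y v)) (snd (f n) v - y v))) \<longlonglongrightarrow> 0"
      by blast+
    define z where "z = ((g, y) :: ('v, 'e) state)"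
    have z: "z \<in> L2d \<N>" using g(1) y(1) by (simp add: L2d_iff z_def edge_states_def)
    have "(\<lambda>n. Re (edge_form \<N> e (fst (f n - z)) (fst (f n - z)))) \<longlonglongrightarrow> 0" if e: "e \<in> Es \<N>" for e
    proof -
      obtain K where K: "\<And>u. u \<in> edge_states \<N> e \<Longrightarrow> Re (edge_form \<N> e u u)
        \<le> K * (\<Sum>i<ncomp \<N> e. LINT s|lebesgue_on {0..len \<N> e}. (cmod (u (e, i) s))\<^sup>2)"
        using edge_form_upper[OF net e] by blast
      have d: "f n - z \<in> L2d \<N>" for n using f z by simp
      have le: "Re (edge_form \<N> e (fst (f n - z)) (fst (f n - z)))
        \<le> K * (\<Sum>i<ncomp \<N> e. LINT s|lebesgue_on {0..len \<N> e}. (cmod (fst (f n) (e, i) s - g (e, i) s))\<^sup>2)" for n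
      proof -
        have "fst (f n - z) \<in> edge_states \<N> e" using d[of n, unfolded L2d_iff] e by blast
        from K[OF this] show ?thesis by (simp add: z_def)
      qed
      have "(\<lambda>n. K * (\<Sum>i<ncomp \<N> e. LINT s|lebesgue_on {0..len \<N> e}.
          (cmod (fst (f n) (e, i) s - g (e, i) s))\<^sup>2)) \<longlonglongrightarrow> 0"
        using g(2)[OF e] by (intro tendsto_mult_right_zero tendsto_null_sum) auto
      then show ?thesis
        by (rule tendsto_sandwich[OF always_eventually always_eventually tendsto_const, rotated 2])
          (use edge_part_nonneg[OF d e] le in auto)
    qed
    then have "(\<lambda>n. (\<Sum>e\<in>Es \<N>. Re (edge_form \<N> e (fst (f n - z)) (fst (f n - z)))) +
       (\<Sum>v\<in>Vs \<N>. Re (ip (idxv \<N> v) (Qv \<N> v (snd (f n - z) v)) (snd (f n - z) v)))) \<longlonglongrightarrow> 0 + 0"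
    proof (intro tendsto_add tendsto_null_sum)
      show "(\<lambda>n. Re (ip (idxv \<N> v) (Qv \<N> v (snd (f n - z) v)) (snd (f n - z) v))) \<longlonglongrightarrow> 0"
        if "v \<in> Vs \<N>" for v
        using y(2)[OF that] unfolding snd_diff_apply z_def snd_conv .
    qed
    then have "(\<lambda>n. sqrt (Re (inner_d \<N> (f n - z) (f n - z)))) \<longlonglongrightarrow> sqrt (0 + 0)"
      unfolding Re_inner_d by (rule tendsto_real_sqrt)
    then have "(\<lambda>n. norm_d \<N> (f n - z)) \<longlonglongrightarrow> 0" unfolding norm_d_def by simp
    with z show "\<exists>z\<in>L2d \<N>. (\<lambda>n. norm_d \<N> (f n - z)) \<longlonglongrightarrow> 0" by blast
  qed
qed

end

section \<open>Conjugation of states\<close>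

definition cnj_state :: "('v, 'e) state \<Rightarrow> ('v, 'e) state" where
  "cnj_state f = (\<lambda>j s. cnj (fst f j s), \<lambda>v. cnjf (snd f v))"

lemma cnj_state_add: "cnj_state (f + g) = cnj_state f + cnj_state g"
  by (simp add: cnj_state_def cnjf_def plus_fun_def)

lemma cnj_state_diff: "cnj_state (f - g) = cnj_state f - cnj_state g"
  by (simp add: cnj_state_def cnjf_def fun_diff_def)

lemma cnj_state_scale: "cnj_state (scale_d c f) = scale_d (cnj c) (cnj_state f)"
  by (simp add: cnj_state_def cnjf_def scale_d_def case_prod_beta)

lemma cnj_state_cnj_state: "cnj_state (cnj_state f) = f"
  by (simp add: cnj_state_def)

lemma weak_derivative_cnj:
  assumes "weak_derivative l f g"
  shows "weak_derivative l (\<lambda>s. cnj (f s)) (\<lambda>s. cnj (g s))"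
  unfolding weak_derivative_def
proof (intro allI impI)
  fix \<phi> assume "test_function l \<phi>"
  then have eq: "(LINT s|lebesgue_on {0..l}. f s * complex_of_real (deriv \<phi> s)) =
        - (LINT s|lebesgue_on {0..l}. g s * complex_of_real (\<phi> s))"
    using assms by (simp add: weak_derivative_def)
  have cnj_int: "(LINT s|lebesgue_on {0..l}. cnj (h s) * complex_of_real (r s))
      = cnj (LINT s|lebesgue_on {0..l}. h s * complex_of_real (r s))" for h and r :: "real \<Rightarrow> real"
    by (simp flip: Bochner_Integration.integral_cnj)
  show "(LINT s|lebesgue_on {0..l}. cnj (f s) * complex_of_real (deriv \<phi> s)) =
        - (LINT s|lebesgue_on {0..l}. cnj (g s) * complex_of_real (\<phi> s))"
    unfolding cnj_int eq by simp
qed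

lemma H1_cnj:
  assumes "f \<in> H1 l"
  shows "(\<lambda>s. cnj (f s)) \<in> H1 l"
proof -
  obtain g where "f \<in> L2 l" "continuous_on {0..l} f" "g \<in> L2 l" "weak_derivative l f g"
    using assms by (auto simp: H1_def)
  then have "(\<lambda>s. cnj (f s)) \<in> L2 l" "continuous_on {0..l} (\<lambda>s. cnj (f s))"
    "(\<lambda>s. cnj (g s)) \<in> L2 l" "weak_derivative l (\<lambda>s. cnj (f s)) (\<lambda>s. cnj (g s))"
    by (auto intro: L2_cnj continuous_on_cnj weak_derivative_cnj)
  then show ?thesis unfolding H1_def by blast
qed

lemma gamma_cnj: "gamma \<N> v (\<lambda>j s. cnj (u j s)) = cnjf (gamma \<N> v u)"
  by (auto simp: gamma_def cnjf_def fun_eq_iff)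

lemma block_mult_index:
  assumes "A \<in> carrier_mat (ncomp \<N> e) (ncomp \<N> e)" "i < ncomp \<N> e"
  shows "(A *\<^sub>v block \<N> e \<xi>) $ i = (\<Sum>j<ncomp \<N> e. A $$ (i, j) * \<xi> (e, j))"
  using assms by (simp add: block_def scalar_prod_def row_def atLeast0LessThan)

lemma elements_mat_real:
  assumes "elements_mat A \<subseteq> \<real>" "A \<in> carrier_mat n n" "i < n" "j < n"
  shows "cnj (A $$ (i, j)) = A $$ (i, j)"
proof -
  have "A $$ (i, j) \<in> elements_mat A" using assms(2-4) by blast
  then show ?thesis using assms(1) by (auto simp: Reals_cnj_iff)
qed

text \<open>
  The integral commutes with conjugation for arbitrary functions, since it is zero for those that
  are not integrable; so \<open>u\<close> and \<open>w\<close> are unrestricted.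
\<close>

lemma edge_form_cnj_args:
  assumes "network \<N>" "e \<in> Es \<N>" and Q: "\<forall>s\<in>{0..len \<N> e}. elements_mat (Qe \<N> e s) \<subseteq> \<real>"
  shows "edge_form \<N> e (\<lambda>j s. cnj (u j s)) (\<lambda>j s. cnj (w j s)) = cnj (edge_form \<N> e u w)"
proof -
  have "edge_form \<N> e (\<lambda>j s. cnj (u j s)) (\<lambda>j s. cnj (w j s))
    = (LINT s|lebesgue_on {0..len \<N> e}. cnj (\<Sum>i<ncomp \<N> e. \<Sum>j<ncomp \<N> e.
        Qe \<N> e s $$ (i, j) * (u (e, j) s * cnj (w (e, i) s))))"
    unfolding edge_form_eq[OF assms(1,2)]
    using Q elements_mat_real[OF _ Qe_carrier[OF assms(1,2)]]
    by (intro Bochner_Integration.integral_cong refl) (simp add: Q)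
  then show ?thesis unfolding Bochner_Integration.integral_cnj edge_form_eq[OF assms(1,2), of u w] .
qed

lemma norm_d_null:
  assumes net: "network \<N>" and f: "f \<in> L2d \<N>"
    and u: "\<And>e i. e \<in> Es \<N> \<Longrightarrow> i < ncomp \<N> e \<Longrightarrow> AE s in lebesgue_on {0..len \<N> e}. fst f (e, i) s = 0"
    and x: "\<And>v. v \<in> Vs \<N> \<Longrightarrow> snd f v = 0"
  shows "norm_d \<N> f = 0"
proof -
  have "Re (edge_form \<N> e (fst f) (fst f)) = 0" if e: "e \<in> Es \<N>" for e
  proof -
    have fe: "fst f \<in> edge_states \<N> e" using f e by (simp add: L2d_iff)
    obtain K where "Re (edge_form \<N> e (fst f) (fst f))
        \<le> K * (\<Sum>i<ncomp \<N> e. LINT s|lebesgue_on {0..len \<N> e}. (cmod (fst f (e, i) s))\<^sup>2)"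
      using edge_form_upper[OF net e] fe by blast
    moreover have "(LINT s|lebesgue_on {0..len \<N> e}. (cmod (fst f (e, i) s))\<^sup>2) = 0" if "i < ncomp \<N> e" for i
      using u[OF e that] by (intro integral_eq_zero_AE) auto
    ultimately have "Re (edge_form \<N> e (fst f) (fst f)) \<le> 0" by simp
    with edge_part_nonneg[OF net f e] show ?thesis by simp
  qed
  moreover have "Re (ip (idxv \<N> v) (Qv \<N> v (snd f v)) (snd f v)) = 0" if "v \<in> Vs \<N>" for v
    using x[OF that] by (simp add: ip_def)
  ultimately have "Re (inner_d \<N> f f) = 0" unfolding Re_inner_d[OF net] by simp
  then show ?thesis by (simp add: norm_d_def)
qed

context
  fixes \<N> :: "('v, 'e) network"
  assumes net: "network \<N>"
    and Yv_re: "\<forall>\<xi>\<in>Pi (Vs \<N>) (Yv \<N>). re_vec \<xi> \<in> Pi (Vs \<N>) (Yv \<N>)"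
    and Yd_re: "\<forall>x\<in>Pi (Vs \<N>) (Yd \<N>). re_vec x \<in> Pi (Vs \<N>) (Yd \<N>)"
    and Qe_real: "\<forall>e\<in>Es \<N>. \<forall>s\<in>{0..len \<N> e}. elements_mat (Qe \<N> e s) \<subseteq> \<real>"
    and vertex_real: "\<forall>v\<in>Vs \<N>. real_matrix_on (idxv \<N> v) (Yd \<N> v) (Qv \<N> v) \<and>
                    real_matrix_on (idxv \<N> v) (Yv \<N> v) (Bv \<N> v) \<and>
                    real_matrix_on (idxv \<N> v) (Yd \<N> v) (Cv \<N> v)"
    and Me_real: "\<forall>e\<in>Es \<N>. \<forall>s\<in>{0..len \<N> e}. elements_mat (Me \<N> e s) \<subseteq> \<real>"
    and Ne_real: "\<forall>e\<in>Es \<N>. AE s in lebesgue_on {0..len \<N> e}. elements_mat (Ne \<N> e s) \<subseteq> \<real>"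
begin

lemma Yv_cnjf: "v \<in> Vs \<N> \<Longrightarrow> \<xi> \<in> Yv \<N> v \<Longrightarrow> cnjf \<xi> \<in> Yv \<N> v"
  by (rule cnjf_closed[OF Yv_re network_vertexD(1)[OF net]])

lemma Yd_cnjf: "v \<in> Vs \<N> \<Longrightarrow> x \<in> Yd \<N> v \<Longrightarrow> cnjf x \<in> Yd \<N> v"
  by (rule cnjf_closed[OF Yd_re network_vertexD(2)[OF net]])

lemma linear_between_cspace:
  "v \<in> Vs \<N> \<Longrightarrow> linear_between U (Yd \<N> v) F \<Longrightarrow> \<xi> \<in> U \<Longrightarrow> F \<xi> \<in> cspace (idxv \<N> v)"
  using network_vertexD(5)[OF net] unfolding linear_between_def by blast

lemma Qv_cnjf: "v \<in> Vs \<N> \<Longrightarrow> x \<in> Yd \<N> v \<Longrightarrow> Qv \<N> v (cnjf x) = cnjf (Qv \<N> v x)"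
  using vertex_real Yd_cnjf linear_between_cspace[OF _ network_vertexD(8)[OF net]]
  by (intro real_matrix_on_cnjf[where I = "idxv \<N> v" and U = "Yd \<N> v"]) blast+

lemma Cv_cnjf: "v \<in> Vs \<N> \<Longrightarrow> x \<in> Yd \<N> v \<Longrightarrow> Cv \<N> v (cnjf x) = cnjf (Cv \<N> v x)"
  using vertex_real Yd_cnjf linear_between_cspace[OF _ network_vertexD(7)[OF net]]
  by (intro real_matrix_on_cnjf[where I = "idxv \<N> v" and U = "Yd \<N> v"]) blast+

lemma Bv_cnjf: "v \<in> Vs \<N> \<Longrightarrow> \<xi> \<in> Yv \<N> v \<Longrightarrow> Bv \<N> v (cnjf \<xi>) = cnjf (Bv \<N> v \<xi>)"
  using vertex_real Yv_cnjf linear_between_cspace[OF _ network_vertexD(6)[OF net]]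
  by (intro real_matrix_on_cnjf[where I = "idxv \<N> v" and U = "Yv \<N> v"]) blast+

lemma Pd_cnjf: "v \<in> Vs \<N> \<Longrightarrow> Pd \<N> v (cnjf \<xi>) = cnjf (Pd \<N> v \<xi>)"
  unfolding Pd_def
  by (rule proj_cnjf[OF network_finite(3)[OF net] network_vertexD(2,5)[OF net] Yd_cnjf])

text \<open>
  Only the vertex components are constrained, so that the lemma also covers differences with members of the
  graph of \<open>op_A\<close>, whose edge components are prescribed merely almost everywhere.
\<close>

lemma norm_d_cnj_state:
  assumes "\<And>v. v \<in> Vs \<N> \<Longrightarrow> snd f v \<in> Yd \<N> v"
  shows "norm_d \<N> (cnj_state f) = norm_d \<N> f"
proof -
  have "edge_form \<N> e (fst (cnj_state f)) (fst (cnj_state f)) = cnj (edge_form \<N> e (fst f) (fst f))"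
    if "e \<in> Es \<N>" for e
    unfolding cnj_state_def fst_conv using edge_form_cnj_args[OF net that] Qe_real that by blast
  moreover have "ip (idxv \<N> v) (Qv \<N> v (snd (cnj_state f) v)) (snd (cnj_state f) v)
      = cnj (ip (idxv \<N> v) (Qv \<N> v (snd f v)) (snd f v))" if "v \<in> Vs \<N>" for v
    unfolding cnj_state_def snd_conv Qv_cnjf[OF that assms[OF that]] by (rule ip_cnjf)
  ultimately have "inner_d \<N> (cnj_state f) (cnj_state f) = cnj (inner_d \<N> f f)"
    unfolding inner_d_eq complex_cnj_add cnj_sum by (simp cong: sum.cong)
  then show ?thesis by (simp add: norm_d_def)
qed

lemma cnj_state_L2d:
  assumes "f \<in> L2d \<N>"
  shows "cnj_state f \<in> L2d \<N>"
  using assms unfolding L2d_iff cnj_state_def edge_states_def fst_conv snd_conv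
  by (auto intro: L2_cnj Yd_cnjf)

text \<open>
  All ingredients commute with conjugation: weak derivatives because test functions are real, traces trivially, the
  projections because \<open>Y\<^sub>v\<^sup>d\<close> is closed under conjugation, and the coefficients because they are real.
\<close>

lemma cnj_state_op_A:
  assumes "(f, g) \<in> op_A \<N>"
  shows "(cnj_state f, cnj_state g) \<in> op_A \<N>"
proof -
  obtain u x w y where f: "f = (u, x)" and g: "g = (w, y)" by (cases f, cases g) blast
  have dom: "(u, x) \<in> dom_A \<N>" and yv: "\<forall>v\<in>Vs \<N>. y v = Bv \<N> v (gamma \<N> v u) + Cv \<N> v (x v)"
    using assms by (auto simp: f g op_A_def)
  obtain u' where "\<forall>(e, i)\<in>idx \<N>. u' (e, i) \<in> L2 (len \<N> e) \<and>
              weak_derivative (len \<N> e) (u (e, i)) (u' (e, i))"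
     "\<forall>(e, i)\<in>idx \<N>. AE s in lebesgue_on {0..len \<N> e}.
              w (e, i) s = (Me \<N> e s *\<^sub>v block \<N> e (\<lambda>j. u' j s) +
                            Ne \<N> e s *\<^sub>v block \<N> e (\<lambda>j. u j s)) $ i"
    using assms unfolding f g op_A_def by blast
  then have u': "\<And>e i. (e, i) \<in> idx \<N> \<Longrightarrow> u' (e, i) \<in> L2 (len \<N> e) \<and>
              weak_derivative (len \<N> e) (u (e, i)) (u' (e, i))"
    and w: "\<And>e i. (e, i) \<in> idx \<N> \<Longrightarrow> AE s in lebesgue_on {0..len \<N> e}.
              w (e, i) s = (Me \<N> e s *\<^sub>v block \<N> e (\<lambda>j. u' j s) +
                            Ne \<N> e s *\<^sub>v block \<N> e (\<lambda>j. u j s)) $ i"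
    by blast+
  have H1: "\<And>e i. (e, i) \<in> idx \<N> \<Longrightarrow> u (e, i) \<in> H1 (len \<N> e)"
    and x: "\<And>v. v \<in> Vs \<N> \<Longrightarrow> x v \<in> Yd \<N> v"
    and \<gamma>: "\<And>v. v \<in> Vs \<N> \<Longrightarrow> gamma \<N> v u \<in> Yv \<N> v" "\<And>v. v \<in> Vs \<N> \<Longrightarrow> x v = Pd \<N> v (gamma \<N> v u)"
    using dom unfolding dom_A_def by blast+
  let ?cu = "\<lambda>j s. cnj (u j s)" and ?cu' = "\<lambda>j s. cnj (u' j s)"
    and ?cx = "\<lambda>v. cnjf (x v)"
  have "(?cu, ?cx) \<in> dom_A \<N>"
  proof -
    have "?cu (e, i) \<in> H1 (len \<N> e)" if "(e, i) \<in> idx \<N>" for e i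
      by (rule H1_cnj[OF H1[OF that]])
    moreover have "?cx v \<in> Yd \<N> v" if "v \<in> Vs \<N>" for v
      by (rule Yd_cnjf[OF that x[OF that]])
    moreover have "gamma \<N> v ?cu \<in> Yv \<N> v" if "v \<in> Vs \<N>" for v
      unfolding gamma_cnj by (rule Yv_cnjf[OF that \<gamma>(1)[OF that]])
    moreover have "?cx v = Pd \<N> v (gamma \<N> v ?cu)" if "v \<in> Vs \<N>" for v
      unfolding gamma_cnj Pd_cnjf[OF that] \<gamma>(2)[OF that] ..
    ultimately show ?thesis unfolding dom_A_def by blast
  qed
  moreover have "?cu' (e, i) \<in> L2 (len \<N> e) \<and> weak_derivative (len \<N> e) (?cu (e, i)) (?cu' (e, i))"
    if "(e, i) \<in> idx \<N>" for e i
    using u'[OF that] by (auto intro: L2_cnj weak_derivative_cnj)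
  moreover have "AE s in lebesgue_on {0..len \<N> e}. cnj (w (e, i) s) =
      (Me \<N> e s *\<^sub>v block \<N> e (\<lambda>j. ?cu' j s) + Ne \<N> e s *\<^sub>v block \<N> e (\<lambda>j. ?cu j s)) $ i"
    if ei: "(e, i) \<in> idx \<N>" for e i
  proof -
    have e: "e \<in> Es \<N>" and i: "i < ncomp \<N> e" using ei by (auto simp: idx_def)
    have Me: "\<And>s. s \<in> {0..len \<N> e} \<Longrightarrow> Me \<N> e s \<in> carrier_mat (ncomp \<N> e) (ncomp \<N> e)"
      and Ne: "\<And>s. s \<in> {0..len \<N> e} \<Longrightarrow> Ne \<N> e s \<in> carrier_mat (ncomp \<N> e) (ncomp \<N> e)"
      using net e unfolding network_def lipschitz_mat_def Linfty_mat_def by blast+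
    have Ne_ae: "AE s in lebesgue_on {0..len \<N> e}. elements_mat (Ne \<N> e s) \<subseteq> \<real>" using Ne_real e by blast
    have "AE s in lebesgue_on {0..len \<N> e}. s \<in> {0..len \<N> e}"
      using AE_space[of "lebesgue_on {0..len \<N> e}"] by simp
    with Ne_ae w[OF ei] show ?thesis
    proof eventually_elim
      fix s
      assume Nr: "elements_mat (Ne \<N> e s) \<subseteq> \<real>" and s: "s \<in> {0..len \<N> e}"
        and ws: "w (e, i) s = (Me \<N> e s *\<^sub>v block \<N> e (\<lambda>j. u' j s) +
                            Ne \<N> e s *\<^sub>v block \<N> e (\<lambda>j. u j s)) $ i"
      have Mr: "elements_mat (Me \<N> e s) \<subseteq> \<real>" using Me_real e s by blast
      have rows: "(Me \<N> e s *\<^sub>v block \<N> e \<xi> + Ne \<N> e s *\<^sub>v block \<N> e \<eta>) $ i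
         = (\<Sum>j<ncomp \<N> e. Me \<N> e s $$ (i, j) * \<xi> (e, j)) + (\<Sum>j<ncomp \<N> e. Ne \<N> e s $$ (i, j) * \<eta> (e, j))"
        for \<xi> \<eta>
        using i Me[OF s] Ne[OF s] block_mult_index[OF Me[OF s] i] block_mult_index[OF Ne[OF s] i]
        by (subst index_add_vec(1)) auto
      show "cnj (w (e, i) s) =
        (Me \<N> e s *\<^sub>v block \<N> e (\<lambda>j. ?cu' j s) + Ne \<N> e s *\<^sub>v block \<N> e (\<lambda>j. ?cu j s)) $ i"
        unfolding ws rows
        by (simp add: elements_mat_real[OF Mr Me[OF s] i] elements_mat_real[OF Nr Ne[OF s] i])
    qed
  qed
  moreover have "cnjf (y v) = Bv \<N> v (gamma \<N> v ?cu) + Cv \<N> v (?cx v)" if v: "v \<in> Vs \<N>" for v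
    unfolding gamma_cnj Bv_cnjf[OF v \<gamma>(1)[OF v]] Cv_cnjf[OF v x[OF v]] bspec[OF yv v] by (rule cnjf_add)
  ultimately have "((?cu, ?cx), (\<lambda>j s. cnj (w j s), \<lambda>v. cnjf (y v))) \<in> op_A \<N>"
    unfolding op_A_def Ball_def split_paired_All mem_Collect_eq prod.case
    by (intro conjI exI[of _ ?cu']) blast+
  then show ?thesis by (simp add: f g cnj_state_def)
qed

lemma op_A_vertex_in:
  assumes "(f, g) \<in> op_A \<N>" "v \<in> Vs \<N>"
  shows "snd f v \<in> Yd \<N> v" "snd g v \<in> Yd \<N> v"
proof -
  obtain u x w y where fg: "f = (u, x)" "g = (w, y)" by (cases f, cases g) blast
  have dom: "(u, x) \<in> dom_A \<N>" and y: "y v = Bv \<N> v (gamma \<N> v u) + Cv \<N> v (x v)"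
    using assms by (auto simp: fg op_A_def)
  have x: "x v \<in> Yd \<N> v" "gamma \<N> v u \<in> Yv \<N> v" using dom assms(2) unfolding dom_A_def by blast+
  then show "snd f v \<in> Yd \<N> v" by (simp add: fg)
  have "Bv \<N> v (gamma \<N> v u) \<in> Yd \<N> v" "Cv \<N> v (x v) \<in> Yd \<N> v"
    using network_vertexD(6,7)[OF net assms(2)] x by (auto simp: linear_between_def)
  then show "snd g v \<in> Yd \<N> v"
    unfolding fg snd_conv y by (rule cfun.subspace_add[OF network_vertexD(2)[OF net assms(2)]])
qed

lemma cnj_state_generator:
  assumes gen: "generated_semigroup \<N> S"
    and fg: "(f, g) \<in> generator (L2d \<N>) scale_d (norm_d \<N>) S"
  shows "(cnj_state f, cnj_state g) \<in> generator (L2d \<N>) scale_d (norm_d \<N>) S"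
proof -
  have eq: "generator (L2d \<N>) scale_d (norm_d \<N>) S =
       {(f, g). f \<in> L2d \<N> \<and> g \<in> L2d \<N> \<and>
         (\<exists>(f', g')\<in>op_A \<N>. norm_d \<N> (f - f') = 0 \<and> norm_d \<N> (g - g') = 0)}"
    using gen unfolding generated_semigroup_def generated_by_def by blast
  obtain f' g' where f: "f \<in> L2d \<N>" and g: "g \<in> L2d \<N>" and A: "(f', g') \<in> op_A \<N>"
    and null: "norm_d \<N> (f - f') = 0" "norm_d \<N> (g - g') = 0"
    using fg unfolding eq by blast
  have "snd (f - f') v \<in> Yd \<N> v" "snd (g - g') v \<in> Yd \<N> v" if v: "v \<in> Vs \<N>" for v
  proof -
    have "snd f v \<in> Yd \<N> v" "snd g v \<in> Yd \<N> v" using f g v by (simp_all add: L2d_iff)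
    with op_A_vertex_in[OF A v] show "snd (f - f') v \<in> Yd \<N> v" "snd (g - g') v \<in> Yd \<N> v"
      using cfun.subspace_diff[OF network_vertexD(2)[OF net v]] unfolding snd_diff_apply by blast+
  qed
  then have "norm_d \<N> (cnj_state f - cnj_state f') = 0" "norm_d \<N> (cnj_state g - cnj_state g') = 0"
    using null unfolding cnj_state_diff[symmetric] by (simp_all only: norm_d_cnj_state)
  then show ?thesis
    unfolding eq using cnj_state_L2d[OF f] cnj_state_L2d[OF g] cnj_state_op_A[OF A] by blast
qed

text \<open>
  This identifies the real states with the fixed points of conjugation, up to null elements, and so turns the
  invariance of the real states into a commutation relation.
\<close>

lemma real_states_iff:
  assumes f: "f \<in> L2d \<N>"
  shows "f \<in> real_states \<N> \<longleftrightarrow> norm_d \<N> (cnj_state f - f) = 0"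
proof -
  interpret L2d: banach_seminormed_space scale_d "L2d \<N>" "norm_d \<N>" by (rule banach_L2d[OF net])
  have d: "cnj_state f - f \<in> L2d \<N>" using f cnj_state_L2d[OF f] by (intro L2d.X_diff)
  have u: "fst (cnj_state f - f) (e, i) s = 0 \<longleftrightarrow> fst f (e, i) s \<in> \<real>" for e i s
    by (simp add: cnj_state_def Reals_cnj_iff)
  have x: "snd (cnj_state f - f) v = 0 \<longleftrightarrow> (\<forall>j\<in>idxv \<N> v. snd f v j \<in> \<real>)" if v: "v \<in> Vs \<N>" for v
  proof -
    have "snd f v \<in> cspace (idxv \<N> v)" using f v network_vertexD(5)[OF net v] by (auto simp: L2d_iff)
    then have zero: "snd f v j = 0" if "j \<notin> idxv \<N> v" for j
      using that unfolding cspace_def by blast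
    have "snd (cnj_state f - f) v = 0 \<longleftrightarrow> (\<forall>j. snd f v j \<in> \<real>)"
      by (simp add: cnj_state_def cnjf_def fun_eq_iff Reals_cnj_iff)
    also have "\<dots> \<longleftrightarrow> (\<forall>j\<in>idxv \<N> v. snd f v j \<in> \<real>)"
      using zero by (metis Reals_0)
    finally show ?thesis .
  qed
  have real: "f \<in> real_states \<N> \<longleftrightarrow>
      (\<forall>e\<in>Es \<N>. \<forall>i<ncomp \<N> e. AE s in lebesgue_on {0..len \<N> e}. fst f (e, i) s \<in> \<real>) \<and>
      (\<forall>v\<in>Vs \<N>. \<forall>j\<in>idxv \<N> v. snd f v j \<in> \<real>)"
    using f by (cases f) (auto simp: real_states_def idx_def)
  show ?thesis
  proof
    assume "f \<in> real_states \<N>"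
    then show "norm_d \<N> (cnj_state f - f) = 0"
      unfolding real using u x by (intro norm_d_null[OF net d]) auto
  next
    assume "norm_d \<N> (cnj_state f - f) = 0"
    from norm_d_zeroD[OF net d this] show "f \<in> real_states \<N>"
      unfolding real u using x by blast
  qed
qed

lemma generated_semigroup_real:
  assumes gen: "generated_semigroup \<N> S"
  shows "real_semigroup \<N> S"
  unfolding real_semigroup_def
proof (intro allI impI ballI)
  fix t :: real and f assume t: "0 \<le> t" and real: "f \<in> real_states \<N>"
  have C0: "C0_semigroup (L2d \<N>) scale_d (norm_d \<N>) S"
    using gen unfolding generated_semigroup_def generated_by_def by blast
  interpret L2d: banach_seminormed_space scale_d "L2d \<N>" "norm_d \<N>" by (rule banach_L2d[OF net])
  interpret S: C0_semigroup_on scale_d "L2d \<N>" "norm_d \<N>" S by unfold_locales (rule C0)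
  have f: "f \<in> L2d \<N>" using real unfolding real_states_def by blast
  note cf = cnj_state_L2d[OF f]
  have "norm_d \<N> (cnj_state (S t f) - S t (cnj_state f)) = 0"
  proof (rule L2d.semigroup_commutes_with_conjugation[OF C0])
    show "norm_d \<N> (cnj_state h) = norm_d \<N> h" if "h \<in> L2d \<N>" for h
      using that by (intro norm_d_cnj_state) (simp add: L2d_iff)
  qed (use t f in \<open>auto intro: cnj_state_L2d cnj_state_add cnj_state_scale cnj_state_cnj_state
      cnj_state_generator[OF gen]\<close>)
  moreover have "norm_d \<N> (S t (cnj_state f) - S t f) = 0"
  proof -
    obtain K where "\<forall>h\<in>L2d \<N>. norm_d \<N> (S t h) \<le> K * norm_d \<N> h" using S.S_bounded[OF t] by blast
    then have "norm_d \<N> (S t (cnj_state f - f)) \<le> K * norm_d \<N> (cnj_state f - f)"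
      using L2d.X_diff[OF cf f] by blast
    also have "\<dots> = 0" using real unfolding real_states_iff[OF f] by simp
    finally have "norm_d \<N> (S t (cnj_state f) - S t f) \<le> 0"
      unfolding S.nrm_S_diff[OF t cf f] .
    then show ?thesis
      using L2d.nrm_nonneg[OF L2d.X_diff[OF S.S_in[OF t cf] S.S_in[OF t f]]] by (rule order_antisym)
  qed
  ultimately have "norm_d \<N> (cnj_state (S t f) - S t f) = 0"
    by (rule L2d.null_trans[OF cnj_state_L2d[OF S.S_in[OF t f]] S.S_in[OF t cf] S.S_in[OF t f]])
  then show "S t f \<in> real_states \<N>" unfolding real_states_iff[OF S.S_in[OF t f]] .
qed

end

theorem proposition4p2:
  fixes \<N> :: "('v, 'e) network"
    and W YB WK :: "'v \<Rightarrow> ('e \<times> nat \<Rightarrow> complex) set"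
    and S :: "real \<Rightarrow> ('v, 'e) state \<Rightarrow> ('v, 'e) state"
  assumes "network \<N>"
    and "vertex_bases \<N> W YB WK"
    and "(is_basis (W_tilde \<N> W YB WK) (cspace (idx \<N>)) \<and>
          (\<exists>c\<ge>0. \<forall>v\<in>Vs \<N>. \<forall>\<xi>\<in>Yv \<N> v. vertex_form \<N> c v \<xi> \<le> 0)) \<or>
         (\<exists>c\<ge>0. \<exists>\<mu>\<ge>0. \<forall>v\<in>Vs \<N>.
            (\<forall>\<xi>\<in>Yd \<N> v. vertex_form \<N> c v \<xi> \<le> 0) \<and>
            (\<forall>(\<xi>, y)\<in>Y_star \<N> v. dual_form \<N> \<mu> v \<xi> y \<le> 0))"
    and "\<forall>\<xi>\<in>Pi (Vs \<N>) (Yv \<N>). re_vec \<xi> \<in> Pi (Vs \<N>) (Yv \<N>)"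
    and "\<forall>x\<in>Pi (Vs \<N>) (Yd \<N>). re_vec x \<in> Pi (Vs \<N>) (Yd \<N>)"
    and "\<forall>e\<in>Es \<N>. \<forall>s\<in>{0..len \<N> e}. elements_mat (Qe \<N> e s) \<subseteq> \<real>"
    and "\<forall>v\<in>Vs \<N>. real_matrix_on (idxv \<N> v) (Yd \<N> v) (Qv \<N> v) \<and>
                    real_matrix_on (idxv \<N> v) (Yv \<N> v) (Bv \<N> v) \<and>
                    real_matrix_on (idxv \<N> v) (Yd \<N> v) (Cv \<N> v)"
    and "generated_semigroup \<N> S"
    and "\<forall>e\<in>Es \<N>. \<forall>s\<in>{0..len \<N> e}. elements_mat (Me \<N> e s) \<subseteq> \<real>"
    and "\<forall>e\<in>Es \<N>. AE s in lebesgue_on {0..len \<N> e}. elements_mat (Ne \<N> e s) \<subseteq> \<real>"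
  shows "real_semigroup \<N> S"
  using assms by (intro generated_semigroup_real)

end
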